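(* Let $m\ge 2$ and $n\ge 2$ be integers and let $G\le\mathfrak{S}_n$ be a subgroup. If $G\le \mathfrak{S}_{n-k}\times \mathfrak{S}_k$ for some integer $k$ with $2\le k\le n-1$, then \[\mathsf{TC}_m(B_n^G)\ge m(n-1)-k+1.\] Furthermore, if $G\le \mathfrak{S}_{n-1}\times \{1\}$, then \[\mathsf{TC}_m(B_n^G)\ge m(n-1)-1.\]
   Context: Braid groups: for $n\ge 2$, $B_n$ is Artin's full braid group on $n$ strands, i.e. the group of isotopy classes (rel boundary) of geometric braids with $n$ strands, generated by $\sigma_1,\dots,\sigma_{n-1}$, where $\sigma_i$ passes the $i$th strand over the $(i+1)$st strand. Let $\mathfrak{S}_n$ be the symmetric group on $\{1,\dots,n\}$ and $\pi\colon B_n\to\mathfrak{S}_n$ the canonical epimorphism sending a braid to the associated permutation of its endpoints, so $\pi(\sigma_i)=(i\;\,i+1)$. For a subgroup $G\le\mathfrak{S}_n$, $B_n^G:=\pi^{-1}(G)\le B_n$. For $1\le k\le n-1$, $\mathfrak{S}_{n-k}\times\mathfrak{S}_k\le\mathfrak{S}_n$ denotes the subgroup of permutations preserving the partition of the $n$ objects into the first $n-k$ and the last $k$ objects. $\mathfrak{S}_{n-1}\times\{1\}\le\mathfrak{S}_n$ denotes the subgroup of permutations fixing the last object. Higher topological complexity (reduced version): for a space $X$ and an integer $m\ge 2$, let $p^m_X\colon X^I\to X^m$ be the fibration \[p^m_X(\gamma) = (\gamma(0),\gamma(1/(m-1)),\ldots,\gamma((m-2)/(m-1)),\gamma(1)),\]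 where $I=[0,1]$. $\mathsf{TC}_m(X)$ is the minimal $k$ such that $X^m$ admits a cover by $k+1$ open sets $U_0,\dots,U_k$, on each of which there exists a continuous local section of $p^m_X$. This is a homotopy invariant. For a discrete group $\Gamma$, $\mathsf{TC}_m(\Gamma):=\mathsf{TC}_m(K(\Gamma,1))$, where $K(\Gamma,1)$ is an Eilenberg--Mac Lane space (connected CW-complex with fundamental group $\Gamma$ and trivial higher homotopy groups). *)

theory Defs
  imports "HOL-Analysis.Analysis" "HOL-Algebra.Sym_Groups" "HOL-Algebra.Elementary_Groups"
begin

text \<open>Maps between abstract topologies are made extensional, so that two of them are equal
  as soon as they agree on the underlying space. The choice \<open>K = {}\<close> in the subbase
  shows that every continuous map is a point of the space.\<close>

definition compact_open_topology :: "'a topology \<Rightarrow> 'b topology \<Rightarrow> ('a \<Rightarrow> 'b) topology" where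
  "compact_open_topology X Y =
     topology_generated_by
       {{f \<in> extensional (topspace X). continuous_map X Y f \<and> f ` K \<subseteq> U} | K U.
          compactin X K \<and> openin Y U}"

definition free_path_space :: "'a topology \<Rightarrow> (real \<Rightarrow> 'a) topology" where
  "free_path_space X = compact_open_topology (top_of_set {0..1}) X"

definition power_space :: "nat \<Rightarrow> 'a topology \<Rightarrow> (nat \<Rightarrow> 'a) topology" where
  "power_space m X = product_topology (\<lambda>_. X) {..<m}"

definition path_fibration :: "nat \<Rightarrow> (real \<Rightarrow> 'a) \<Rightarrow> (nat \<Rightarrow> 'a)" where
  "path_fibration m \<gamma> = (\<lambda>i\<in>{..<m}. \<gamma> (real i / real (m - 1)))"

definition has_local_section :: "nat \<Rightarrow> 'a topology \<Rightarrow> (nat \<Rightarrow> 'a) set \<Rightarrow> bool" where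
  "has_local_section m X U \<longleftrightarrow>
     (\<exists>s. continuous_map (subtopology (power_space m X) U) (free_path_space X) s \<and>
          (\<forall>x\<in>U. path_fibration m (s x) = x))"

text \<open>The value is \<open>\<infinity>\<close> if there is no finite cover of the required kind.\<close>

definition higher_TC :: "nat \<Rightarrow> 'a topology \<Rightarrow> enat" where
  "higher_TC m X =
     Inf {enat k | k. \<exists>U. (\<forall>i\<le>k. openin (power_space m X) (U i) \<and> has_local_section m X (U i)) \<and>
                         (\<Union>i\<le>k. U i) = topspace (power_space m X)}"

definition cube :: "nat \<Rightarrow> (nat \<Rightarrow> real) topology" where
  "cube k = product_topology (\<lambda>_. top_of_set {0..1}) {..<k}"

definition cube_boundary :: "nat \<Rightarrow> (nat \<Rightarrow> real) set" where
  "cube_boundary k = {y \<in> topspace (cube k). \<exists>i<k. y i = 0 \<or> y i = 1}"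

definition spheroids :: "nat \<Rightarrow> 'a topology \<Rightarrow> 'a \<Rightarrow> ((nat \<Rightarrow> real) \<Rightarrow> 'a) set" where
  "spheroids k X x0 = {f. continuous_map (cube k) X f \<and> f ` cube_boundary k \<subseteq> {x0}}"

definition spheroid_homotopic ::
  "nat \<Rightarrow> 'a topology \<Rightarrow> 'a \<Rightarrow> ((nat \<Rightarrow> real) \<Rightarrow> 'a) \<Rightarrow> ((nat \<Rightarrow> real) \<Rightarrow> 'a) \<Rightarrow> bool" where
  "spheroid_homotopic k X x0 f g \<longleftrightarrow>
     homotopic_with (\<lambda>h. h ` cube_boundary k \<subseteq> {x0}) (cube k) X f g"

definition spheroid_concat ::
  "((nat \<Rightarrow> real) \<Rightarrow> 'a) \<Rightarrow> ((nat \<Rightarrow> real) \<Rightarrow> 'a) \<Rightarrow> (nat \<Rightarrow> real) \<Rightarrow> 'a" where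
  "spheroid_concat f g y =
     (if y 0 \<le> 1/2 then f (y(0 := 2 * y 0)) else g (y(0 := 2 * y 0 - 1)))"

text \<open>Meaningful for \<open>k \<ge> 1\<close>; the fundamental group is the case \<open>k = 1\<close>. The spheroids are
  not extensional here, but maps that agree on the cube are homotopic and hence
  have the same class.\<close>

definition homotopy_group ::
  "nat \<Rightarrow> 'a topology \<Rightarrow> 'a \<Rightarrow> ((nat \<Rightarrow> real) \<Rightarrow> 'a) set monoid" where
  "homotopy_group k X x0 =
     \<lparr> carrier = spheroids k X x0 // {(f, g). spheroid_homotopic k X x0 f g},
       mult = (\<lambda>A B. {h. \<exists>f\<in>A. \<exists>g\<in>B. spheroid_homotopic k X x0 (spheroid_concat f g) h}),
       one = {h. spheroid_homotopic k X x0 (\<lambda>_. x0) h} \<rparr>"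

definition unit_disc :: "nat \<Rightarrow> (nat \<Rightarrow> real) set" where
  "unit_disc d = {x \<in> topspace (Euclidean_space d). (\<Sum>i<d. x i ^ 2) \<le> 1}"

definition open_unit_disc :: "nat \<Rightarrow> (nat \<Rightarrow> real) set" where
  "open_unit_disc d = {x \<in> topspace (Euclidean_space d). (\<Sum>i<d. x i ^ 2) < 1}"

definition unit_sphere :: "nat \<Rightarrow> (nat \<Rightarrow> real) set" where
  "unit_sphere d = {x \<in> topspace (Euclidean_space d). (\<Sum>i<d. x i ^ 2) = 1}"

text \<open>A CW structure in Whitehead's form: \<open>E\<close> is the set of open cells, \<open>d e\<close> the dimension and
  \<open>\<Phi> e\<close> the characteristic map of the cell \<open>e\<close>. The image of the closed disc
  under \<open>\<Phi> e\<close> is the closed cell, as \<open>X\<close> is Hausdorff.\<close>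

definition CW_structure ::
  "'a topology \<Rightarrow> 'a set set \<Rightarrow> ('a set \<Rightarrow> nat) \<Rightarrow> ('a set \<Rightarrow> (nat \<Rightarrow> real) \<Rightarrow> 'a) \<Rightarrow> bool" where
  "CW_structure X E d \<Phi> \<longleftrightarrow>
     Hausdorff_space X \<and> disjoint E \<and> \<Union>E = topspace X \<and>
     (\<forall>e\<in>E.
        continuous_map (subtopology (Euclidean_space (d e)) (unit_disc (d e))) X (\<Phi> e) \<and>
        homeomorphic_map (subtopology (Euclidean_space (d e)) (open_unit_disc (d e)))
          (subtopology X e) (\<Phi> e) \<and>
        (\<exists>F. finite F \<and> F \<subseteq> E \<and> (\<forall>f\<in>F. d f < d e) \<and> \<Phi> e ` unit_sphere (d e) \<subseteq> \<Union>F)) \<and>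
     (\<forall>A. A \<subseteq> topspace X \<and> (\<forall>e\<in>E. closedin X (A \<inter> \<Phi> e ` unit_disc (d e))) \<longrightarrow> closedin X A)"

definition CW_complex :: "'a topology \<Rightarrow> bool" where
  "CW_complex X \<longleftrightarrow> (\<exists>E d \<Phi>. CW_structure X E d \<Phi>)"

text \<open>\<open>X\<close> is a \<open>K(\<Gamma>,1)\<close>. The space is connected, so one base point suffices.\<close>

definition Eilenberg_MacLane_1 :: "('g, 'h) monoid_scheme \<Rightarrow> 'a topology \<Rightarrow> bool" where
  "Eilenberg_MacLane_1 \<Gamma> X \<longleftrightarrow>
     CW_complex X \<and> connected_space X \<and>
     (\<exists>x0\<in>topspace X.
        homotopy_group 1 X x0 \<cong> \<Gamma> \<and> (\<forall>k\<ge>2. trivial_group (homotopy_group k X x0)))"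

text \<open>A geometric braid in \<open>\<complex> \<times> [0,1]\<close> is given by its \<open>n\<close> strands: \<open>\<beta> i t\<close> is the
  point at height \<open>t\<close> of the strand that starts at the point \<open>i\<close>. Only the values for
  \<open>i \<in> {1..n}\<close> and \<open>t \<in> {0..1}\<close> matter.\<close>

definition geometric_braid :: "nat \<Rightarrow> (nat \<Rightarrow> real \<Rightarrow> complex) \<Rightarrow> bool" where
  "geometric_braid n \<beta> \<longleftrightarrow>
     (\<forall>i\<in>{1..n}. continuous_on {0..1} (\<beta> i)) \<and>
     (\<forall>t\<in>{0..1}. inj_on (\<lambda>i. \<beta> i t) {1..n}) \<and>
     (\<forall>i\<in>{1..n}. \<beta> i 0 = of_nat i) \<and>
     (\<lambda>i. \<beta> i 1) ` {1..n} = of_nat ` {1..n}"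

definition braid_isotopic ::
  "nat \<Rightarrow> (nat \<Rightarrow> real \<Rightarrow> complex) \<Rightarrow> (nat \<Rightarrow> real \<Rightarrow> complex) \<Rightarrow> bool" where
  "braid_isotopic n \<beta> \<gamma> \<longleftrightarrow>
     (\<exists>H :: real \<Rightarrow> nat \<Rightarrow> real \<Rightarrow> complex.
        (\<forall>i\<in>{1..n}. continuous_on ({0..1} \<times> {0..1}) (\<lambda>(s, t). H s i t)) \<and>
        (\<forall>s\<in>{0..1}. geometric_braid n (H s)) \<and>
        (\<forall>s\<in>{0..1}. \<forall>i\<in>{1..n}. H s i 0 = \<beta> i 0 \<and> H s i 1 = \<beta> i 1) \<and>
        (\<forall>i\<in>{1..n}. \<forall>t\<in>{0..1}. H 0 i t = \<beta> i t \<and> H 1 i t = \<gamma> i t))"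

definition braid_perm :: "nat \<Rightarrow> (nat \<Rightarrow> real \<Rightarrow> complex) \<Rightarrow> nat \<Rightarrow> nat" where
  "braid_perm n \<beta> i =
     (if i \<in> {1..n} then THE j. j \<in> {1..n} \<and> \<beta> i 1 = of_nat j else i)"

text \<open>Stacking, with the right factor traversed first. With this order the permutation of a
  product is the composite of the permutations in \<^const>\<open>sym_group\<close>, whose product is
  \<open>\<circ>\<close>. The other order gives the opposite, hence an isomorphic, group, and the same
  preimages of subgroups.\<close>

definition braid_comp ::
  "nat \<Rightarrow> (nat \<Rightarrow> real \<Rightarrow> complex) \<Rightarrow> (nat \<Rightarrow> real \<Rightarrow> complex) \<Rightarrow> nat \<Rightarrow> real \<Rightarrow> complex" where
  "braid_comp n \<alpha> \<beta> i t =
     (if t \<le> 1/2 then \<beta> i (2 * t) else \<alpha> (braid_perm n \<beta> i) (2 * t - 1))"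

definition braid_group :: "nat \<Rightarrow> (nat \<Rightarrow> real \<Rightarrow> complex) set monoid" where
  "braid_group n =
     \<lparr> carrier = {\<beta>. geometric_braid n \<beta>} // {(\<beta>, \<gamma>). braid_isotopic n \<beta> \<gamma>},
       mult = (\<lambda>A B. {\<gamma>. \<exists>\<alpha>\<in>A. \<exists>\<beta>\<in>B. braid_isotopic n (braid_comp n \<alpha> \<beta>) \<gamma>}),
       one = {\<gamma>. braid_isotopic n (\<lambda>i t. of_nat i) \<gamma>} \<rparr>"

text \<open>The canonical map to the symmetric group; all braids in a class have the same
  permutation, since isotopies fix the end points.\<close>

definition braid_proj :: "nat \<Rightarrow> (nat \<Rightarrow> real \<Rightarrow> complex) set \<Rightarrow> nat \<Rightarrow> nat" where
  "braid_proj n A = the_elem (braid_perm n ` A)"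

definition braid_subgroup ::
  "nat \<Rightarrow> (nat \<Rightarrow> nat) set \<Rightarrow> (nat \<Rightarrow> real \<Rightarrow> complex) set monoid" where
  "braid_subgroup n G =
     (braid_group n)\<lparr>carrier := {A \<in> carrier (braid_group n). braid_proj n A \<in> G}\<rparr>"

definition sym_partition_subgroup :: "nat \<Rightarrow> nat \<Rightarrow> (nat \<Rightarrow> nat) set" where
  "sym_partition_subgroup n k =
     {p \<in> carrier (sym_group n). p ` {1..n - k} = {1..n - k} \<and> p ` {n - k + 1..n} = {n - k + 1..n}}"

definition sym_fix_last_subgroup :: "nat \<Rightarrow> (nat \<Rightarrow> nat) set" where
  "sym_fix_last_subgroup n = {p \<in> carrier (sym_group n). p n = n}"

end

theory Submission imports Defs "HOL-Complex_Analysis.Winding_Numbers" begin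

text \<open>The bound is detected by tori in the power space that come from commuting pure braids.

  Let the centre be one of the points \<open>1\<close> and \<open>n\<close> of
  \<open>{1..n}\<close>, so that no two points have the same distance to it. In a planetary braid
  the other points revolve round the centre, each on its own orbit. As the orbits are disjoint, the
  order of the revolutions does not matter, and planetary braids with the same centre commute
  (\<open>planetary_commute\<close>). They are pure, and the winding number of the difference of two
  strands is the number of revolutions of the outer one (\<open>planetary_winding\<close>). Isotopy
  invariance and additivity of winding numbers make this an invariant of elements of the braid
  group.

  Let \<open>X\<close> be the aspherical space. Commuting elements of its fundamental group extend
  cell by cell to a map from Euclidean space to \<open>X\<close> that is invariant under integer
  translations (\<open>periodic_map_exists\<close>). With the centre \<open>n\<close> and all other
  points revolving this gives a map \<open>\<Phi>\<close> of rank \<open>n - 1\<close>; with the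
  centre \<open>1\<close> and only the points from \<open>2\<close> to \<open>n - k + 1\<close>
  revolving it gives a map \<open>\<Psi>\<close> of rank \<open>n - k\<close>. Together,
  \<open>\<Phi>\<close> in the first \<open>m - 1\<close> factors and \<open>\<Psi>\<close> in the
  last one form a periodic map to the \<open>m\<close>-fold power, on a space of dimension \<open>d
  = (m - 1) * (n - 1) + (n - k)\<close>.

  Suppose that \<open>d\<close> open sets with local sections cover the power. Their preimages form
  a periodic open cover of the \<open>d\<close>-dimensional space, and by a form of the covering
  dimension of the torus one of them contains a path from a point to its translate by an integer
  vector \<open>v \<noteq> 0\<close> (\<open>periodic_open_cover\<close>). The section over this
  path consists of paths in \<open>X\<close> that join the coordinates; it shows that the loop given
  by \<open>v\<close> in any of the first factors is conjugate to the one in the last factor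
  (\<open>conjugate_rays\<close>). Conjugation by a loop whose braid has the permutation
  \<open>p\<close> renumbers the linking numbers by \<open>p\<close>. The strands \<open>i \<ge> n -
  k + 2\<close> are unlinked in \<open>\<Psi>\<close>. If \<open>p\<close> sends one of them to
  \<open>n\<close> or \<open>n - 1\<close>, then the strand \<open>n\<close> or \<open>n - 1\<close>
  is unlinked in \<open>\<Phi>\<close>. But every revolving point is linked with both of these
  strands, or with the other one if it is one of them. Hence \<open>v = 0\<close>, a contradiction
  (\<open>free_torus_action\<close>).

  Both kinds of subgroups provide such an \<open>i\<close> for each permutation \<open>p\<close>. If
  \<open>p\<close> preserves the last \<open>k \<ge> 2\<close> points, then \<open>n\<close> and
  \<open>n - 1\<close> have preimages among these, and one of the two is not \<open>n - k +
  1\<close>. If \<open>p\<close> fixes \<open>n\<close>, then \<open>i = n\<close> serves for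
  \<open>k = 2\<close>.\<close>

section \<open>Gluing continuous maps\<close>

lemma continuous_map_glue_homotopies:
  fixes T :: "'t::topological_space set" and X :: "'a topology"
  assumes F: "continuous_map (top_of_set ({0..1::real} \<times> T)) X F"
    and G: "continuous_map (top_of_set ({0..1::real} \<times> T)) X G"
    and FG: "\<And>y. y \<in> T \<Longrightarrow> F (1, y) = G (0, y)"
  shows "continuous_map (top_of_set ({0..1} \<times> T)) X
           (\<lambda>z. if fst z \<le> 1/2 then F (2 * fst z, snd z) else G (2 * fst z - 1, snd z))"
proof (rule continuous_map_cases_le)
  show "continuous_map (top_of_set ({0..1} \<times> T)) euclideanreal fst"
    by (auto intro: continuous_intros)
  show "continuous_map (top_of_set ({0..1} \<times> T)) euclideanreal (\<lambda>z. 1/2)"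
    by simp
  have "continuous_map (subtopology (top_of_set ({0..1} \<times> T)) {x \<in> topspace (top_of_set ({0..1} \<times> T)). fst x \<le> 1 / 2}) X
     (F \<circ> (\<lambda>z. (2 * fst z, snd z)))"
    by (rule continuous_map_compose[OF _ F])
       (auto simp: subtopology_subtopology intro!: continuous_intros)
  then show "continuous_map (subtopology (top_of_set ({0..1} \<times> T)) {x \<in> topspace (top_of_set ({0..1} \<times> T)). fst x \<le> 1 / 2}) X
     (\<lambda>z. F (2 * fst z, snd z))" by (simp add: o_def)
  have "continuous_map (subtopology (top_of_set ({0..1} \<times> T)) {x \<in> topspace (top_of_set ({0..1} \<times> T)). 1 / 2 \<le> fst x}) X
     (G \<circ> (\<lambda>z. (2 * fst z - 1, snd z)))"
    by (rule continuous_map_compose[OF _ G])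
       (auto simp: subtopology_subtopology intro!: continuous_intros)
  then show "continuous_map (subtopology (top_of_set ({0..1} \<times> T)) {x \<in> topspace (top_of_set ({0..1} \<times> T)). 1 / 2 \<le> fst x}) X
     (\<lambda>z. G (2 * fst z - 1, snd z))" by (simp add: o_def)
  show "F (2 * fst z, snd z) = G (2 * fst z - 1, snd z)"
    if "z \<in> topspace (top_of_set ({0..1} \<times> T))" "fst z = 1/2" for z
    using that(1) FG[of "snd z"] unfolding that(2) by (simp add: mem_Times_iff)
qed

lemma continuous_map_set_compose:
  assumes "continuous_map (top_of_set T) X f" "continuous_on S g" "\<And>x. x \<in> S \<Longrightarrow> g x \<in> T"
  shows "continuous_map (top_of_set S) X (\<lambda>x. f (g x))"
proof -
  have "continuous_map (top_of_set S) (top_of_set T) g"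
    using assms(2,3) by (simp add: continuous_map_in_subtopology Pi_iff)
  from continuous_map_compose[OF this assms(1)] show ?thesis by (simp add: o_def)
qed

lemma continuous_map_set_cases:
  fixes h :: "'t::topological_space \<Rightarrow> real"
  assumes "continuous_map (top_of_set {x \<in> S. h x \<le> a}) X f"
    and "continuous_map (top_of_set {x \<in> S. a \<le> h x}) X g"
    and h: "continuous_on S h"
    and fg: "\<And>x. x \<in> S \<Longrightarrow> h x = a \<Longrightarrow> f x = g x"
  shows "continuous_map (top_of_set S) X (\<lambda>x. if h x \<le> a then f x else g x)"
proof (rule continuous_map_cases_le)
  have *: "S \<inter> {x \<in> S. P x} = {x \<in> S. P x}" for P by blast
  show "continuous_map (subtopology (top_of_set S) {x \<in> topspace (top_of_set S). h x \<le> a}) X f"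
    "continuous_map (subtopology (top_of_set S) {x \<in> topspace (top_of_set S). a \<le> h x}) X g"
    using assms(1,2) by (simp_all add: subtopology_subtopology *)
qed (use h fg in simp_all)

section \<open>Isotopy classes of braids and winding numbers\<close>

lemma braid_isotopic_sym:
  assumes "braid_isotopic n \<beta> \<gamma>"
  shows "braid_isotopic n \<gamma> \<beta>"
proof -
  obtain H where H: "\<forall>i\<in>{1..n}. continuous_on ({0..1} \<times> {0..1}) (\<lambda>(s, t). H s i t)"
    "\<forall>s\<in>{0..1::real}. geometric_braid n (H s)"
    "\<forall>s\<in>{0..1}. \<forall>i\<in>{1..n}. H s i 0 = \<beta> i 0 \<and> H s i 1 = \<beta> i 1"
    "\<forall>i\<in>{1..n}. \<forall>t\<in>{0..1}. H 0 i t = \<beta> i t \<and> H 1 i t = \<gamma> i t"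
    using assms unfolding braid_isotopic_def by blast
  have "continuous_on ({0..1} \<times> {0..1}) (\<lambda>(s, t). H (1 - s) i t)" if "i \<in> {1..n}" for i
  proof -
    have "continuous_on ({0..1} \<times> {0..1}) ((\<lambda>(s, t). H s i t) \<circ> (\<lambda>(s,t). (1 - s, t)))"
      by (rule continuous_on_compose[OF _ continuous_on_subset[OF H(1)[rule_format, OF that]]])
         (auto simp: case_prod_unfold intro!: continuous_intros)
    then show ?thesis by (simp add: o_def case_prod_unfold)
  qed
  moreover have "H (1 - s) i 0 = \<gamma> i 0 \<and> H (1 - s) i 1 = \<gamma> i 1"
    if "s \<in> {0..1}" "i \<in> {1..n}" for s i
    using H(3)[rule_format, of 1 i] H(3)[rule_format, of "1 - s" i] H(4)[rule_format, of i] that by simp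
  moreover have "geometric_braid n (H (1 - s))" if "s \<in> {0..1}" for s
    using H(2) that by simp
  moreover have "H (1 - 0) i t = \<gamma> i t \<and> H (1 - 1) i t = \<beta> i t"
    if "i \<in> {1..n}" "t \<in> {0..1}" for i t
    using H(4) that by simp
  ultimately show ?thesis
    unfolding braid_isotopic_def by (intro exI[of _ "\<lambda>s. H (1 - s)"]) blast
qed

lemma braid_isotopic_trans:
  assumes "braid_isotopic n \<alpha> \<beta>" "braid_isotopic n \<beta> \<gamma>"
  shows "braid_isotopic n \<alpha> \<gamma>"
proof -
  obtain H where "\<forall>i\<in>{1..n}. continuous_on ({0..1} \<times> {0..1}) (\<lambda>(s, t). H s i t)"
    "\<forall>s\<in>{0..1::real}. geometric_braid n (H s)"
    "\<forall>s\<in>{0..1}. \<forall>i\<in>{1..n}. H s i 0 = \<alpha> i 0 \<and> H s i 1 = \<alpha> i 1"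
    "\<forall>i\<in>{1..n}. \<forall>t\<in>{0..1}. H 0 i t = \<alpha> i t \<and> H 1 i t = \<beta> i t"
    using assms(1) unfolding braid_isotopic_def by blast
  note H = this[rule_format]
  obtain K where "\<forall>i\<in>{1..n}. continuous_on ({0..1} \<times> {0..1}) (\<lambda>(s, t). K s i t)"
    "\<forall>s\<in>{0..1::real}. geometric_braid n (K s)"
    "\<forall>s\<in>{0..1}. \<forall>i\<in>{1..n}. K s i 0 = \<beta> i 0 \<and> K s i 1 = \<beta> i 1"
    "\<forall>i\<in>{1..n}. \<forall>t\<in>{0..1}. K 0 i t = \<beta> i t \<and> K 1 i t = \<gamma> i t"
    using assms(2) unfolding braid_isotopic_def by blast
  note K = this[rule_format]
  define M where "M = (\<lambda>s::real. if s \<le> 1/2 then H (2 * s) else K (2 * s - 1))"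
  have ab: "\<beta> i 0 = \<alpha> i 0" "\<beta> i 1 = \<alpha> i 1" if "i \<in> {1..n}" for i
    using H(3)[of 1 i] H(4)[of i] that by auto
  have "continuous_on ({0..1} \<times> {0..1}) (\<lambda>(s, t). M s i t)" if i: "i \<in> {1..n}" for i
  proof -
    have "continuous_map (top_of_set ({0..1} \<times> {0..1})) euclidean (\<lambda>z. if fst z \<le> 1/2
        then (\<lambda>(s, t). H s i t) (2 * fst z, snd z) else (\<lambda>(s, t). K s i t) (2 * fst z - 1, snd z))"
      by (rule continuous_map_glue_homotopies[where F = "\<lambda>(s, t). H s i t" and G = "\<lambda>(s, t). K s i t"])
         (use H(1,4)[OF i] K(1,4)[OF i] in simp_all)
    then have "continuous_on ({0..1} \<times> {0..1}) (\<lambda>z. if fst z \<le> 1/2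
        then (\<lambda>(s, t). H s i t) (2 * fst z, snd z) else (\<lambda>(s, t). K s i t) (2 * fst z - 1, snd z))"
      by (simp only: continuous_map_iff_continuous)
    then show ?thesis by (rule continuous_on_eq) (auto simp: M_def)
  qed
  moreover have "\<forall>s\<in>{0..1}. geometric_braid n (M s)"
    using H(2) K(2) by (auto simp: M_def)
  moreover have "\<forall>s\<in>{0..1}. \<forall>i\<in>{1..n}. M s i 0 = \<alpha> i 0 \<and> M s i 1 = \<alpha> i 1"
    using H(3) K(3) ab by (auto simp: M_def)
  moreover have "\<forall>i\<in>{1..n}. \<forall>t\<in>{0..1}. M 0 i t = \<alpha> i t \<and> M 1 i t = \<gamma> i t"
    using H(4) K(4) by (auto simp: M_def)
  ultimately show ?thesis unfolding braid_isotopic_def by blast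
qed

lemma braid_isotopic_geometric:
  assumes "braid_isotopic n \<beta> \<gamma>" shows "geometric_braid n \<beta>" "geometric_braid n \<gamma>"
proof -
  have *: "geometric_braid n \<beta>" if "braid_isotopic n \<beta> \<gamma>" for \<beta> \<gamma>
  proof -
    obtain H where "\<forall>i\<in>{1..n}. continuous_on ({0..1} \<times> {0..1}) (\<lambda>(s, t). H s i t)"
    "\<forall>s\<in>{0..1::real}. geometric_braid n (H s)"
    "\<forall>s\<in>{0..1}. \<forall>i\<in>{1..n}. H s i 0 = \<beta> i 0 \<and> H s i 1 = \<beta> i 1"
    "\<forall>i\<in>{1..n}. \<forall>t\<in>{0..1}. H 0 i t = \<beta> i t \<and> H 1 i t = \<gamma> i t"
    using \<open>braid_isotopic n \<beta> \<gamma>\<close> unfolding braid_isotopic_def by blast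
    note H = this[rule_format]
    have "geometric_braid n (H 0)" using H(2) by simp
    moreover have "inj_on (\<lambda>i. H 0 i t) {1..n} = inj_on (\<lambda>i. \<beta> i t) {1..n}" if "t \<in> {0..1}" for t
      using that H(4) by (intro inj_on_cong) blast
    moreover have "continuous_on {0..1} (H 0 i) = continuous_on {0..1} (\<beta> i)" if "i \<in> {1..n}" for i
      using that H(4) by (intro continuous_on_cong) auto
    moreover have "(\<lambda>i. H 0 i 1) ` {1..n} = (\<lambda>i. \<beta> i 1) ` {1..n}"
      using H(4) by (intro image_cong) auto
    moreover have "\<beta> i 0 = of_nat i" if "i \<in> {1..n}" for i
      using \<open>geometric_braid n (H 0)\<close> H(4)[of i 0] that by (simp add: geometric_braid_def)
    ultimately show ?thesis
      using \<open>geometric_braid n (H 0)\<close> unfolding geometric_braid_def by simp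
  qed
  show "geometric_braid n \<beta>" "geometric_braid n \<gamma>"
    using * assms braid_isotopic_sym by blast+
qed

lemma braid_perm_end:
  assumes "geometric_braid n \<beta>" "i \<in> {1..n}"
  shows "braid_perm n \<beta> i \<in> {1..n}" "of_nat (braid_perm n \<beta> i) = \<beta> i 1"
proof -
  have "\<beta> i 1 \<in> of_nat ` {1..n}"
    using assms unfolding geometric_braid_def by blast
  then obtain j where j: "j \<in> {1..n}" "\<beta> i 1 = of_nat j" by auto
  have "(THE j. j \<in> {1..n} \<and> \<beta> i 1 = of_nat j) = j"
    using j by (intro the_equality) auto
  then show "braid_perm n \<beta> i \<in> {1..n}" "of_nat (braid_perm n \<beta> i) = \<beta> i 1"
    using j assms(2) by (auto simp: braid_perm_def)
qed

lemma braid_perm_eqI: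
  assumes "i \<in> {1..n}" "j \<in> {1..n}" "\<beta> i 1 = of_nat j"
  shows "braid_perm n \<beta> i = j"
  using assms by (auto simp: braid_perm_def)

lemma braid_perm_inj:
  assumes "geometric_braid n \<beta>" "i \<in> {1..n}" "j \<in> {1..n}" "i \<noteq> j"
  shows "braid_perm n \<beta> i \<noteq> braid_perm n \<beta> j"
proof
  assume "braid_perm n \<beta> i = braid_perm n \<beta> j"
  then have "\<beta> i 1 = \<beta> j 1" using braid_perm_end[OF assms(1)] assms by metis
  moreover have "inj_on (\<lambda>i. \<beta> i 1) {1..n}"
    using assms(1) unfolding geometric_braid_def by auto
  ultimately show False using assms by (auto dest: inj_onD)
qed

lemma braid_isotopic_perm:
  assumes "braid_isotopic n \<beta> \<gamma>"
  shows "braid_perm n \<beta> = braid_perm n \<gamma>"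
proof
  fix i
  obtain H where "\<forall>i\<in>{1..n}. continuous_on ({0..1} \<times> {0..1}) (\<lambda>(s, t). H s i t)"
    "\<forall>s\<in>{0..1::real}. geometric_braid n (H s)"
    "\<forall>s\<in>{0..1}. \<forall>i\<in>{1..n}. H s i 0 = \<beta> i 0 \<and> H s i 1 = \<beta> i 1"
    "\<forall>i\<in>{1..n}. \<forall>t\<in>{0..1}. H 0 i t = \<beta> i t \<and> H 1 i t = \<gamma> i t"
    using assms unfolding braid_isotopic_def by blast
  note H = this[rule_format]
  have "\<beta> i 1 = \<gamma> i 1" if "i \<in> {1..n}"
    using H(3)[of 1 i] H(4)[of i 1] that by simp
  then show "braid_perm n \<beta> i = braid_perm n \<gamma> i" by (auto simp: braid_perm_def)
qed

text \<open>The difference of two strands is a path in the punctured plane. For a pure braid it is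
  closed, and its winding number is the linking number of the two strands; in general it is a
  complex number that still adds up under stacking.\<close>

definition strand_winding :: "(nat \<Rightarrow> real \<Rightarrow> complex) \<Rightarrow> nat \<Rightarrow> nat \<Rightarrow> complex" where
  "strand_winding \<beta> i j = winding_number (\<lambda>t. \<beta> i t - \<beta> j t) 0"

lemma strand_difference_path:
  assumes "geometric_braid n \<beta>" "i \<in> {1..n}" "j \<in> {1..n}" "i \<noteq> j"
  shows "path (\<lambda>t. \<beta> i t - \<beta> j t)" "0 \<notin> path_image (\<lambda>t. \<beta> i t - \<beta> j t)"
proof -
  show "path (\<lambda>t. \<beta> i t - \<beta> j t)"
    using assms unfolding path_def geometric_braid_def by (auto intro!: continuous_intros)
  have "\<beta> i t \<noteq> \<beta> j t" if "t \<in> {0..1}" for t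
    using assms that unfolding geometric_braid_def inj_on_def by blast
  then show "0 \<notin> path_image (\<lambda>t. \<beta> i t - \<beta> j t)"
    by (auto simp: path_image_def)
qed

text \<open>An isotopy keeps the strands disjoint and their ends fixed, so the difference of two
  strands moves through a homotopy of paths in the punctured plane.\<close>

lemma strand_winding_isotopic:
  assumes "braid_isotopic n \<beta> \<gamma>" "i \<in> {1..n}" "j \<in> {1..n}" "i \<noteq> j"
  shows "strand_winding \<beta> i j = strand_winding \<gamma> i j"
proof -
  obtain H where "\<forall>i\<in>{1..n}. continuous_on ({0..1} \<times> {0..1}) (\<lambda>(s, t). H s i t)"
    "\<forall>s\<in>{0..1::real}. geometric_braid n (H s)"
    "\<forall>s\<in>{0..1}. \<forall>i\<in>{1..n}. H s i 0 = \<beta> i 0 \<and> H s i 1 = \<beta> i 1"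
    "\<forall>i\<in>{1..n}. \<forall>t\<in>{0..1}. H 0 i t = \<beta> i t \<and> H 1 i t = \<gamma> i t"
    using assms(1) unfolding braid_isotopic_def by blast
  note H = this[rule_format]
  have "H s i t \<noteq> H s j t" if "s \<in> {0..1}" "t \<in> {0..1}" for s t
    using H(2)[OF that(1)] that assms unfolding geometric_braid_def inj_on_def by blast
  moreover have "continuous_on ({0..1} \<times> {0..1}) (\<lambda>x. H (fst x) i (snd x) - H (fst x) j (snd x))"
    using H(1)[OF assms(2)] H(1)[OF assms(3)]
    by (intro continuous_intros) (auto simp: case_prod_unfold)
  ultimately have "homotopic_paths (-{0}) (\<lambda>t. \<beta> i t - \<beta> j t) (\<lambda>t. \<gamma> i t - \<gamma> j t)"
    unfolding homotopic_paths
    by (intro exI[of _ "\<lambda>x. H (fst x) i (snd x) - H (fst x) j (snd x)"])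
       (use H(3)[OF _ assms(2)] H(3)[OF _ assms(3)] H(4)[OF assms(2)] H(4)[OF assms(3)]
         in \<open>auto simp: pathstart_def pathfinish_def\<close>)
  then show ?thesis unfolding strand_winding_def by (rule winding_number_homotopic_paths)
qed

lemma braid_perm_comp:
  assumes "geometric_braid n \<alpha>" "geometric_braid n \<beta>"
  shows "braid_perm n (braid_comp n \<alpha> \<beta>) = braid_perm n \<alpha> \<circ> braid_perm n \<beta>"
proof
  fix i
  show "braid_perm n (braid_comp n \<alpha> \<beta>) i = (braid_perm n \<alpha> \<circ> braid_perm n \<beta>) i"
  proof (cases "i \<in> {1..n}")
    case True
    note b = braid_perm_end[OF assms(2) True]
    show ?thesis
      using braid_perm_end[OF assms(1) b(1)] True by (auto intro!: braid_perm_eqI simp: braid_comp_def)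
  next
    case False
    then show ?thesis unfolding o_def braid_perm_def by (simp only: if_False)
  qed
qed

text \<open>In a product the right factor comes first and brings the strand \<open>i\<close> to the
  place where the strand \<open>braid_perm n \<beta> i\<close> of the left factor starts; hence the
  change of indices in the second summand.\<close>

lemma strand_winding_comp:
  assumes "geometric_braid n \<alpha>" "geometric_braid n \<beta>" "i \<in> {1..n}" "j \<in> {1..n}" "i \<noteq> j"
  shows "strand_winding (braid_comp n \<alpha> \<beta>) i j =
    strand_winding \<beta> i j + strand_winding \<alpha> (braid_perm n \<beta> i) (braid_perm n \<beta> j)"
proof -
  let ?i = "braid_perm n \<beta> i" and ?j = "braid_perm n \<beta> j"
  have "(\<lambda>t. braid_comp n \<alpha> \<beta> i t - braid_comp n \<alpha> \<beta> j t) =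
      (\<lambda>t. \<beta> i t - \<beta> j t) +++ (\<lambda>t. \<alpha> ?i t - \<alpha> ?j t)"
    by (auto simp: braid_comp_def joinpaths_def)
  moreover have ij: "?i \<in> {1..n}" "?j \<in> {1..n}" "?i \<noteq> ?j"
    using braid_perm_end[OF assms(2)] braid_perm_inj[OF assms(2-5)] assms by auto
  moreover have "\<alpha> ?i 0 = of_nat ?i" "\<alpha> ?j 0 = of_nat ?j"
    using assms(1) ij unfolding geometric_braid_def by auto
  ultimately show ?thesis
    unfolding strand_winding_def
    using strand_difference_path[OF assms(2-5)] strand_difference_path[OF assms(1) ij]
      braid_perm_end[OF assms(2)] assms
    by (simp add: winding_number_join pathstart_def pathfinish_def)
qed

lemma braid_class_members:
  assumes "A \<in> carrier (braid_group n)"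
  shows "A \<noteq> {}" "\<beta> \<in> A \<Longrightarrow> geometric_braid n \<beta>"
    "\<beta> \<in> A \<Longrightarrow> \<gamma> \<in> A \<longleftrightarrow> braid_isotopic n \<beta> \<gamma>"
proof -
  obtain \<alpha> where a: "geometric_braid n \<alpha>" "A = {\<gamma>. braid_isotopic n \<alpha> \<gamma>}"
    using assms by (auto simp: braid_group_def quotient_def)
  have "continuous_on ({0..1} \<times> {0..1}) (\<lambda>(s :: real, t). \<alpha> i t)" if "i \<in> {1..n}" for i
  proof -
    have "continuous_on {0..1} (\<alpha> i)" using a(1) that by (simp add: geometric_braid_def)
    from continuous_on_compose2[OF this, of "{0..1} \<times> {0..1}" "snd :: real \<times> real \<Rightarrow> real"]
    show ?thesis by (simp add: case_prod_unfold continuous_on_snd)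
  qed
  then have "braid_isotopic n \<alpha> \<alpha>"
    using a(1) unfolding braid_isotopic_def by (intro exI[of _ "\<lambda>s. \<alpha>"]) simp
  then show "A \<noteq> {}" unfolding a(2) by blast
  assume "\<beta> \<in> A"
  then have b: "braid_isotopic n \<alpha> \<beta>" unfolding a(2) by simp
  show "geometric_braid n \<beta>" by (rule braid_isotopic_geometric(2)[OF b])
  show "\<gamma> \<in> A \<longleftrightarrow> braid_isotopic n \<beta> \<gamma>"
    unfolding a(2) mem_Collect_eq
    using braid_isotopic_trans[OF b] braid_isotopic_trans[OF braid_isotopic_sym[OF b]] by (rule iffI[rotated])
qed

lemma braid_class_eqI:
  assumes "A \<in> carrier (braid_group n)" "B \<in> carrier (braid_group n)" "\<beta> \<in> A" "\<beta> \<in> B"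
  shows "A = B"
  by (intro equalityI subsetI) (simp_all only: braid_class_members(3)[OF assms(1,3)] braid_class_members(3)[OF assms(2,4)])

definition class_winding :: "(nat \<Rightarrow> real \<Rightarrow> complex) set \<Rightarrow> nat \<Rightarrow> nat \<Rightarrow> complex" where
  "class_winding A = strand_winding (SOME \<beta>. \<beta> \<in> A)"

lemma class_invariants:
  assumes "A \<in> carrier (braid_group n)" "\<beta> \<in> A"
  shows "braid_proj n A = braid_perm n \<beta>"
    "\<lbrakk>i \<in> {1..n}; j \<in> {1..n}; i \<noteq> j\<rbrakk> \<Longrightarrow> class_winding A i j = strand_winding \<beta> i j"
proof -
  have "braid_perm n \<gamma> = braid_perm n \<beta>" if "\<gamma> \<in> A" for \<gamma>
    using braid_isotopic_perm[of n \<beta> \<gamma>] braid_class_members(3)[OF assms, of \<gamma>] that by simp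
  then show "braid_proj n A = braid_perm n \<beta>"
    unfolding braid_proj_def by (intro the_elem_image_unique braid_class_members(1)[OF assms(1)])
  have "(SOME \<beta>. \<beta> \<in> A) \<in> A" using someI[of "\<lambda>\<beta>. \<beta> \<in> A", OF assms(2)] .
  then have iso: "braid_isotopic n \<beta> (SOME \<beta>. \<beta> \<in> A)"
    by (rule iffD1[OF braid_class_members(3)[OF assms]])
  show "class_winding A i j = strand_winding \<beta> i j" if "i \<in> {1..n}" "j \<in> {1..n}" "i \<noteq> j"
    unfolding class_winding_def by (rule strand_winding_isotopic[OF iso that, symmetric])
qed

text \<open>That the product class is nonempty is taken from its membership in the carrier: this
  yields representatives of the factors that can be stacked.\<close>

lemma mult_invariants:
  assumes A: "A \<in> carrier (braid_group n)" and B: "B \<in> carrier (braid_group n)"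
    and AB: "A \<otimes>\<^bsub>braid_group n\<^esub> B \<in> carrier (braid_group n)"
  shows "braid_proj n (A \<otimes>\<^bsub>braid_group n\<^esub> B) = braid_proj n A \<circ> braid_proj n B"
    "\<lbrakk>i \<in> {1..n}; j \<in> {1..n}; i \<noteq> j\<rbrakk> \<Longrightarrow> class_winding (A \<otimes>\<^bsub>braid_group n\<^esub> B) i j =
       class_winding B i j + class_winding A (braid_proj n B i) (braid_proj n B j)"
proof -
  obtain \<gamma> where "\<gamma> \<in> A \<otimes>\<^bsub>braid_group n\<^esub> B"
    using braid_class_members(1)[OF AB] by blast
  then obtain \<alpha> \<beta> where ab: "\<alpha> \<in> A" "\<beta> \<in> B" "braid_isotopic n (braid_comp n \<alpha> \<beta>) \<gamma>"
    by (auto simp: braid_group_def)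
  then have m: "braid_comp n \<alpha> \<beta> \<in> A \<otimes>\<^bsub>braid_group n\<^esub> B"
    using braid_isotopic_trans[OF ab(3) braid_isotopic_sym[OF ab(3)]] by (auto simp: braid_group_def)
  have g: "geometric_braid n \<alpha>" "geometric_braid n \<beta>"
    by (rule braid_class_members(2)[OF A ab(1)], rule braid_class_members(2)[OF B ab(2)])
  show "braid_proj n (A \<otimes>\<^bsub>braid_group n\<^esub> B) = braid_proj n A \<circ> braid_proj n B"
    using class_invariants(1)[OF A ab(1)] class_invariants(1)[OF B ab(2)] class_invariants(1)[OF AB m]
      braid_perm_comp[OF g] by simp
  assume ij: "i \<in> {1..n}" "j \<in> {1..n}" "i \<noteq> j"
  then show "class_winding (A \<otimes>\<^bsub>braid_group n\<^esub> B) i j =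
       class_winding B i j + class_winding A (braid_proj n B i) (braid_proj n B j)"
    using class_invariants(2)[OF AB m ij] class_invariants(2)[OF B ab(2) ij]
      class_invariants(1)[OF B ab(2)] strand_winding_comp[OF g ij]
      class_invariants(2)[OF A ab(1)] braid_perm_end[OF g(2)] braid_perm_inj[OF g(2) ij]
    by simp
qed

section \<open>Planetary braids\<close>

text \<open>The points of \<open>{1..n}\<close> circle round the centre \<open>c\<close>. The number
  \<open>\<theta> t i\<close> counts the turns that the point \<open>i\<close> has made at the time
  \<open>t\<close>. If no two points have the same distance to the centre then the orbits are
  disjoint, and every choice of \<open>\<theta>\<close> gives a braid.\<close>

definition planetary_braid :: "nat \<Rightarrow> (real \<Rightarrow> nat \<Rightarrow> real) \<Rightarrow> nat \<Rightarrow> real \<Rightarrow> complex" where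
  "planetary_braid c \<theta> i t =
     of_nat c + of_real (real i - real c) * exp (2 * of_real pi * \<i> * of_real (\<theta> t i))"

definition winding_path :: "nat \<Rightarrow> (real \<Rightarrow> nat \<Rightarrow> real) \<Rightarrow> bool" where
  "winding_path n \<theta> \<longleftrightarrow>
     (\<forall>i\<in>{1..n}. continuous_on {0..1} (\<lambda>t. \<theta> t i) \<and> \<theta> 0 i = 0 \<and> \<theta> 1 i \<in> \<int>)"

lemma winding_pathD:
  assumes "winding_path n \<theta>" "i \<in> {1..n}"
  shows "continuous_on {0..1} (\<lambda>t. \<theta> t i)" "\<theta> 0 i = 0" "\<theta> 1 i \<in> \<int>"
  using assms unfolding winding_path_def by blast+

lemma exp_two_pi_int:
  assumes "x \<in> \<int>" shows "exp (2 * of_real pi * \<i> * of_real x) = 1"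
proof -
  have "exp (2 * of_real pi * \<i> * of_real x) = exp (complex_of_real (2 * x * pi) * \<i>)"
    by (simp add: mult_ac)
  then show ?thesis using exp_integer_2pi[OF assms] by simp
qed

lemma planetary_inj:
  assumes "inj_on (\<lambda>i. \<bar>real i - real c\<bar>) {1..n}"
  shows "inj_on (\<lambda>i. planetary_braid c \<theta> i t) {1..n}"
proof (rule inj_onI)
  fix i j assume ij: "i \<in> {1..n}" "j \<in> {1..n}" "planetary_braid c \<theta> i t = planetary_braid c \<theta> j t"
  then have "norm (of_real (real i - real c) * exp (2 * of_real pi * \<i> * of_real (\<theta> t i))) =
      norm (of_real (real j - real c) * exp (2 * of_real pi * \<i> * of_real (\<theta> t j)))"
    by (simp add: planetary_braid_def)
  then have "\<bar>real i - real c\<bar> = \<bar>real j - real c\<bar>"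
    by (simp only: norm_mult norm_of_real) simp
  then show "i = j" using assms ij by (auto dest: inj_onD)
qed

lemma planetary_geometric:
  assumes "inj_on (\<lambda>i. \<bar>real i - real c\<bar>) {1..n}" "winding_path n \<theta>"
  shows "geometric_braid n (planetary_braid c \<theta>)"
    "i \<in> {1..n} \<Longrightarrow> planetary_braid c \<theta> i 1 = of_nat i"
    "braid_perm n (planetary_braid c \<theta>) = id"
proof -
  have 0: "planetary_braid c \<theta> i 0 = of_nat i" if "i \<in> {1..n}" for i
    using assms(2) that by (simp add: planetary_braid_def winding_path_def)
  show 1: "planetary_braid c \<theta> i 1 = of_nat i" if "i \<in> {1..n}" for i
    using assms(2) that by (simp add: planetary_braid_def winding_path_def exp_two_pi_int)
  have "continuous_on {0..1} (planetary_braid c \<theta> i)" if "i \<in> {1..n}" for i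
    unfolding planetary_braid_def by (intro continuous_intros winding_pathD(1)[OF assms(2) that])
  then show "geometric_braid n (planetary_braid c \<theta>)"
    unfolding geometric_braid_def using planetary_inj[OF assms(1)] 0 1 by auto
  show "braid_perm n (planetary_braid c \<theta>) = id"
  proof
    fix i show "braid_perm n (planetary_braid c \<theta>) i = id i"
      by (cases "i \<in> {1..n}") (use 1 braid_perm_eqI in \<open>auto simp: braid_perm_def\<close>)
  qed
qed

text \<open>Points on disjoint orbits never meet, so the turning functions can be interpolated
  linearly: only the total numbers of turns matter.\<close>

lemma planetary_isotopic:
  assumes c: "inj_on (\<lambda>i. \<bar>real i - real c\<bar>) {1..n}"
    and w: "winding_path n \<theta>" "winding_path n \<eta>" "\<And>i. i \<in> {1..n} \<Longrightarrow> \<theta> 1 i = \<eta> 1 i"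
    and ab: "\<And>i t. i \<in> {1..n} \<Longrightarrow> t \<in> {0..1} \<Longrightarrow> \<alpha> i t = planetary_braid c \<theta> i t"
      "\<And>i t. i \<in> {1..n} \<Longrightarrow> t \<in> {0..1} \<Longrightarrow> \<beta> i t = planetary_braid c \<eta> i t"
  shows "braid_isotopic n \<alpha> \<beta>"
proof -
  define H where "H = (\<lambda>s. planetary_braid c (\<lambda>t i. (1 - s) * \<theta> t i + s * \<eta> t i))"
  have e: "(1 - s) * x + s * x = x" for s x :: real by (simp add: algebra_simps)
  have wp: "winding_path n (\<lambda>t i. (1 - s) * \<theta> t i + s * \<eta> t i)" for s :: real
    using w by (auto simp: winding_path_def e intro!: continuous_intros)
  have "continuous_on ({0..1} \<times> {0..1}) (\<lambda>(s, t). H s i t)" if "i \<in> {1..n}" for i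
  proof -
    have "continuous_on {0..1} (\<lambda>t. \<theta> t i)" "continuous_on {0..1} (\<lambda>t. \<eta> t i)"
      using winding_pathD(1) w that by blast+
    then have "continuous_on ({0..1} \<times> {0..1}) (\<lambda>x :: real \<times> real. \<theta> (snd x) i)"
      "continuous_on ({0..1} \<times> {0..1}) (\<lambda>x :: real \<times> real. \<eta> (snd x) i)"
      by (auto intro!: continuous_on_compose2[of "{0..1}" "\<lambda>t. \<theta> t i" _ snd] 
            continuous_on_compose2[of "{0..1}" "\<lambda>t. \<eta> t i" _ snd] continuous_on_snd continuous_on_id)
    then show ?thesis
      unfolding H_def planetary_braid_def case_prod_unfold
      by (intro continuous_intros)
  qed
  moreover have "geometric_braid n (H s)" for s
    unfolding H_def by (rule planetary_geometric(1)[OF c wp])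
  moreover have "H s i 0 = \<alpha> i 0 \<and> H s i 1 = \<alpha> i 1" if "i \<in> {1..n}" for s i
    using ab(1)[OF that] w that by (auto simp: H_def planetary_braid_def winding_path_def e)
  moreover have "H 0 i t = \<alpha> i t \<and> H 1 i t = \<beta> i t" if "i \<in> {1..n}" "t \<in> {0..1}" for i t
    using ab that by (auto simp: H_def planetary_braid_def)
  ultimately show ?thesis unfolding braid_isotopic_def by blast
qed

text \<open>The difference of two strands is the vector from the centre to the outer point, which
  runs round a circle, perturbed by a vector that is shorter than the radius. So the outer point
  decides how often the two strands wind round each other.\<close>

lemma planetary_winding:
  assumes c: "inj_on (\<lambda>i. \<bar>real i - real c\<bar>) {1..n}" and w: "winding_path n \<theta>"
    and ij: "i \<in> {1..n}" "j \<in> {1..n}" "i \<noteq> j"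
  shows "strand_winding (planetary_braid c \<theta>) i j =
    of_real (\<theta> 1 (if \<bar>real j - real c\<bar> < \<bar>real i - real c\<bar> then i else j))"
proof -
  define E where "E = (\<lambda>i t. exp (2 * of_real pi * \<i> * of_real (\<theta> t i)))"
  have wind: "winding_number (\<lambda>t. K * E i t - L * E j t) 0 = of_real (\<theta> 1 i)"
    if KL: "norm L < norm K" "i \<in> {1..n}" "j \<in> {1..n}" for K L i j
  proof -
    have cont: "continuous_on {0..1} (E i)" if "i \<in> {1..n}" for i
      unfolding E_def by (intro continuous_intros winding_pathD(1)[OF w that])
    have ends: "E i 0 = 1" "E i 1 = 1" if "i \<in> {1..n}" for i
      unfolding E_def using winding_pathD(2,3)[OF w that] by (simp_all add: exp_two_pi_int)
    have "norm (E i t) = 1" for i t unfolding E_def by simp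
    then have "winding_number (\<lambda>t. K * E i t - L * E j t) 0 = winding_number (\<lambda>t. K * E i t) 0"
      using KL cont[OF KL(2)] cont[OF KL(3)] ends[OF KL(2)] ends[OF KL(3)]
      by (intro winding_number_nearby_loops_eq)
         (auto simp: path_def pathstart_def pathfinish_def norm_mult intro!: continuous_intros)
    also have "\<dots> = winding_number (exp \<circ> (\<lambda>t. Ln K + 2 * of_real pi * \<i> * of_real (\<theta> t i))) 0"
    proof -
      have "K \<noteq> 0" using KL(1) by auto
      then have "K * E i t = exp (Ln K + 2 * of_real pi * \<i> * of_real (\<theta> t i))" for t
        by (simp add: E_def exp_add)
      then show ?thesis by (simp only: o_def)
    qed
    also have "\<dots> = of_real (\<theta> 1 i)"
    proof -
      have "path (\<lambda>t. Ln K + 2 * of_real pi * \<i> * of_real (\<theta> t i))"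
        unfolding path_def by (intro continuous_intros winding_pathD(1)[OF w KL(2)])
      then show ?thesis
        using winding_pathD(2)[OF w KL(2)]
        by (simp add: winding_number_compose_exp pathstart_def pathfinish_def)
    qed
    finally show ?thesis .
  qed
  \<comment> \<open>The same difference is written twice, so that \<open>wind\<close> applies
    whichever of the two points is the outer one.\<close>
  have eq: "(\<lambda>t. planetary_braid c \<theta> i t - planetary_braid c \<theta> j t) =
      (\<lambda>t. of_real (real i - real c) * E i t - of_real (real j - real c) * E j t)"
    "(\<lambda>t. planetary_braid c \<theta> i t - planetary_braid c \<theta> j t) =
      (\<lambda>t. - of_real (real j - real c) * E j t - (- of_real (real i - real c)) * E i t)"
    by (simp_all add: fun_eq_iff planetary_braid_def E_def algebra_simps)
  have ne: "\<bar>real i - real c\<bar> \<noteq> \<bar>real j - real c\<bar>"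
    using inj_onD[OF c, of i j] ij by blast
  show ?thesis
  proof (cases "\<bar>real j - real c\<bar> < \<bar>real i - real c\<bar>")
    case True
    then show ?thesis
      using wind[of "of_real (real j - real c)" "of_real (real i - real c)" i j] ij
      unfolding strand_winding_def eq(1) norm_of_real by simp
  next
    case False
    then show ?thesis
      using wind[of "- of_real (real i - real c)" "- of_real (real j - real c)" j i] ij ne
      unfolding strand_winding_def eq(2) norm_minus_cancel norm_of_real by simp
  qed
qed

text \<open>Both products are planetary braids with the same total numbers of turns.\<close>

lemma planetary_comp:
  assumes c: "inj_on (\<lambda>i. \<bar>real i - real c\<bar>) {1..n}"
    and w: "winding_path n \<theta>" "winding_path n \<eta>"
  shows "braid_isotopic n (braid_comp n (planetary_braid c \<theta>) (planetary_braid c \<eta>))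
     (braid_comp n (planetary_braid c \<eta>) (planetary_braid c \<theta>))"
proof -
  \<comment> \<open>the turning function of the product: first the turns of the right factor, then
    those of the left one\<close>
  define J :: "(real \<Rightarrow> nat \<Rightarrow> real) \<Rightarrow> (real \<Rightarrow> nat \<Rightarrow> real) \<Rightarrow> real \<Rightarrow> nat \<Rightarrow> real"
    where "J = (\<lambda>\<theta> \<eta> t i. if t \<le> 1/2 then \<eta> (2 * t) i else (\<eta> 1 i + \<theta> (2 * t - 1) i))"
  have J: "winding_path n (J \<theta> \<eta>)"
    "i \<in> {1..n} \<Longrightarrow> t \<in> {0..1} \<Longrightarrow>
       braid_comp n (planetary_braid c \<theta>) (planetary_braid c \<eta>) i t = planetary_braid c (J \<theta> \<eta>) i t"
    if w: "winding_path n \<theta>" "winding_path n \<eta>" for \<theta> \<eta> i t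
  proof -
    have "continuous_on {0..1} (\<lambda>t. J \<theta> \<eta> t i)" if i: "i \<in> {1..n}" for i
    proof -
      have \<theta>: "continuous_on {0..1} (\<lambda>t. \<theta> t i)" and \<eta>: "continuous_on {0..1} (\<lambda>t. \<eta> t i)"
        and "\<theta> 0 i = 0"
        using w i by (auto simp: winding_path_def)
      moreover have "continuous_on {t \<in> {0..1}. t \<le> 1/2} (\<lambda>t. \<eta> (2 * t) i)"
        by (rule continuous_on_compose2[OF \<eta>]) (auto intro!: continuous_intros)
      moreover have "continuous_on {t \<in> {0..1}. 1/2 \<le> t} (\<lambda>t. \<theta> (2 * t - 1) i)"
        by (rule continuous_on_compose2[OF \<theta>]) (auto intro!: continuous_intros)
      then have "continuous_on {t \<in> {0..1}. 1/2 \<le> t} (\<lambda>t. \<eta> 1 i + \<theta> (2 * t - 1) i)"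
        by (intro continuous_on_add continuous_on_const)
      moreover have "\<eta> (2 * t) i = \<eta> 1 i + \<theta> (2 * t - 1) i" if "t = 1/2" for t
        using \<open>\<theta> 0 i = 0\<close> unfolding that by simp
      ultimately have "continuous_on {0..1} (\<lambda>t. if t \<le> 1/2 then \<eta> (2 * t) i else \<eta> 1 i + \<theta> (2 * t - 1) i)"
        by (intro continuous_on_cases_le continuous_on_id)
      then show ?thesis by (simp only: J_def)
    qed
    then show "winding_path n (J \<theta> \<eta>)"
      using w by (auto simp: winding_path_def J_def)
    assume i: "i \<in> {1..n}"
    then have "exp (2 * of_real pi * \<i> * of_real (\<eta> 1 i)) = 1"
      using w by (simp add: winding_path_def exp_two_pi_int)
    then show "braid_comp n (planetary_braid c \<theta>) (planetary_braid c \<eta>) i t = planetary_braid c (J \<theta> \<eta>) i t"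
      using planetary_geometric(3)[OF c w(2)]
      by (simp add: braid_comp_def J_def planetary_braid_def distrib_left exp_add)
  qed
  show ?thesis
    by (rule planetary_isotopic[OF c J(1)[OF w] J(1)[OF w(2,1)] _ J(2)[OF w] J(2)[OF w(2,1)]])
       (simp_all add: J_def)
qed

definition braid_class :: "nat \<Rightarrow> (nat \<Rightarrow> real \<Rightarrow> complex) \<Rightarrow> (nat \<Rightarrow> real \<Rightarrow> complex) set" where
  "braid_class n \<beta> = {\<gamma>. braid_isotopic n \<beta> \<gamma>}"

lemma braid_class_carrier: "geometric_braid n \<beta> \<Longrightarrow> braid_class n \<beta> \<in> carrier (braid_group n)"
  by (auto simp: braid_class_def braid_group_def quotient_def)

lemma planetary_class:
  assumes c: "inj_on (\<lambda>i. \<bar>real i - real c\<bar>) {1..n}" and w: "winding_path n \<theta>"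
  shows "planetary_braid c \<theta> \<in> braid_class n (planetary_braid c \<theta>)"
    "braid_class n (planetary_braid c \<theta>) \<in> carrier (braid_group n)"
    "braid_proj n (braid_class n (planetary_braid c \<theta>)) = id"
    "\<lbrakk>i \<in> {1..n}; j \<in> {1..n}; i \<noteq> j\<rbrakk> \<Longrightarrow> class_winding (braid_class n (planetary_braid c \<theta>)) i j =
      of_real (\<theta> 1 (if \<bar>real j - real c\<bar> < \<bar>real i - real c\<bar> then i else j))"
proof -
  show m: "planetary_braid c \<theta> \<in> braid_class n (planetary_braid c \<theta>)"
    unfolding braid_class_def using planetary_isotopic[OF c w w] by blast
  show cc: "braid_class n (planetary_braid c \<theta>) \<in> carrier (braid_group n)"
    by (rule braid_class_carrier[OF planetary_geometric(1)[OF c w]])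
  show "braid_proj n (braid_class n (planetary_braid c \<theta>)) = id"
    using class_invariants(1)[OF cc m] planetary_geometric(3)[OF c w] by simp
  assume ij: "i \<in> {1..n}" "j \<in> {1..n}" "i \<noteq> j"
  show "class_winding (braid_class n (planetary_braid c \<theta>)) i j =
      of_real (\<theta> 1 (if \<bar>real j - real c\<bar> < \<bar>real i - real c\<bar> then i else j))"
    by (rule trans[OF class_invariants(2)[OF cc m ij] planetary_winding[OF c w ij]])
qed

lemma planetary_commute:
  assumes c: "inj_on (\<lambda>i. \<bar>real i - real c\<bar>) {1..n}" and w: "winding_path n \<theta>" "winding_path n \<eta>"
    and AB: "A = braid_class n (planetary_braid c \<theta>)" "B = braid_class n (planetary_braid c \<eta>)"
    and cl: "A \<otimes>\<^bsub>braid_group n\<^esub> B \<in> carrier (braid_group n)"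
      "B \<otimes>\<^bsub>braid_group n\<^esub> A \<in> carrier (braid_group n)"
  shows "A \<otimes>\<^bsub>braid_group n\<^esub> B = B \<otimes>\<^bsub>braid_group n\<^esub> A"
proof (rule braid_class_eqI[OF cl])
  let ?\<gamma> = "braid_comp n (planetary_braid c \<theta>) (planetary_braid c \<eta>)"
  note m = planetary_class(1)[OF c w(1), folded AB] planetary_class(1)[OF c w(2), folded AB]
  have "braid_isotopic n ?\<gamma> ?\<gamma>"
    by (rule braid_isotopic_trans[OF planetary_comp[OF c w] planetary_comp[OF c w(2,1)]])
  then show "?\<gamma> \<in> A \<otimes>\<^bsub>braid_group n\<^esub> B" using m by (auto simp: braid_group_def)
  show "?\<gamma> \<in> B \<otimes>\<^bsub>braid_group n\<^esub> A"
    using m planetary_comp[OF c w(2,1)] by (auto simp: braid_group_def)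
qed

section \<open>Covers of Euclidean space that are invariant under integer translations\<close>

text \<open>Points are functions on all of \<open>\<nat>\<close>, and translations move the first
  \<open>d\<close> coordinates, since the dimension \<open>d\<close> is a number that depends on the
  other data of the problem.\<close>

definition int_vectors :: "nat \<Rightarrow> (nat \<Rightarrow> real) set" where
  "int_vectors d = {v. (\<forall>j<d. v j \<in> \<int>) \<and> (\<forall>j\<ge>d. v j = 0)}"

definition translate :: "(nat \<Rightarrow> real) \<Rightarrow> (nat \<Rightarrow> real) \<Rightarrow> nat \<Rightarrow> real" where
  "translate v x = (\<lambda>j. x j + v j)"

lemma int_vectors_closed:
  "(\<lambda>_. 0) \<in> int_vectors d" "v \<in> int_vectors d \<Longrightarrow> (\<lambda>j. - v j) \<in> int_vectors d"
  "v \<in> int_vectors d \<Longrightarrow> w \<in> int_vectors d \<Longrightarrow> (\<lambda>j. v j + w j) \<in> int_vectors d"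
  "v \<in> int_vectors d \<Longrightarrow> w \<in> int_vectors d \<Longrightarrow> (\<lambda>j. v j - w j) \<in> int_vectors d"
  by (auto simp: int_vectors_def)

lemma path_component_translate:
  assumes inv: "\<And>x. x \<in> W \<Longrightarrow> translate v x \<in> W" and "path_component W x y"
  shows "path_component W (translate v x) (translate v y)"
proof -
  obtain g where g: "path g" "path_image g \<subseteq> W" "pathstart g = x" "pathfinish g = y"
    using assms(2) by (auto simp: path_component_def)
  have "path (\<lambda>t. translate v (g t))"
    using g(1) unfolding path_def translate_def
    by (intro continuous_on_coordinatewise_then_product[where S = "{0..1}"] continuous_on_add continuous_on_const)
       (rule continuous_on_product_then_coordinatewise)
  then show ?thesis
    unfolding path_component_def
    using g inv by (intro exI[of _ "\<lambda>t. translate v (g t)"]) (auto simp: path_image_def pathstart_def pathfinish_def)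
qed

lemma path_component_line:
  fixes x y :: "nat \<Rightarrow> real"
  assumes "\<And>t. t \<in> {0..1} \<Longrightarrow> (\<lambda>j. (1 - t) * x j + t * y j) \<in> W"
  shows "path_component W x y"
  unfolding path_component_def
proof (intro exI conjI)
  show "path (\<lambda>t j. (1 - t) * x j + t * y j)"
    unfolding path_def by (rule continuous_on_coordinatewise_then_product) (intro continuous_intros)
qed (use assms in \<open>auto simp: path_image_def pathstart_def pathfinish_def\<close>)

text \<open>If no path in the invariant set \<open>W\<close> joins a point to a different translate,
  then the integer vectors permute the path components of \<open>W\<close> freely. Choosing a base
  point in every orbit of components, one labels a component by the translation that leads to it
  from the base component. The label is constant on path components and changes under translations
  like a point of space does.\<close>

lemma equivariant_component_label:
  assumes inv: "\<And>x v. x \<in> W \<Longrightarrow> v \<in> int_vectors d \<Longrightarrow> translate v x \<in> W"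
    and free: "\<And>x v. v \<in> int_vectors d \<Longrightarrow> path_component W x (translate v x) \<Longrightarrow> v = (\<lambda>_. 0)"
  obtains \<tau> where "\<And>x v. x \<in> W \<Longrightarrow> v \<in> int_vectors d \<Longrightarrow> \<tau> (translate v x) = (\<lambda>j. \<tau> x j + v j)"
    "\<And>x y. path_component W x y \<Longrightarrow> \<tau> x = \<tau> y"
proof -
  \<comment> \<open>\<open>Orb x\<close> is the union of the components that are translates of the
    component of \<open>x\<close>.\<close>
  define Orb where "Orb x = {y. \<exists>v\<in>int_vectors d. path_component W (translate v x) y}" for x
  define base where "base x = (SOME y. y \<in> Orb x)" for x
  define good where "good x u \<longleftrightarrow> u \<in> int_vectors d \<and> path_component W x (translate u (base x))" for x u
  define \<tau> where "\<tau> x = (SOME u. good x u)" for x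
  have tr: "path_component W (translate v x) (translate v y)"
    if "v \<in> int_vectors d" "path_component W x y" for v x y
    by (rule path_component_translate[OF _ that(2)]) (rule inv[OF _ that(1)])
  have assoc: "translate v (translate w x) = translate (\<lambda>j. w j + v j) x" for v w x
    by (simp add: translate_def add.assoc)
  have zero: "translate (\<lambda>_. 0) x = x" for x by (simp add: translate_def)
  have ex: "\<exists>u. good x u" if "x \<in> W" for x
  proof -
    have "x \<in> Orb x"
      unfolding Orb_def using that int_vectors_closed(1)
      by (auto intro!: bexI[of _ "\<lambda>_. 0"] simp: zero path_component_refl)
    then have "base x \<in> Orb x" unfolding base_def by (rule someI[of "\<lambda>y. y \<in> Orb x"])
    then obtain v where v: "v \<in> int_vectors d" "path_component W (translate v x) (base x)"
      unfolding Orb_def by blast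
    have "path_component W (translate (\<lambda>j. - v j) (translate v x)) (translate (\<lambda>j. - v j) (base x))"
      by (rule tr[OF int_vectors_closed(2)[OF v(1)] v(2)])
    then show ?thesis
      unfolding good_def using int_vectors_closed(2)[OF v(1)] by (auto simp: assoc zero)
  qed
  have unique: "u = w" if "good x u" "good x w" for x u w
  proof -
    have "path_component W (translate u (base x)) (translate (\<lambda>j. w j - u j) (translate u (base x)))"
      using path_component_trans[OF path_component_sym, of W x "translate u (base x)" "translate w (base x)"] that
      unfolding good_def assoc by simp
    moreover have "(\<lambda>j. w j - u j) \<in> int_vectors d"
      using that int_vectors_closed(4) unfolding good_def by blast
    ultimately have "(\<lambda>j. w j - u j) = (\<lambda>_. 0)" using free by blast
    then have "w j - u j = 0" for j by (rule fun_cong)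
    then show ?thesis by (simp add: fun_eq_iff)
  qed
  have eqI: "\<tau> x = u" if "good x u" for x u
    unfolding \<tau>_def using unique[OF _ that] someI[of "good x", OF that] by blast
  have good: "good x (\<tau> x)" if "x \<in> W" for x
    unfolding \<tau>_def using ex[OF that] by (rule someI_ex)
  have Orb_tr: "Orb (translate v x) = Orb x" if "v \<in> int_vectors d" for v x
  proof (intro equalityI subsetI)
    fix y assume "y \<in> Orb (translate v x)"
    then obtain w where "w \<in> int_vectors d" "path_component W (translate w (translate v x)) y"
      unfolding Orb_def by blast
    then show "y \<in> Orb x"
      unfolding Orb_def assoc using int_vectors_closed(3)[OF that, of w] by blast
  next
    fix y assume "y \<in> Orb x"
    then obtain w where w: "w \<in> int_vectors d" "path_component W (translate w x) y"
      unfolding Orb_def by blast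
    then have "path_component W (translate (\<lambda>j. w j - v j) (translate v x)) y"
      unfolding assoc by simp
    then show "y \<in> Orb (translate v x)"
      unfolding Orb_def using int_vectors_closed(4)[OF w(1) that] by blast
  qed
  have Orb_path: "Orb x \<subseteq> Orb y" if "path_component W y x" for x y
  proof
    fix z assume "z \<in> Orb x"
    then obtain v where v: "v \<in> int_vectors d" "path_component W (translate v x) z"
      unfolding Orb_def by blast
    have "path_component W (translate v y) (translate v x)"
      by (rule tr[OF v(1) that])
    then show "z \<in> Orb y"
      unfolding Orb_def using v path_component_trans by blast
  qed
  show thesis
  proof (rule that)
    fix x v assume x: "x \<in> W" and v: "v \<in> int_vectors d"
    have "base (translate v x) = base x" by (simp add: base_def Orb_tr[OF v])
    moreover have "path_component W (translate v x) (translate v (translate (\<tau> x) (base x)))"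
      using tr[OF v] good[OF x] unfolding good_def by blast
    ultimately show "\<tau> (translate v x) = (\<lambda>j. \<tau> x j + v j)"
      using good[OF x] int_vectors_closed(3)[OF _ v] unfolding assoc by (intro eqI) (auto simp: good_def)
  next
    fix x y assume p: "path_component W x y"
    then have "y \<in> W" by (auto dest: path_component_mem)
    have "Orb x = Orb y" using Orb_path p path_component_sym by blast
    then have "base x = base y" by (simp add: base_def)
    then have "good x (\<tau> y)"
      using good[OF \<open>y \<in> W\<close>] path_component_trans[OF p] unfolding good_def by simp
    then show "\<tau> x = \<tau> y" by (rule eqI)
  qed
qed

lemma dist_function_le:
  fixes x y :: "nat \<Rightarrow> real"
  assumes "\<And>j. \<bar>x j - y j\<bar> \<le> \<delta>"
  shows "dist x y \<le> 2 * \<delta>"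
proof -
  have le: "(1/2)^n * min (dist (x (from_nat n)) (y (from_nat n))) 1 \<le> (1/2)^n * \<delta>" for n
    using assms[of "from_nat n"] by (intro mult_left_mono) (auto simp: dist_real_def)
  have s: "summable (\<lambda>n. (1/2::real)^n * \<delta>)" by (intro summable_mult2 summable_geometric) auto
  have "dist x y = (\<Sum>n. (1/2)^n * min (dist (x (from_nat n)) (y (from_nat n))) 1)"
    by (rule dist_fun_def)
  also have "\<dots> \<le> (\<Sum>n. (1/2)^n * \<delta>)"
    by (intro suminf_le le s summable_comparison_test'[OF s, of 0]) (use le in \<open>auto simp: abs_mult\<close>)
  also have "\<dots> = 2 * \<delta>"
    using suminf_geometric[of "1/2::real"] by (subst suminf_mult2[symmetric]) (auto intro: summable_geometric)
  finally show ?thesis .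
qed

text \<open>A Lebesgue number for the compact unit cube, carried over to all of space by the
  periodicity of the cover.\<close>

lemma uniform_grid:
  fixes W :: "nat \<Rightarrow> (nat \<Rightarrow> real) set"
  assumes op: "\<And>i. i \<le> k \<Longrightarrow> open (W i)"
    and cov: "\<And>x. \<exists>i\<le>k. x \<in> W i"
    and inv: "\<And>i x v. i \<le> k \<Longrightarrow> x \<in> W i \<Longrightarrow> v \<in> int_vectors d \<Longrightarrow> translate v x \<in> W i"
  shows "\<exists>M::nat. M > 0 \<and> (\<forall>q. (\<forall>j\<ge>d. q j = 0) \<longrightarrow>
    (\<exists>i\<le>k. \<forall>x. (\<forall>j. \<bar>x j - q j\<bar> \<le> 1 / real M) \<longrightarrow> x \<in> W i))"
proof -
  define K :: "(nat \<Rightarrow> real) set" where "K = PiE UNIV (\<lambda>j. if j < d then {0..1} else {0})"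
  have "compactin (product_topology (\<lambda>_. euclideanreal) UNIV) K"
    unfolding K_def by (subst compactin_PiE) auto
  then have "compact K" by (simp add: euclidean_product_topology)
  moreover have "K \<subseteq> \<Union>(W ` {..k})" using cov by auto
  ultimately obtain e where e: "e > 0" "\<And>x. x \<in> K \<Longrightarrow> \<exists>G\<in>W ` {..k}. ball x e \<subseteq> G"
    by (rule Heine_Borel_lemma) (use op in auto)
  obtain M :: nat where M: "M > 0" "2 * (1 / real M) < e"
  proof -
    obtain M :: nat where "real M > 2 / e" using reals_Archimedean2 by blast
    moreover from this have "M > 0" using e(1) by (cases M) (auto simp: divide_simps)
    ultimately show thesis using that[of M] e(1) by (auto simp: field_simps)
  qed
  show ?thesis
  proof (rule exI[of _ M], intro conjI M(1) allI impI)
    fix q :: "nat \<Rightarrow> real" assume "\<forall>j\<ge>d. q j = 0"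
    then have q: "\<And>j. j \<ge> d \<Longrightarrow> q j = 0" by blast
    define v :: "nat \<Rightarrow> real" where "v = (\<lambda>j. of_int \<lfloor>q j\<rfloor>)"
    have v: "v \<in> int_vectors d" using q by (auto simp: v_def int_vectors_def)
    have "translate (\<lambda>j. - v j) q \<in> K"
      unfolding K_def PiE_UNIV_domain translate_def v_def Pi_iff
    proof
      fix j :: nat
      have "0 \<le> q j - of_int \<lfloor>q j\<rfloor>" "q j - of_int \<lfloor>q j\<rfloor> \<le> 1" by linarith+
      then show "q j + - of_int \<lfloor>q j\<rfloor> \<in> (if j < d then {0..1} else {0})"
        using q[of j] by auto
    qed
    from e(2)[OF this] obtain i where i: "i \<le> k" "ball (translate (\<lambda>j. - v j) q) e \<subseteq> W i" by auto
    have "x \<in> W i" if x: "\<forall>j. \<bar>x j - q j\<bar> \<le> 1 / real M" for x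
    proof -
      have "dist (translate (\<lambda>j. - v j) q) (translate (\<lambda>j. - v j) x) \<le> 2 * (1 / real M)"
        using x by (intro dist_function_le) (simp add: translate_def abs_minus_commute)
      then have "translate (\<lambda>j. - v j) x \<in> W i" using i(2) M(2) by auto
      from inv[OF i(1) this v] show ?thesis by (simp add: translate_def)
    qed
    then show "\<exists>i\<le>k. \<forall>x. (\<forall>j. \<bar>x j - q j\<bar> \<le> 1 / real M) \<longrightarrow> x \<in> W i" using i(1) by blast
  qed
qed

text \<open>This is the lower bound \<open>d\<close> for the covering dimension of the
  \<open>d\<close>-dimensional torus, in the form that is needed below. Suppose that no such path
  exists. Then every set of the cover has an equivariant label \<open>\<tau> i\<close>, and \<open>x
  - \<tau> i x\<close> is invariant under translations; on a fine grid it takes finitely many values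
  and so is bounded. On the faces of a large enough box the sign of the \<open>i\<close>-th
  coordinate of \<open>\<tau> i x\<close> is therefore that of \<open>x i\<close>, as Kuhn's
  combinatorial lemma demands. By that lemma some small cell of the grid carries both labels in
  every coordinate. But the cell is contained in one of the sets \<open>W i\<close>, where
  \<open>\<tau> i\<close> is constant on it. This uses one coordinate for each set, whence the
  hypothesis \<open>k < d\<close>.\<close>

proposition periodic_open_cover:
  fixes W :: "nat \<Rightarrow> (nat \<Rightarrow> real) set"
  assumes op: "\<And>i. i \<le> k \<Longrightarrow> open (W i)"
    and cov: "\<And>x. \<exists>i\<le>k. x \<in> W i"
    and inv: "\<And>i x v. i \<le> k \<Longrightarrow> x \<in> W i \<Longrightarrow> v \<in> int_vectors d \<Longrightarrow> translate v x \<in> W i"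
    and "k < d"
  shows "\<exists>i x v. i \<le> k \<and> v \<in> int_vectors d \<and> v \<noteq> (\<lambda>_. 0) \<and> path_component (W i) x (translate v x)"
proof (rule ccontr)
  assume neg: "\<not> ?thesis"
  define P where "P i t \<longleftrightarrow> (\<forall>x v. x \<in> W i \<longrightarrow> v \<in> int_vectors d \<longrightarrow> t (translate v x) = (\<lambda>j. t x j + v j))
      \<and> (\<forall>x y. path_component (W i) x y \<longrightarrow> t x = t y)" for i and t :: "(nat \<Rightarrow> real) \<Rightarrow> nat \<Rightarrow> real"
  define \<tau> where "\<tau> i = (SOME t. P i t)" for i
  have P: "P i (\<tau> i)" if "i \<le> k" for i
  proof -
    have "\<exists>t. P i t"
    proof (rule equivariant_component_label[of "W i" d])
      show "translate v x \<in> W i" if "x \<in> W i" "v \<in> int_vectors d" for x v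
        by (rule inv[OF \<open>i \<le> k\<close> that])
      show "v = (\<lambda>_. 0)" if "v \<in> int_vectors d" "path_component (W i) x (translate v x)" for x v
        using neg that \<open>i \<le> k\<close> by blast
      fix t assume "\<And>x v. x \<in> W i \<Longrightarrow> v \<in> int_vectors d \<Longrightarrow> t (translate v x) = (\<lambda>j. t x j + v j)"
        "\<And>x y. path_component (W i) x y \<Longrightarrow> t x = t y"
      then have "P i t" unfolding P_def by simp
      then show "\<exists>t. P i t" by (rule exI[of "P i"])
    qed
    then show ?thesis unfolding \<tau>_def by (rule someI_ex)
  qed
  have \<tau>: "\<tau> i (translate v x) = (\<lambda>j. \<tau> i x j + v j)" if "i \<le> k" "x \<in> W i" "v \<in> int_vectors d" for i x v
    using P[OF that(1)] that(2,3) unfolding P_def by blast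
  have \<tau>_path: "\<tau> i x = \<tau> i y" if "i \<le> k" "path_component (W i) x y" for i x y
    using P[OF that(1)] that(2) unfolding P_def by blast
  have "\<exists>M::nat. M > 0 \<and> (\<forall>q. (\<forall>j\<ge>d. q j = 0) \<longrightarrow>
    (\<exists>i\<le>k. \<forall>x. (\<forall>j. \<bar>x j - q j\<bar> \<le> 1 / real M) \<longrightarrow> x \<in> W i))"
    using op cov inv by (rule uniform_grid)
  then obtain M :: nat where M: "M > 0" "\<forall>q. (\<forall>j\<ge>d. q j = 0) \<longrightarrow>
    (\<exists>i\<le>k. \<forall>x. (\<forall>j. \<bar>x j - q j\<bar> \<le> 1 / real M) \<longrightarrow> x \<in> W i)" by blast
  define grid :: "(nat \<Rightarrow> real) set"
    where "grid = {x. \<forall>j. (j \<in> {..<d} \<longrightarrow> x j \<in> (\<lambda>a::nat. real a / real M) ` {..<M}) \<and> (j \<notin> {..<d} \<longrightarrow> x j = 0)}"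
  have "finite grid" unfolding grid_def by (intro finite_set_of_finite_funs) auto
  then have "finite ((\<lambda>(i, x, j). \<bar>x j - \<tau> i x j\<bar>) ` ({..k} \<times> grid \<times> {..<d}))" by blast
  then have "\<exists>B0. \<forall>z\<in>(\<lambda>(i, x, j). \<bar>x j - \<tau> i x j\<bar>) ` ({..k} \<times> grid \<times> {..<d}). z \<le> B0"
    using bdd_above_finite by (simp only: bdd_above_def)
  then obtain B0 where B0: "\<forall>z\<in>(\<lambda>(i, x, j). \<bar>x j - \<tau> i x j\<bar>) ` ({..k} \<times> grid \<times> {..<d}). z \<le> B0" ..
  obtain B :: nat where "B0 \<le> real B" using real_arch_simple by blast
  have B: "\<bar>x j - \<tau> i x j\<bar> \<le> real B" if "i \<le> k" "x \<in> grid" "j < d" for i x j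
  proof -
    have "(i, x, j) \<in> {..k} \<times> grid \<times> {..<d}" using that by simp
    from B0[rule_format, OF imageI[OF this]] show ?thesis using \<open>B0 \<le> real B\<close> by simp
  qed
  \<comment> \<open>The box \<open>[-N, N]\<close> to the power \<open>d\<close> is subdivided into
    cells of side \<open>1 / M\<close>; it is larger than the bound \<open>B\<close>.\<close>
  define N where "N = Suc B"
  define p where "p = 2 * N * M"
  define pt :: "(nat \<Rightarrow> nat) \<Rightarrow> nat \<Rightarrow> real"
    where "pt q = (\<lambda>j. if j < d then real (q j) / real M - real N else 0)" for q
  have bound: "\<bar>pt q j - \<tau> i (pt q) j\<bar> \<le> real B" if "i \<le> k" "pt q \<in> W i" "j < d" for i q j
  proof -
    define x where "x = (\<lambda>j. if j < d then real (q j mod M) / real M else 0)"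
    define v where "v = (\<lambda>j. if j < d then real (q j div M) - real N else 0)"
    have v: "v \<in> int_vectors d" by (auto simp: v_def int_vectors_def)
    have qM: "real (q j) / real M = real (q j mod M) / real M + real (q j div M)" for j
    proof -
      have "real (q j) = real (q j mod M) + real (q j div M) * real M"
        by (metis mod_mult_div_eq mult.commute of_nat_add of_nat_mult)
      then show ?thesis using M(1) by (simp add: add_divide_distrib)
    qed
    have eq: "pt q = translate v x"
      by (auto simp: translate_def pt_def v_def x_def qM)
    have "x \<in> grid" using M(1) by (auto simp: grid_def x_def)
    have "x = translate (\<lambda>j. - v j) (pt q)" by (simp add: eq translate_def)
    then have xW: "x \<in> W i" using inv[OF that(1,2) int_vectors_closed(2)[OF v]] by simp
    have "pt q j - \<tau> i (pt q) j = x j - \<tau> i x j"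
      unfolding eq \<tau>[OF that(1) xW v] by (simp add: translate_def)
    then show ?thesis using B[OF that(1) \<open>x \<in> grid\<close> that(3)] by simp
  qed
  \<comment> \<open>The first two cases are the boundary values in Kuhn's lemma; for points of \<open>W j\<close> they agree
    with the sign of \<open>\<tau> j (pt q) j\<close>.\<close>
  define label :: "(nat \<Rightarrow> nat) \<Rightarrow> nat \<Rightarrow> nat"
    where "label q j = (if q j = 0 then 0 else if q j = p then 1 else
      if j \<le> k \<and> pt q \<in> W j \<and> \<tau> j (pt q) j \<ge> 0 then 1 else 0)" for q j
  have "p > 0" using M(1) by (simp add: p_def N_def)
  have label: "label q i = (if \<tau> i (pt q) i \<ge> 0 then 1 else 0)" if "i \<le> k" "pt q \<in> W i" for q i
  proof -
    have "i < d" using that \<open>k < d\<close> by simp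
    note b = bound[OF that this]
    have "pt q i = - real N" if "q i = 0" using that \<open>i < d\<close> by (simp add: pt_def)
    moreover have "pt q i = real N" if "q i = p"
      using that \<open>i < d\<close> M(1) by (simp add: pt_def p_def)
    ultimately show ?thesis
      using b that \<open>p > 0\<close> by (auto simp: label_def N_def)
  qed
  obtain q where q: "\<forall>i<d. q i < p"
    "\<forall>i<d. \<exists>r s. (\<forall>j<d. q j \<le> r j \<and> r j \<le> q j + 1) \<and> (\<forall>j<d. q j \<le> s j \<and> s j \<le> q j + 1) \<and> label r i \<noteq> label s i"
    by (rule kuhn_lemma[OF \<open>p > 0\<close>, of d label]) (use \<open>p > 0\<close> in \<open>auto simp: label_def\<close>)
  have "\<forall>j\<ge>d. pt q j = 0" by (simp add: pt_def)
  then obtain i where i: "i \<le> k" "\<forall>x. (\<forall>j. \<bar>x j - pt q j\<bar> \<le> 1 / real M) \<longrightarrow> x \<in> W i"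
    using M(2)[rule_format, of "pt q"] by blast
  have "i < d" using i(1) \<open>k < d\<close> by simp
  then obtain r s where "\<forall>j<d. q j \<le> r j \<and> r j \<le> q j + 1" "\<forall>j<d. q j \<le> s j \<and> s j \<le> q j + 1"
    and rs_label: "label r i \<noteq> label s i"
    using q(2)[rule_format, of i] by blast
  note rs = this(1,2)[rule_format]
  have near: "0 \<le> pt r j - pt q j \<and> pt r j - pt q j \<le> 1 / real M"
    if "\<And>j. j < d \<Longrightarrow> q j \<le> r j \<and> r j \<le> q j + 1" for r j
  proof (cases "j < d")
    case True
    then have "0 \<le> real (r j) - real (q j)" "real (r j) - real (q j) \<le> 1" using that[OF True] by auto
    then have "0 \<le> (real (r j) - real (q j)) / real M" "(real (r j) - real (q j)) / real M \<le> 1 / real M"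
      using M(1) by (auto simp: divide_right_mono)
    then show ?thesis using True by (simp add: pt_def diff_divide_distrib)
  qed (simp add: pt_def)
  have "path_component (W i) (pt r) (pt s)"
  proof (intro path_component_line i(2)[rule_format])
    fix t :: real and j assume t: "t \<in> {0..1}"
    have "(1 - t) * pt r j + t * pt s j - pt q j = (1 - t) * (pt r j - pt q j) + t * (pt s j - pt q j)"
      by (simp add: algebra_simps)
    moreover have "0 \<le> (1 - t) * (pt r j - pt q j) + t * (pt s j - pt q j)"
      using t near[OF rs(1), of j] near[OF rs(2), of j] by simp
    moreover have "(1 - t) * (pt r j - pt q j) + t * (pt s j - pt q j) \<le> (1 - t) * (1 / real M) + t * (1 / real M)"
      using t near[OF rs(1), of j] near[OF rs(2), of j] by (intro add_mono mult_left_mono) auto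
    moreover have "(1 - t) * (1 / real M) + t * (1 / real M) = 1 / real M"
      unfolding distrib_right[symmetric] by simp
    ultimately show "\<bar>(1 - t) * pt r j + t * pt s j - pt q j\<bar> \<le> 1 / real M" by linarith
  qed
  note pc = this
  have "\<tau> i (pt r) = \<tau> i (pt s)" by (rule \<tau>_path[OF i(1) pc])
  moreover have "pt r \<in> W i" "pt s \<in> W i" using path_component_mem[OF pc] by auto
  ultimately show False using rs_label label[OF i(1), of r] label[OF i(1), of s] by simp
qed

section \<open>Loops and the fundamental group\<close>

text \<open>The fundamental group is given by maps on the one-dimensional cube, whose points are
  functions on \<open>{..<1}\<close>. Loops on the unit interval are an equivalent description with
  a simpler domain. The numeral \<open>1\<close> for the dimension is kept from being rewritten to
  \<open>Suc 0\<close>.\<close>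

declare One_nat_def [simp del]

definition loop_at :: "'a topology \<Rightarrow> 'a \<Rightarrow> (real \<Rightarrow> 'a) \<Rightarrow> bool" where
  "loop_at X x0 g \<longleftrightarrow> continuous_map (top_of_set {0..1}) X g \<and> g 0 = x0 \<and> g 1 = x0"

definition loop_homotopic :: "'a topology \<Rightarrow> 'a \<Rightarrow> (real \<Rightarrow> 'a) \<Rightarrow> (real \<Rightarrow> 'a) \<Rightarrow> bool" where
  "loop_homotopic X x0 g h \<longleftrightarrow>
     (\<exists>H. continuous_map (top_of_set ({0..1::real} \<times> {0..1::real})) X H \<and>
        (\<forall>u\<in>{0..1}. H (0, u) = g u \<and> H (1, u) = h u) \<and>
        (\<forall>s\<in>{0..1}. H (s, 0) = x0 \<and> H (s, 1) = x0))"

definition loop_concat :: "(real \<Rightarrow> 'a) \<Rightarrow> (real \<Rightarrow> 'a) \<Rightarrow> real \<Rightarrow> 'a" where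
  "loop_concat g h t = (if t \<le> 1/2 then g (2 * t) else h (2 * t - 1))"

definition loop_spheroid :: "(real \<Rightarrow> 'a) \<Rightarrow> (nat \<Rightarrow> real) \<Rightarrow> 'a" where
  "loop_spheroid g y = g (y 0)"

definition loop_class :: "'a topology \<Rightarrow> 'a \<Rightarrow> (real \<Rightarrow> 'a) \<Rightarrow> ((nat \<Rightarrow> real) \<Rightarrow> 'a) set" where
  "loop_class X x0 g = {f. spheroid_homotopic 1 X x0 (loop_spheroid g) f}"

lemma spheroid_homotopic_iff:
  "spheroid_homotopic k X x0 f g \<longleftrightarrow>
     (\<exists>H. continuous_map (prod_topology (top_of_set {0..1::real}) (cube k)) X H \<and>
        (\<forall>y\<in>topspace (cube k). H (0, y) = f y \<and> H (1, y) = g y) \<and>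
        (\<forall>t\<in>{0..1::real}. \<forall>y\<in>cube_boundary k. H (t, y) = x0))"
proof -
  have sub: "cube_boundary k \<subseteq> topspace (cube k)" by (auto simp: cube_boundary_def)
  have "(h ` cube_boundary k \<subseteq> {x0}) = (h' ` cube_boundary k \<subseteq> {x0})"
    if "\<And>y. y \<in> topspace (cube k) \<Longrightarrow> h y = h' y" for h h' :: "(nat \<Rightarrow> real) \<Rightarrow> 'a"
  proof -
    have "h ` cube_boundary k = h' ` cube_boundary k"
      by (rule image_cong[OF refl]) (use that sub in blast)
    then show ?thesis by simp
  qed
  from homotopic_with[of "cube k" "\<lambda>h. h ` cube_boundary k \<subseteq> {x0}" X f g, OF this]
  show ?thesis unfolding spheroid_homotopic_def image_subset_iff singleton_iff by (simp add: ball_conj_distrib conj_assoc)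
qed

lemma spheroid_homotopic_sym: "spheroid_homotopic k X x0 f g \<Longrightarrow> spheroid_homotopic k X x0 g f"
  unfolding spheroid_homotopic_def by (rule homotopic_with_symD)

lemma spheroid_homotopic_trans:
  "spheroid_homotopic k X x0 f g \<Longrightarrow> spheroid_homotopic k X x0 g h \<Longrightarrow> spheroid_homotopic k X x0 f h"
  unfolding spheroid_homotopic_def by (rule homotopic_with_trans)

lemma spheroid_homotopic_agree:
  assumes f: "f \<in> spheroids k X x0" and fg: "\<And>y. y \<in> topspace (cube k) \<Longrightarrow> f y = g y"
  shows "spheroid_homotopic k X x0 f g"
proof -
  have "g ` cube_boundary k = f ` cube_boundary k"
    by (rule image_cong[OF refl]) (use fg in \<open>auto simp: cube_boundary_def\<close>)
  then show ?thesis
    using f unfolding spheroid_homotopic_def spheroids_def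
    by (intro homotopic_with_equal) (auto simp: fg)
qed

lemma spheroid_homotopic_spheroids:
  assumes "spheroid_homotopic k X x0 f g"
  shows "f \<in> spheroids k X x0" "g \<in> spheroids k X x0"
  using homotopic_with_imp_continuous_maps[OF assms[unfolded spheroid_homotopic_def]]
    homotopic_with_imp_property[OF assms[unfolded spheroid_homotopic_def]]
  by (auto simp: spheroids_def)

definition cube_point :: "real \<Rightarrow> nat \<Rightarrow> real" where
  "cube_point t = (\<lambda>i\<in>{..<1}. t)"

lemma topspace_cube1: "y \<in> topspace (cube 1) \<Longrightarrow> y 0 \<in> {0..1} \<and> y = cube_point (y 0)"
  by (auto simp: cube_def cube_point_def PiE_iff extensional_def fun_eq_iff)

lemma cube_point_topspace: "t \<in> {0..1} \<Longrightarrow> cube_point t \<in> topspace (cube 1)"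
  by (auto simp: cube_def cube_point_def)

lemma cube_point_0 [simp]: "cube_point t 0 = t"
  by (simp add: cube_point_def)

lemma cube_boundary1_iff: "y \<in> cube_boundary 1 \<longleftrightarrow> y = cube_point 0 \<or> y = cube_point 1"
  using topspace_cube1[of y] cube_point_topspace[of 0] cube_point_topspace[of 1]
  by (auto simp: cube_boundary_def)

lemma cube_boundary1: "cube_boundary 1 = {cube_point 0, cube_point 1}"
  by (auto simp: cube_boundary1_iff)

lemma continuous_cube_coordinate: "continuous_map (cube 1) (top_of_set {0..1}) (\<lambda>y. y 0)"
  unfolding cube_def by (rule continuous_map_product_projection) simp

lemma continuous_cube_point: "continuous_map (top_of_set {0..1}) (cube 1) cube_point"
  unfolding cube_def cube_point_def
  by (rule continuous_map_coordinatewise_then_product) auto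

lemma unit_square_topology:
  "top_of_set ({0..1::real} \<times> {0..1::real}) = prod_topology (top_of_set {0..1::real}) (top_of_set {0..1::real})"
  by (simp add: prod_topology_subtopology_eu)

lemma loop_homotopic_iff_spheroid:
  "loop_homotopic X x0 g h \<longleftrightarrow> spheroid_homotopic 1 X x0 (loop_spheroid g) (loop_spheroid h)"
proof
  assume "loop_homotopic X x0 g h"
  then obtain H where H: "continuous_map (top_of_set ({0..1::real} \<times> {0..1::real})) X H"
    "\<forall>u\<in>{0..1}. H (0, u) = g u \<and> H (1, u) = h u" "\<forall>s\<in>{0..1}. H (s, 0) = x0 \<and> H (s, 1) = x0"
    unfolding loop_homotopic_def by blast
  have "continuous_map (prod_topology (top_of_set {0..1::real}) (cube 1))
      (prod_topology (top_of_set {0..1::real}) (top_of_set {0..1::real})) (\<lambda>z. (fst z, snd z 0))"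
    by (intro continuous_map_pairedI continuous_map_fst
        continuous_map_compose[OF continuous_map_snd continuous_cube_coordinate, unfolded o_def])
  from continuous_map_compose[OF this] H(1)
  have "continuous_map (prod_topology (top_of_set {0..1::real}) (cube 1)) X (\<lambda>z. H (fst z, snd z 0))"
    unfolding unit_square_topology o_def by blast
  then show "spheroid_homotopic 1 X x0 (loop_spheroid g) (loop_spheroid h)"
    unfolding spheroid_homotopic_iff loop_spheroid_def using H(2,3) topspace_cube1
    by (intro exI[of _ "\<lambda>z. H (fst z, snd z 0)"]) (simp add: cube_boundary1)
next
  assume "spheroid_homotopic 1 X x0 (loop_spheroid g) (loop_spheroid h)"
  then obtain H where H: "continuous_map (prod_topology (top_of_set {0..1::real}) (cube 1)) X H"
    "\<forall>y\<in>topspace (cube 1). H (0, y) = loop_spheroid g y \<and> H (1, y) = loop_spheroid h y"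
    "\<forall>t\<in>{0..1::real}. \<forall>y\<in>cube_boundary 1. H (t, y) = x0"
    unfolding spheroid_homotopic_iff by blast
  have "continuous_map (prod_topology (top_of_set {0..1::real}) (top_of_set {0..1::real}))
      (prod_topology (top_of_set {0..1::real}) (cube 1)) (\<lambda>z. (fst z, cube_point (snd z)))"
    by (intro continuous_map_pairedI continuous_map_fst
        continuous_map_compose[OF continuous_map_snd continuous_cube_point, unfolded o_def])
  from continuous_map_compose[OF this H(1)]
  have "continuous_map (top_of_set ({0..1::real} \<times> {0..1::real})) X (\<lambda>z. H (fst z, cube_point (snd z)))"
    unfolding unit_square_topology o_def .
  then show "loop_homotopic X x0 g h"
    unfolding loop_homotopic_def using H(2,3) cube_point_topspace
    by (intro exI[of _ "\<lambda>z. H (fst z, cube_point (snd z))"]) (auto simp: loop_spheroid_def cube_boundary1)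
qed

lemma loop_homotopic_refl: "loop_at X x0 g \<Longrightarrow> loop_homotopic X x0 g g"
  unfolding loop_homotopic_def loop_at_def
  by (intro exI[of _ "\<lambda>z. g (snd z)"])
     (auto intro!: continuous_map_set_compose[of "{0..1}" X g _ snd] continuous_on_snd continuous_on_id)

lemma loop_homotopic_sym: "loop_homotopic X x0 g h \<Longrightarrow> loop_homotopic X x0 h g"
  unfolding loop_homotopic_iff_spheroid by (rule spheroid_homotopic_sym)

lemma loop_spheroid_spheroids: "loop_at X x0 g \<Longrightarrow> loop_spheroid g \<in> spheroids 1 X x0"
  by (rule spheroid_homotopic_spheroids(1)[OF loop_homotopic_refl[unfolded loop_homotopic_iff_spheroid]])

lemma spheroid_as_loop:
  assumes "f \<in> spheroids 1 X x0"
  shows "loop_at X x0 (\<lambda>t. f (cube_point t))"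
    "spheroid_homotopic 1 X x0 f (loop_spheroid (\<lambda>t. f (cube_point t)))"
proof -
  have f: "continuous_map (cube 1) X f" "\<And>y. y \<in> cube_boundary 1 \<Longrightarrow> f y = x0"
    using assms by (auto simp: spheroids_def)
  have "continuous_map (top_of_set {0..1}) X (\<lambda>t. f (cube_point t))"
    using continuous_map_compose[OF continuous_cube_point f(1)] by (simp add: o_def)
  then show "loop_at X x0 (\<lambda>t. f (cube_point t))"
    unfolding loop_at_def using f(2) by (simp add: cube_boundary1)
  show "spheroid_homotopic 1 X x0 f (loop_spheroid (\<lambda>t. f (cube_point t)))"
    by (rule spheroid_homotopic_agree[OF assms]) (use topspace_cube1 in \<open>simp add: loop_spheroid_def\<close>)
qed

lemma loop_concat_homotopic:
  assumes "loop_homotopic X x0 g g'" "loop_homotopic X x0 h h'"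
  shows "loop_homotopic X x0 (loop_concat g h) (loop_concat g' h')"
proof -
  obtain H where H: "continuous_map (top_of_set ({0..1::real} \<times> {0..1::real})) X H"
    "\<forall>u\<in>{0..1}. H (0, u) = g u \<and> H (1, u) = g' u" "\<forall>s\<in>{0..1}. H (s, 0) = x0 \<and> H (s, 1) = x0"
    using assms(1) unfolding loop_homotopic_def by blast
  obtain K where K: "continuous_map (top_of_set ({0..1::real} \<times> {0..1::real})) X K"
    "\<forall>u\<in>{0..1}. K (0, u) = h u \<and> K (1, u) = h' u" "\<forall>s\<in>{0..1}. K (s, 0) = x0 \<and> K (s, 1) = x0"
    using assms(2) unfolding loop_homotopic_def by blast
  define M where "M z = (if snd z \<le> 1/2 then H (fst z, 2 * snd z) else K (fst z, 2 * snd z - 1))" for z :: "real \<times> real"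
  have "continuous_map (top_of_set ({0..1::real} \<times> {0..1::real})) X M"
    unfolding M_def
  proof (rule continuous_map_set_cases)
    show "continuous_map (top_of_set {x \<in> {0..1::real} \<times> {0..1::real}. snd x \<le> 1/2}) X (\<lambda>z. H (fst z, 2 * snd z))"
      by (rule continuous_map_set_compose[OF H(1)]) (auto intro!: continuous_intros)
    show "continuous_map (top_of_set {x \<in> {0..1::real} \<times> {0..1::real}. 1/2 \<le> snd x}) X (\<lambda>z. K (fst z, 2 * snd z - 1))"
      by (rule continuous_map_set_compose[OF K(1)]) (auto intro!: continuous_intros)
    show "continuous_on ({0..1::real} \<times> {0..1::real}) (snd :: real \<times> real \<Rightarrow> real)" by (intro continuous_intros)
    show "H (fst x, 2 * snd x) = K (fst x, 2 * snd x - 1)" if "x \<in> {0..1::real} \<times> {0..1::real}" "snd x = 1/2" for x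
      using H(3) K(3) that(1) unfolding that(2) by (simp add: mem_Times_iff)
  qed
  moreover have "M (0, u) = loop_concat g h u \<and> M (1, u) = loop_concat g' h' u" if "u \<in> {0..1}" for u
  proof (cases "u \<le> 1/2")
    case True
    then have "2 * u \<in> {0..1}" using that by simp
    then show ?thesis using H(2) True by (simp add: M_def loop_concat_def)
  next
    case False
    then have "2 * u - 1 \<in> {0..1}" using that by simp
    then show ?thesis using K(2) False by (simp add: M_def loop_concat_def)
  qed
  moreover have "M (s, 0) = x0 \<and> M (s, 1) = x0" if "s \<in> {0..1}" for s
    using H(3) K(3) that by (simp add: M_def)
  ultimately show ?thesis unfolding loop_homotopic_def by blast
qed

lemma loop_at_homotopic: "loop_homotopic X x0 g h \<Longrightarrow> loop_at X x0 g \<and> loop_at X x0 h"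
proof -
  have *: "loop_at X x0 g" if gh: "loop_homotopic X x0 g h" for g h
  proof -
    obtain H where H: "continuous_map (top_of_set ({0..1::real} \<times> {0..1::real})) X H"
      "\<forall>u\<in>{0..1}. H (0, u) = g u \<and> H (1, u) = h u" "\<forall>s\<in>{0..1}. H (s, 0) = x0 \<and> H (s, 1) = x0"
      using gh unfolding loop_homotopic_def by blast
    have "continuous_map (top_of_set {0..1}) X (\<lambda>u. H (0, u))"
      by (rule continuous_map_set_compose[OF H(1)]) (auto intro!: continuous_intros)
    then have "continuous_map (top_of_set {0..1}) X g"
      by (rule continuous_map_eq) (use H(2) in simp)
    moreover have "g 0 = x0" "g 1 = x0"
      using H(2)[rule_format, of 0] H(2)[rule_format, of 1] H(3)[rule_format, of 0] by simp_all
    ultimately show ?thesis by (simp add: loop_at_def)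
  qed
  assume gh: "loop_homotopic X x0 g h"
  show ?thesis by (rule conjI[OF *[OF gh] *[OF loop_homotopic_sym[OF gh]]])
qed

lemma loop_at_concat: "loop_at X x0 g \<Longrightarrow> loop_at X x0 h \<Longrightarrow> loop_at X x0 (loop_concat g h)"
  by (rule conjunct1[OF loop_at_homotopic[OF loop_concat_homotopic[OF loop_homotopic_refl loop_homotopic_refl]]])

lemma spheroid_concat_loops:
  "spheroid_concat (loop_spheroid g) (loop_spheroid h) = loop_spheroid (loop_concat g h)"
  by (auto simp: spheroid_concat_def loop_spheroid_def loop_concat_def fun_eq_iff)

lemma loop_class_carrier:
  "loop_at X x0 g \<Longrightarrow> loop_class X x0 g \<in> carrier (homotopy_group 1 X x0)"
  using quotientI[OF loop_spheroid_spheroids, of X x0 g "{(f, g). spheroid_homotopic 1 X x0 f g}"]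
  by (simp add: homotopy_group_def loop_class_def Image_singleton)

lemma loop_class_eq_iff:
  assumes "loop_at X x0 g" "loop_at X x0 h"
  shows "loop_class X x0 g = loop_class X x0 h \<longleftrightarrow> loop_homotopic X x0 g h"
proof
  assume eq: "loop_class X x0 g = loop_class X x0 h"
  have "loop_spheroid h \<in> loop_class X x0 h"
    using loop_homotopic_refl[OF assms(2)] by (simp add: loop_class_def loop_homotopic_iff_spheroid)
  then have "loop_spheroid h \<in> loop_class X x0 g" by (simp only: eq)
  then show "loop_homotopic X x0 g h" by (simp add: loop_class_def loop_homotopic_iff_spheroid)
next
  assume "loop_homotopic X x0 g h"
  note gh = this[unfolded loop_homotopic_iff_spheroid]
  show "loop_class X x0 g = loop_class X x0 h"
    unfolding loop_class_def
    using spheroid_homotopic_trans[OF gh] spheroid_homotopic_trans[OF spheroid_homotopic_sym[OF gh]]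
    by (intro Collect_cong iffI)
qed

lemma loop_class_exists:
  assumes "A \<in> carrier (homotopy_group 1 X x0)"
  obtains g where "loop_at X x0 g" "A = loop_class X x0 g"
proof -
  obtain f where f: "f \<in> spheroids 1 X x0" "A = {g. spheroid_homotopic 1 X x0 f g}"
    using assms by (auto simp: homotopy_group_def quotient_def)
  note s = spheroid_as_loop[OF f(1)]
  have "A = loop_class X x0 (\<lambda>t. f (cube_point t))"
    unfolding f(2) loop_class_def
    using spheroid_homotopic_trans[OF s(2)] spheroid_homotopic_trans[OF spheroid_homotopic_sym[OF s(2)]]
    by (intro Collect_cong iffI)
  with s(1) show thesis by (rule that)
qed

text \<open>The product class consists of all maps homotopic to a concatenation of representatives,
  which need not be of the form \<open>loop_spheroid\<close>; they are first replaced by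
  loops.\<close>

lemma loop_class_mult:
  assumes "loop_at X x0 g" "loop_at X x0 h"
  shows "loop_class X x0 g \<otimes>\<^bsub>homotopy_group 1 X x0\<^esub> loop_class X x0 h = loop_class X x0 (loop_concat g h)"
proof (intro equalityI subsetI)
  fix f assume "f \<in> loop_class X x0 (loop_concat g h)"
  moreover have "loop_spheroid g \<in> loop_class X x0 g" "loop_spheroid h \<in> loop_class X x0 h"
    using loop_homotopic_refl[OF assms(1)] loop_homotopic_refl[OF assms(2)]
    by (simp_all add: loop_class_def loop_homotopic_iff_spheroid)
  ultimately show "f \<in> loop_class X x0 g \<otimes>\<^bsub>homotopy_group 1 X x0\<^esub> loop_class X x0 h"
    unfolding homotopy_group_def by (auto simp: loop_class_def spheroid_concat_loops[symmetric])
next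
  fix f assume "f \<in> loop_class X x0 g \<otimes>\<^bsub>homotopy_group 1 X x0\<^esub> loop_class X x0 h"
  then obtain p q where p: "spheroid_homotopic 1 X x0 (loop_spheroid g) p"
    and q: "spheroid_homotopic 1 X x0 (loop_spheroid h) q"
    and f: "spheroid_homotopic 1 X x0 (spheroid_concat p q) f"
    unfolding homotopy_group_def loop_class_def by auto
  define p' where "p' = (\<lambda>t. p (cube_point t))"
  define q' where "q' = (\<lambda>t. q (cube_point t))"
  have p': "loop_homotopic X x0 g p'" and q': "loop_homotopic X x0 h q'"
    unfolding loop_homotopic_iff_spheroid p'_def q'_def
    by (rule spheroid_homotopic_trans[OF p spheroid_as_loop(2)[OF spheroid_homotopic_spheroids(2)[OF p]]],
        rule spheroid_homotopic_trans[OF q spheroid_as_loop(2)[OF spheroid_homotopic_spheroids(2)[OF q]]])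
  have gh: "loop_homotopic X x0 (loop_concat g h) (loop_concat p' q')"
    by (rule loop_concat_homotopic[OF p' q'])
  have upd: "y(0 := t) = cube_point t" if "y \<in> topspace (cube 1)" for y t
    using that by (auto simp: cube_def cube_point_def PiE_iff extensional_def fun_eq_iff)
  have "spheroid_homotopic 1 X x0 (loop_spheroid (loop_concat p' q')) (spheroid_concat p q)"
  proof (rule spheroid_homotopic_agree)
    show "loop_spheroid (loop_concat p' q') \<in> spheroids 1 X x0"
      by (rule loop_spheroid_spheroids[OF conjunct2[OF loop_at_homotopic[OF gh]]])
    show "loop_spheroid (loop_concat p' q') y = spheroid_concat p q y" if "y \<in> topspace (cube 1)" for y
      unfolding spheroid_concat_def upd[OF that] by (simp add: loop_spheroid_def loop_concat_def p'_def q'_def)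
  qed
  from spheroid_homotopic_trans[OF spheroid_homotopic_trans[OF gh[unfolded loop_homotopic_iff_spheroid] this] f]
  show "f \<in> loop_class X x0 (loop_concat g h)" by (simp add: loop_class_def)
qed

lemma convex_loop_homotopic:
  fixes p q :: "real \<Rightarrow> 'v::real_normed_vector"
  assumes \<Theta>: "continuous_map (top_of_set S) X \<Theta>" and "convex S"
    and p: "continuous_on {0..1} p" "p ` {0..1} \<subseteq> S" and q: "continuous_on {0..1} q" "q ` {0..1} \<subseteq> S"
    and ends: "p 0 = q 0" "p 1 = q 1" "\<Theta> (p 0) = x0" "\<Theta> (p 1) = x0"
  shows "loop_homotopic X x0 (\<lambda>t. \<Theta> (p t)) (\<lambda>t. \<Theta> (q t))"
proof -
  define H where "H z = \<Theta> ((1 - fst z) *\<^sub>R p (snd z) + fst z *\<^sub>R q (snd z))" for z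
  have "continuous_on ({0..1::real} \<times> {0..1::real}) (\<lambda>z :: real \<times> real. p (snd z))"
    "continuous_on ({0..1::real} \<times> {0..1::real}) (\<lambda>z :: real \<times> real. q (snd z))"
    by (auto intro!: continuous_on_compose2[OF p(1)] continuous_on_compose2[OF q(1)] continuous_on_snd continuous_on_id)
  then have "continuous_map (top_of_set ({0..1::real} \<times> {0..1::real})) X H"
    unfolding H_def
    by (intro continuous_map_set_compose[OF \<Theta>] continuous_intros)
       (use p(2) q(2) \<open>convex S\<close> in \<open>auto simp: image_subset_iff intro!: convexD_alt\<close>)
  moreover have "(1 - s) *\<^sub>R v + s *\<^sub>R v = v" for s and v :: 'v
    unfolding scaleR_add_left[symmetric] by simp
  ultimately show ?thesis
    unfolding loop_homotopic_def using ends by (intro exI[of _ H]) (simp add: H_def)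
qed

text \<open>The two ways along the boundary of a square from one corner to the opposite one are
  paths in a convex set.\<close>

lemma square_boundary_homotopic:
  assumes \<Theta>: "continuous_map (top_of_set ({0..1::real} \<times> {0..1::real})) X \<Theta>"
    and ends: "\<Theta> (0, 0) = x0" "\<Theta> (1, 1) = x0"
  shows "loop_homotopic X x0 (loop_concat (\<lambda>t. \<Theta> (t, 0)) (\<lambda>t. \<Theta> (1, t)))
     (loop_concat (\<lambda>t. \<Theta> (0, t)) (\<lambda>t. \<Theta> (t, 1)))"
proof -
  define p where "p t = (min 1 (2 * t), max 0 (2 * t - 1))" for t :: real
  define q where "q t = (max 0 (2 * t - 1), min 1 (2 * t))" for t :: real
  have "loop_homotopic X x0 (\<lambda>t. \<Theta> (p t)) (\<lambda>t. \<Theta> (q t))"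
  proof (rule convex_loop_homotopic[OF \<Theta>])
    show "convex ({0..1::real} \<times> {0..1::real})" by (intro convex_Times convex_real_interval)
    show "continuous_on {0..1} p" "continuous_on {0..1} q"
      unfolding p_def q_def by (intro continuous_intros)+
  qed (use ends in \<open>auto simp: p_def q_def\<close>)
  moreover have "(\<lambda>t. \<Theta> (p t)) = loop_concat (\<lambda>t. \<Theta> (t, 0)) (\<lambda>t. \<Theta> (1, t))"
    "(\<lambda>t. \<Theta> (q t)) = loop_concat (\<lambda>t. \<Theta> (0, t)) (\<lambda>t. \<Theta> (t, 1))"
  proof -
    have "p t = (2 * t, 0) \<and> q t = (0, 2 * t)" if "t \<le> 1/2" for t
      using that by (simp add: p_def q_def)
    moreover have "p t = (1, 2 * t - 1) \<and> q t = (2 * t - 1, 1)" if "\<not> t \<le> 1/2" for t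
      using that by (simp add: p_def q_def)
    ultimately show "(\<lambda>t. \<Theta> (p t)) = loop_concat (\<lambda>t. \<Theta> (t, 0)) (\<lambda>t. \<Theta> (1, t))"
      "(\<lambda>t. \<Theta> (q t)) = loop_concat (\<lambda>t. \<Theta> (0, t)) (\<lambda>t. \<Theta> (t, 1))"
      unfolding loop_concat_def fun_eq_iff by metis+
  qed
  ultimately show ?thesis by simp
qed

text \<open>Runs through the unit interval in the middle third and rests before and after. A loop
  that pauses near its ends leaves room at the corners of a square.\<close>

definition pause :: "real \<Rightarrow> real" where
  "pause t = max 0 (min 1 (3 * t - 1))"

lemma pause_homotopic:
  assumes "loop_at X x0 g"
  shows "loop_homotopic X x0 g (\<lambda>t. g (pause t))"
proof (rule convex_loop_homotopic[of "{0..1}" X g "\<lambda>t. t" pause])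
  show "continuous_map (top_of_set {0..1}) X g" using assms by (simp add: loop_at_def)
  show "continuous_on {0..1} pause" unfolding pause_def by (intro continuous_intros)
qed (use assms in \<open>auto simp: pause_def loop_at_def\<close>)

text \<open>A homotopy between \<open>ab\<close> and \<open>ba\<close> is a square with two sides
  constant; the map sought here is a square with sides \<open>a\<close>, \<open>b\<close>,
  \<open>a\<close>, \<open>b\<close>. In the latter, \<open>fst z + snd z\<close> serves as time
  along the concatenated loops and \<open>snd z - fst z\<close> as the homotopy parameter. The
  substitution only has to be right up to the moments at which the loops pause: near the corners
  \<open>(0, 0)\<close> and \<open>(1, 1)\<close> the homotopy parameter varies along the sides, but
  there the time is constant and the value is the base point.\<close>

lemma commuting_loops_square:
  assumes comm: "loop_homotopic X x0 (loop_concat a b) (loop_concat b a)"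
  obtains h where "continuous_map (top_of_set ({0..1::real} \<times> {0..1::real})) X h"
    "\<And>t. t \<in> {0..1} \<Longrightarrow> h (t, 0) = a (pause t) \<and> h (t, 1) = a (pause t) \<and>
       h (0, t) = b (pause t) \<and> h (1, t) = b (pause t)"
proof -
  obtain H where H: "continuous_map (top_of_set ({0..1::real} \<times> {0..1::real})) X H"
    "\<forall>u\<in>{0..1}. H (0, u) = loop_concat a b u \<and> H (1, u) = loop_concat b a u"
    "\<forall>s\<in>{0..1}. H (s, 0) = x0 \<and> H (s, 1) = x0"
    using comm unfolding loop_homotopic_def by blast
  \<comment> \<open>On \<open>[0, 2]\<close> this passes the first loop during \<open>[1/3,
    2/3]\<close> and the second one during \<open>[4/3, 5/3]\<close>.\<close>
  define \<Lambda> where "\<Lambda> w = pause w / 2 + pause (w - 1) / 2" for w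
  define \<sigma> where "\<sigma> z = max 0 (min 1 (1/2 + 2 * (snd z - fst z)))" for z :: "real \<times> real"
  define h where "h z = H (\<sigma> z, \<Lambda> (fst z + snd z))" for z
  have p01: "0 \<le> pause t" "pause t \<le> 1" for t by (auto simp: pause_def)
  have \<sigma>01: "\<sigma> z \<in> {0..1}" for z by (auto simp: \<sigma>_def)
  have \<Lambda>01: "\<Lambda> u \<in> {0..1}" for u using p01[of u] p01[of "u - 1"] by (simp add: \<Lambda>_def)
  have cont: "continuous_map (top_of_set ({0..1::real} \<times> {0..1::real})) X h"
    unfolding h_def
  proof (rule continuous_map_set_compose[OF H(1)])
    show "continuous_on ({0..1} \<times> {0..1}) (\<lambda>z :: real \<times> real. (\<sigma> z, \<Lambda> (fst z + snd z)))"
      unfolding \<sigma>_def \<Lambda>_def pause_def by (intro continuous_intros) simp_all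
    show "(\<sigma> z, \<Lambda> (fst z + snd z)) \<in> {0..1} \<times> {0..1}" for z
      using \<sigma>01 \<Lambda>01 by (rule SigmaI)
  qed
  have corner: "H (s, \<Lambda> u) = x0" if "\<Lambda> u = 0 \<or> \<Lambda> u = 1" "s \<in> {0..1}" for s u
    using H(3) that by auto
  have low: "\<Lambda> t = pause t / 2" and high: "\<Lambda> (1 + t) = 1/2 + pause t / 2"
    if "t \<in> {0..1}" for t
  proof -
    have "pause (t - 1) = 0" "pause (1 + t) = 1" using that by (auto simp: pause_def)
    then show "\<Lambda> t = pause t / 2" "\<Lambda> (1 + t) = 1/2 + pause t / 2"
      unfolding \<Lambda>_def by simp_all
  qed
  have "H (0, 0) = a 0 \<and> H (1, 0) = b 0" "H (0, 1) = b 1 \<and> H (1, 1) = a 1"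
    using H(2)[rule_format, of 0] H(2)[rule_format, of 1] by (simp_all add: loop_concat_def)
  moreover have "H (0, 0) = x0" "H (1, 0) = x0" "H (0, 1) = x0" "H (1, 1) = x0"
    using H(3)[rule_format, of 0] H(3)[rule_format, of 1] by simp_all
  ultimately have ab0: "a 0 = x0" "b 0 = x0" and ab1: "b 1 = x0" "a 1 = x0" by metis+
  have concat_low: "loop_concat f g (pause t / 2) = f (pause t)" for f g :: "real \<Rightarrow> 'a" and t
    using p01[of t] by (simp add: loop_concat_def)
  have concat_high: "loop_concat f g (1/2 + pause t / 2) = g (pause t)" if "f 1 = g 0" for f g :: "real \<Rightarrow> 'a" and t
  proof (cases "pause t = 0")
    case True then show ?thesis using that by (simp add: loop_concat_def)
  next
    case False
    then have "\<not> 1/2 + pause t / 2 \<le> 1/2" "2 * (1/2 + pause t / 2) - 1 = pause t" using p01[of t] by auto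
    then show ?thesis by (simp only: loop_concat_def if_False)
  qed
  have mem: "pause t / 2 \<in> {0..1}" "1/2 + pause t / 2 \<in> {0..1}" for t using p01[of t] by auto
  have HL: "H (0, pause t / 2) = a (pause t)" "H (1, pause t / 2) = b (pause t)" for t
    using H(2)[rule_format, OF mem(1)[of t]] by (simp_all only: concat_low)
  have "a 1 = b 0" "b 1 = a 0" using ab0 ab1 by simp_all
  then have HH: "H (0, 1/2 + pause t / 2) = b (pause t)" "H (1, 1/2 + pause t / 2) = a (pause t)" for t
    using H(2)[rule_format, OF mem(2)[of t]] concat_high[of a b t] concat_high[of b a t] by simp_all
  have "h (t, 0) = a (pause t)" if t: "t \<in> {0..1}" for t
  proof (cases "t \<le> 1/3")
    case True
    then have "pause t = 0" by (simp add: pause_def)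
    then show ?thesis using corner[of t] low[OF t] \<sigma>01 ab0 by (simp add: h_def)
  next
    case False
    then have "\<sigma> (t, 0) = 0" by (simp add: \<sigma>_def)
    then show ?thesis using HL(1)[of t] low[OF t] by (simp only: h_def fst_conv snd_conv add_0_right)
  qed
  moreover have "h (0, t) = b (pause t)" if t: "t \<in> {0..1}" for t
  proof (cases "t \<le> 1/3")
    case True
    then have "pause t = 0" by (simp add: pause_def)
    then show ?thesis using corner[of t] low[OF t] \<sigma>01 ab0 by (simp add: h_def)
  next
    case False
    then have "\<sigma> (0, t) = 1" by (simp add: \<sigma>_def)
    then show ?thesis using HL(2)[of t] low[OF t] by (simp only: h_def fst_conv snd_conv add_0_left)
  qed
  moreover have "h (1, t) = b (pause t)" if t: "t \<in> {0..1}" for t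
  proof (cases "2/3 \<le> t")
    case True
    then have "pause t = 1" by (simp add: pause_def)
    then show ?thesis using corner[of "1 + t"] high[OF t] \<sigma>01 ab1 by (simp add: h_def)
  next
    case False
    then have "\<sigma> (1, t) = 0" by (simp add: \<sigma>_def)
    then show ?thesis using HH(1)[of t] high[OF t] by (simp only: h_def fst_conv snd_conv)
  qed
  moreover have "h (t, 1) = a (pause t)" if t: "t \<in> {0..1}" for t
  proof (cases "2/3 \<le> t")
    case True
    then have "pause t = 1" by (simp add: pause_def)
    then show ?thesis using corner[of "1 + t"] high[OF t] \<sigma>01 ab1 by (simp add: h_def add.commute)
  next
    case False
    then have "\<sigma> (t, 1) = 1" by (simp add: \<sigma>_def)
    then show ?thesis using HH(2)[of t] high[OF t] by (simp only: h_def fst_conv snd_conv add.commute[of t 1])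
  qed
  ultimately have "h (t, 0) = a (pause t) \<and> h (t, 1) = a (pause t) \<and>
       h (0, t) = b (pause t) \<and> h (1, t) = b (pause t)" if "t \<in> {0..1}" for t
    using that by simp
  with cont show thesis by (rule that)
qed

section \<open>Extending maps over cubes\<close>

lemma continuous_map_glue_closed:
  assumes "closed A" "closed B" "continuous_map (top_of_set A) X f" "continuous_map (top_of_set B) X g"
    and fg: "\<And>x. x \<in> A \<Longrightarrow> x \<in> B \<Longrightarrow> f x = g x"
  shows "continuous_map (top_of_set (A \<union> B)) X (\<lambda>x. if x \<in> A then f x else g x)"
proof (rule pasting_lemma_closed[where I = "UNIV :: bool set" and T = "\<lambda>b. if b then A else B"
      and f = "\<lambda>b. if b then f else g"])
  show "closedin (top_of_set (A \<union> B)) (if b then A else B)" for b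
    using assms(1,2) by (auto intro!: closed_subset)
  have "(A \<union> B) \<inter> A = A" "(A \<union> B) \<inter> B = B" by auto
  then show "continuous_map (subtopology (top_of_set (A \<union> B)) (if b then A else B)) X (if b then f else g)" for b
    using assms(3,4) by (simp add: subtopology_subtopology)
  show "(if b then f else g) x = (if c then f else g) x"
    if "x \<in> topspace (top_of_set (A \<union> B)) \<inter> (if b then A else B) \<inter> (if c then A else B)" for b c x
    using that fg by (cases b; cases c) auto
  show "\<exists>b. b \<in> UNIV \<and> x \<in> (if b then A else B) \<and> (if x \<in> A then f x else g x) = (if b then f else g) x"
    if "x \<in> topspace (top_of_set (A \<union> B))" for x
    using that by (intro exI[of _ "x \<in> A"]) auto
qed simp

lemma coordinate_intros:
  "continuous_on A (\<lambda>y :: nat \<Rightarrow> real. y i)"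
  "continuous_on B (\<lambda>z :: 'b::topological_space \<times> (nat \<Rightarrow> real). snd z i)"
  using continuous_on_product_then_coordinatewise[OF continuous_on_id, of A i]
    continuous_on_product_then_coordinatewise[OF continuous_on_snd[OF continuous_on_id], of B i] by simp_all

text \<open>The faces of the standard cubes that contain the origin: \<open>S\<close> is the set of
  the coordinates that vary. All cells lie in one space, so that maps on different cells can be
  compared and glued.\<close>

definition cell :: "nat set \<Rightarrow> (nat \<Rightarrow> real) set" where
  "cell S = {y. \<forall>i. y i \<in> (if i \<in> S then {0..1} else {0})}"

definition cell_boundary :: "nat set \<Rightarrow> (nat \<Rightarrow> real) set" where
  "cell_boundary S = {y \<in> cell S. \<exists>i\<in>S. y i = 0 \<or> y i = 1}"

lemma cellD: "y \<in> cell S \<Longrightarrow> i \<in> S \<Longrightarrow> 0 \<le> y i \<and> y i \<le> 1" "y \<in> cell S \<Longrightarrow> i \<notin> S \<Longrightarrow> y i = 0"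
  by (auto simp: cell_def split: if_splits)

lemma cellI: "(\<And>i. i \<in> S \<Longrightarrow> 0 \<le> y i \<and> y i \<le> 1) \<Longrightarrow> (\<And>i. i \<notin> S \<Longrightarrow> y i = 0) \<Longrightarrow> y \<in> cell S"
  by (auto simp: cell_def)

lemma closed_coordinate: "closed C \<Longrightarrow> closed {y :: nat \<Rightarrow> real. y i \<in> C}"
  using closed_vimage[OF _ continuous_on_product_coordinates, of C i] by (simp add: vimage_def)

lemma closed_cell: "closed (cell S)"
  unfolding cell_def by (intro closed_Collect_all closed_coordinate) auto

lemma closed_cell_boundary: assumes "finite S" shows "closed (cell_boundary S)"
proof -
  have "cell_boundary S = (\<Union>i\<in>S. cell S \<inter> {y. y i \<in> {0, 1}})"
    by (auto simp: cell_boundary_def)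
  moreover have "closed (cell S \<inter> {y. y i \<in> {0, 1}})" for i
    by (intro closed_Int closed_cell closed_coordinate) auto
  ultimately show ?thesis using assms by (simp only:) (intro closed_UN ballI)
qed

lemma cell_boundary_cell: "y \<in> cell_boundary S \<Longrightarrow> y \<in> cell S"
  by (auto simp: cell_boundary_def)

lemma continuous_on_if_const:
  "(P \<Longrightarrow> continuous_on A f) \<Longrightarrow> (\<not> P \<Longrightarrow> continuous_on A g) \<Longrightarrow> continuous_on A (\<lambda>x. if P then f x else g x)"
  by (cases P) simp_all

text \<open>A bijection of the index set with \<open>{..<card S}\<close> identifies the cell with
  the standard cube of the same dimension; there the triviality of the homotopy group says that the
  spheroid \<open>f\<close> is homotopic to the constant one.\<close>

lemma null_homotopy_on_cell:
  assumes triv: "trivial_group (homotopy_group (card S) X x0)" and fin: "finite S"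
    and f: "continuous_map (top_of_set (cell S)) X f" "\<And>y. y \<in> cell_boundary S \<Longrightarrow> f y = x0"
  obtains N where "continuous_map (top_of_set ({0..1::real} \<times> cell S)) X N"
    "\<And>y. y \<in> cell S \<Longrightarrow> N (0, y) = x0" "\<And>y. y \<in> cell S \<Longrightarrow> N (1, y) = f y"
    "\<And>s y. s \<in> {0..1} \<Longrightarrow> y \<in> cell_boundary S \<Longrightarrow> N (s, y) = x0"
proof -
  define k where "k = card S"
  obtain e where e: "bij_betw e {..<k} S"
    using ex_bij_betw_nat_finite[OF fin] unfolding k_def atLeast0LessThan by blast
  define e' where "e' = inv_into {..<k} e"
  have e': "e' j < k" "e (e' j) = j" if "j \<in> S" for j
    using bij_betw_inv_into_right[OF e that] bij_betw_apply[OF bij_betw_inv_into[OF e] that]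
    by (simp_all add: e'_def)
  have eS: "e i \<in> S" "e' (e i) = i" if "i < k" for i
    using bij_betw_apply[OF e, of i] bij_betw_inv_into_left[OF e, of i] that by (simp_all add: e'_def)
  define spread where "spread z = (\<lambda>j. if j \<in> S then z (e' j) else 0)" for z :: "nat \<Rightarrow> real"
  define gather where "gather y = (\<lambda>i\<in>{..<k}. y (e i))" for y :: "nat \<Rightarrow> real"
  have cube: "z \<in> topspace (cube k) \<longleftrightarrow> z \<in> PiE {..<k} (\<lambda>_. {0..1})" for z
    by (simp add: cube_def)
  have spread_cell: "spread z \<in> cell S" if "z \<in> topspace (cube k)" for z
    using that e' unfolding cube by (intro cellI) (auto simp: spread_def PiE_iff)
  have gather_cube: "gather y \<in> topspace (cube k)" if "y \<in> cell S" for y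
    unfolding cube using cellD(1)[OF that eS(1)] by (auto simp: gather_def)
  have spread_gather: "spread (gather y) = y" if "y \<in> cell S" for y
    using e' cellD(2)[OF that] by (auto simp: spread_def gather_def fun_eq_iff)
  have spread_boundary: "spread z \<in> cell_boundary S" if z: "z \<in> cube_boundary k" for z
  proof -
    obtain i where i: "i < k" "z i = 0 \<or> z i = 1" and "z \<in> topspace (cube k)"
      using z by (auto simp: cube_boundary_def)
    then show ?thesis
      unfolding cell_boundary_def using spread_cell eS[OF i(1)]
      by (intro CollectI conjI bexI[of _ "e i"]) (auto simp: spread_def)
  qed
  have gather_boundary: "gather y \<in> cube_boundary k" if y: "y \<in> cell_boundary S" for y
  proof -
    obtain j where j: "j \<in> S" "y j = 0 \<or> y j = 1" and "y \<in> cell S"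
      using y by (auto simp: cell_boundary_def)
    then show ?thesis
      unfolding cube_boundary_def using gather_cube e'[OF j(1)]
      by (intro CollectI conjI exI[of _ "e' j"]) (auto simp: gather_def)
  qed
  have coord: "continuous_map (cube k) euclideanreal (\<lambda>z. z i)" if "i < k" for i
  proof -
    have "continuous_map (cube k) (top_of_set {0..1}) (\<lambda>z. z i)"
      unfolding cube_def by (rule continuous_map_product_projection) (use that in simp)
    then show ?thesis by (simp add: continuous_map_in_subtopology)
  qed
  have "continuous_map (cube k) (product_topology (\<lambda>_. euclideanreal) UNIV) spread"
  proof (rule continuous_map_coordinatewise_then_product)
    show "continuous_map (cube k) euclideanreal (\<lambda>z. spread z j)" for j
      using coord[OF e'(1), of j] by (cases "j \<in> S") (simp_all add: spread_def)
  qed simp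
  then have spread_cont: "continuous_map (cube k) (top_of_set (cell S)) spread"
    unfolding euclidean_product_topology continuous_map_in_subtopology using spread_cell by blast
  have gather_cont: "continuous_map (top_of_set (cell S)) (cube k) gather"
    unfolding cube_def
  proof (rule continuous_map_coordinatewise_then_product)
    fix i assume "i \<in> {..<k}"
    then have "i < k" by simp
    then have "continuous_map (top_of_set (cell S)) (top_of_set {0..1}) (\<lambda>y. y (e i))"
      using cellD(1)[OF _ eS(1)] coordinate_intros(1)
      by (simp add: continuous_map_in_subtopology Pi_iff)
    then show "continuous_map (top_of_set (cell S)) (top_of_set {0..1}) (\<lambda>y. gather y i)"
      using \<open>i < k\<close> by (simp add: gather_def)
  qed (simp add: gather_def)
  define F where "F = f \<circ> spread"
  have "continuous_map (cube k) X F"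
    unfolding F_def by (rule continuous_map_compose[OF spread_cont f(1)])
  moreover have "F z = x0" if "z \<in> cube_boundary k" for z
    unfolding F_def o_def by (rule f(2)[OF spread_boundary[OF that]])
  ultimately have F: "F \<in> spheroids k X x0" by (simp add: spheroids_def image_subset_iff)
  define R where "R = {(f, g). spheroid_homotopic k X x0 f g}"
  have "R `` {F} \<in> carrier (homotopy_group k X x0)"
    using quotientI[OF F, of R] by (simp add: homotopy_group_def R_def)
  then have "R `` {F} = one (homotopy_group k X x0)"
    using triv unfolding trivial_group_def k_def by simp
  moreover have "F \<in> R `` {F}" using spheroid_homotopic_agree[OF F refl] by (simp add: R_def)
  ultimately have "F \<in> one (homotopy_group k X x0)" by simp
  then have "spheroid_homotopic k X x0 (\<lambda>_. x0) F"
    by (simp add: homotopy_group_def)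
  then obtain H where H: "continuous_map (prod_topology (top_of_set {0..1::real}) (cube k)) X H"
    "\<forall>y\<in>topspace (cube k). H (0, y) = x0 \<and> H (1, y) = F y"
    "\<forall>t\<in>{0..1}. \<forall>y\<in>cube_boundary k. H (t, y) = x0"
    unfolding spheroid_homotopic_iff by blast
  show thesis
  proof (rule that[of "\<lambda>z. H (fst z, gather (snd z))"])
    have "continuous_map (prod_topology (top_of_set {0..1::real}) (top_of_set (cell S)))
        (prod_topology (top_of_set {0..1::real}) (cube k)) (\<lambda>z. (fst z, gather (snd z)))"
      by (intro continuous_map_pairedI continuous_map_fst
          continuous_map_compose[OF continuous_map_snd gather_cont, unfolded o_def])
    from continuous_map_compose[OF this H(1)]
    show "continuous_map (top_of_set ({0..1::real} \<times> cell S)) X (\<lambda>z. H (fst z, gather (snd z)))"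
      by (simp add: o_def prod_topology_subtopology_eu)
  qed (use H(2,3) gather_cube gather_boundary spread_gather in \<open>simp_all add: F_def\<close>)
qed

lemma continuous_on_Max:
  fixes f :: "'i \<Rightarrow> 'a::topological_space \<Rightarrow> real"
  assumes "finite S" "S \<noteq> {}" "\<And>i. i \<in> S \<Longrightarrow> continuous_on A (f i)"
  shows "continuous_on A (\<lambda>x. Max ((\<lambda>i. f i x) ` S))"
  using assms
proof (induction S rule: finite_ne_induct)
  case (insert i S)
  then have "continuous_on A (\<lambda>x. max (f i x) (Max ((\<lambda>i. f i x) ` S)))"
    by (intro continuous_on_max) auto
  with insert show ?case by simp
qed simp

lemma unit_abs:
  fixes a :: real
  shows "\<bar>2 * a - 1\<bar> \<le> 1 \<Longrightarrow> 0 \<le> a \<and> a \<le> 1" "\<bar>2 * a - 1\<bar> = 1 \<Longrightarrow> a = 0 \<or> a = 1"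
  by (auto simp: abs_if split: if_splits)

text \<open>A box without its lid is a retract of the full box, so a map on the former extends to
  the latter. The retraction \<open>\<rho>\<close> is the central projection from the point at
  height \<open>2\<close> above the middle of the box: it divides the vector from this point by the
  number \<open>w\<close>, which is the maximum of two gauges. The first one is \<open>1\<close> on
  the bottom, the second one is \<open>1\<close> on the walls.\<close>

lemma fill_open_box:
  assumes fin: "finite S" "S \<noteq> {}"
    and g: "continuous_map (top_of_set ({0::real} \<times> cell S \<union> {0..1::real} \<times> cell_boundary S)) X g"
  obtains G where "continuous_map (top_of_set ({0..1::real} \<times> cell S)) X G"
    "\<And>y. y \<in> cell S \<Longrightarrow> G (0, y) = g (0, y)"
    "\<And>s y. s \<in> {0..1} \<Longrightarrow> y \<in> cell_boundary S \<Longrightarrow> G (s, y) = g (s, y)"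
proof -
  define m where "m y = Max ((\<lambda>i. \<bar>2 * y i - 1\<bar>) ` S)" for y :: "nat \<Rightarrow> real"
  define w where "w z = max ((2 - fst z) / 2) (m (snd z))" for z :: "real \<times> (nat \<Rightarrow> real)"
  define \<rho> where "\<rho> z = (2 - (2 - fst z) / w z, (\<lambda>i. if i \<in> S then 1/2 + (snd z i - 1/2) / w z else 0))"
    for z :: "real \<times> (nat \<Rightarrow> real)"
  have m_ge: "\<bar>2 * y i - 1\<bar> \<le> m y" if "i \<in> S" for y i
    unfolding m_def using fin that by (intro Max_ge) auto
  have m_le: "m y \<le> 1" if "y \<in> cell S" for y
    unfolding m_def using fin cellD(1)[OF that] by (intro Max.boundedI) (fastforce simp: abs_le_iff)+
  have m_in: "\<exists>i\<in>S. m y = \<bar>2 * y i - 1\<bar>" for y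
  proof -
    have "m y \<in> (\<lambda>i. \<bar>2 * y i - 1\<bar>) ` S"
      unfolding m_def by (intro Max_in) (use fin in simp_all)
    then show ?thesis by blast
  qed
  have w_pos: "w z > 0" if "fst z \<le> 1" for z
    using that unfolding w_def by (intro less_le_trans[OF _ max.cobounded1]) simp
  have w_le: "w z \<le> 1" if "z \<in> {0..1::real} \<times> cell S" for z
    using that m_le[of "snd z"] by (simp add: w_def mem_Times_iff)
  have cont: "continuous_on ({0..1::real} \<times> cell S) \<rho>"
  proof -
    have "continuous_on ({0..1::real} \<times> cell S) (\<lambda>z. m (snd z))"
      unfolding m_def using fin by (intro continuous_on_Max continuous_intros coordinate_intros)
    then have w: "continuous_on ({0..1::real} \<times> cell S) w"
      unfolding w_def by (intro continuous_intros) simp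
    have ne: "\<forall>z\<in>{0..1::real} \<times> cell S. w z \<noteq> 0"
    proof
      fix z assume "z \<in> {0..1::real} \<times> cell S"
      then have "fst z \<le> 1" by (simp add: mem_Times_iff)
      then show "w z \<noteq> 0" using w_pos[of z] by simp
    qed
    have "continuous_on ({0..1::real} \<times> cell S) (\<lambda>z. 2 - (2 - fst z) / w z)"
      by (intro continuous_intros w ne)
    moreover have "continuous_on ({0..1::real} \<times> cell S) (\<lambda>z i. if i \<in> S then 1/2 + (snd z i - 1/2) / w z else 0)"
      by (rule continuous_on_coordinatewise_then_product, rule continuous_on_if_const)
         (intro continuous_intros coordinate_intros w ne)+
    ultimately show ?thesis unfolding \<rho>_def by (rule continuous_on_Pair)
  qed
  have range: "\<rho> z \<in> {0::real} \<times> cell S \<union> {0..1::real} \<times> cell_boundary S" if z: "z \<in> {0..1::real} \<times> cell S" for z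
  proof -
    obtain t y where ty: "z = (t, y)" "0 \<le> t" "t \<le> 1" "y \<in> cell S" using z by auto
    have wz: "w z > 0" "w z \<le> 1" "(2 - t) / 2 \<le> w z" "m y \<le> w z"
      using w_pos[of z] w_le[OF z] ty by (auto simp: w_def)
    have a: "0 \<le> 2 - (2 - t) / w z" using wz(1,3) by (simp add: field_simps)
    have "(2 - t) * w z \<le> (2 - t) * 1" using wz(2) ty by (intro mult_left_mono) auto
    then have "2 - t \<le> (2 - t) / w z" using wz(1) by (simp add: pos_le_divide_eq)
    then have b: "2 - (2 - t) / w z \<le> 1" using ty by linarith
    have c: "\<bar>2 * (1/2 + (y i - 1/2) / w z) - 1\<bar> = \<bar>2 * y i - 1\<bar> / w z" for i
    proof -
      have "2 * (1/2 + (y i - 1/2) / w z) - 1 = (2 * y i - 1) / w z"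
        using wz(1) by (simp add: field_simps)
      then show ?thesis using wz(1) by (simp add: abs_divide)
    qed
    have "\<bar>2 * y i - 1\<bar> / w z \<le> 1" if "i \<in> S" for i
      using m_ge[OF that, of y] wz by (simp add: pos_divide_le_eq)
    then have "0 \<le> 1/2 + (y i - 1/2) / w z \<and> 1/2 + (y i - 1/2) / w z \<le> 1" if "i \<in> S" for i
      using that by (intro unit_abs(1)) (simp only: c)
    then have d: "snd (\<rho> z) \<in> cell S"
      unfolding \<rho>_def using ty(1) by (intro cellI) simp_all
    show ?thesis
    proof (cases "w z = (2 - t) / 2")
      case True
      then have "2 - t = 2 * w z" by simp
      then have "(2 - t) / w z = 2" using wz(1) by simp
      then have "fst (\<rho> z) = 0" by (simp add: \<rho>_def ty(1))
      then show ?thesis using d by (simp add: mem_Times_iff)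
    next
      case False
      moreover have "w z = max ((2 - t) / 2) (m y)" by (simp add: w_def ty(1))
      ultimately have "w z = m y" by (simp add: max_def split: if_splits)
      then obtain i where i: "i \<in> S" "w z = \<bar>2 * y i - 1\<bar>" using m_in[of y] by auto
      then have "\<bar>2 * (1/2 + (y i - 1/2) / w z) - 1\<bar> = 1" using c[of i] wz(1) by simp
      then have "1/2 + (y i - 1/2) / w z = 0 \<or> 1/2 + (y i - 1/2) / w z = 1"
        by (rule unit_abs(2))
      then have "snd (\<rho> z) \<in> cell_boundary S"
        unfolding cell_boundary_def using d i(1)
        by (intro CollectI conjI bexI[of _ i]) (simp_all add: \<rho>_def ty)
      then show ?thesis using a b by (simp add: mem_Times_iff \<rho>_def ty)
    qed
  qed
  have fix_pt: "\<rho> z = z" if "w z = 1" "snd z \<in> cell S" for z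
    using that cellD(2)[OF that(2)] by (auto simp: \<rho>_def fun_eq_iff prod_eq_iff)
  show thesis
  proof (rule that[of "\<lambda>z. g (\<rho> z)"])
    show "continuous_map (top_of_set ({0..1::real} \<times> cell S)) X (\<lambda>z. g (\<rho> z))"
      by (rule continuous_map_set_compose[OF g cont range])
    show "g (\<rho> (0, y)) = g (0, y)" if "y \<in> cell S" for y
    proof -
      have "w (0, y) = 1" using m_le[OF that] by (simp add: w_def)
      then show ?thesis using fix_pt[of "(0, y)"] that by simp
    qed
    show "g (\<rho> (s, y)) = g (s, y)" if s: "s \<in> {0..1}" and bd: "y \<in> cell_boundary S" for s y
    proof -
      have y: "y \<in> cell S" by (rule cell_boundary_cell[OF bd])
      obtain i where "i \<in> S" "\<bar>2 * y i - 1\<bar> = 1" using bd by (auto simp: cell_boundary_def)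
      then have "m y = 1" using m_ge[of i y] m_le[OF y] by simp
      then have "w (s, y) = 1" using s by (simp add: w_def)
      then show ?thesis using fix_pt[of "(s, y)"] y by simp
    qed
  qed
qed

lemma continuous_on_scale:
  "continuous_on A f \<Longrightarrow> continuous_on A u \<Longrightarrow> continuous_on A (\<lambda>z. (\<lambda>i. f z * (u z i) :: real))"
  by (rule continuous_on_coordinatewise_then_product)
     (intro continuous_on_mult continuous_on_product_then_coordinatewise[of A u])

lemma continuous_on_fun_upd:
  fixes u :: "'a::topological_space \<Rightarrow> nat \<Rightarrow> real"
  assumes "continuous_on A u" "continuous_on A f"
  shows "continuous_on A (\<lambda>z. (u z)(l := f z))"
proof (rule continuous_on_coordinatewise_then_product)
  show "continuous_on A (\<lambda>z. ((u z)(l := f z)) i)" for i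
    using continuous_on_product_then_coordinatewise[OF assms(1), of i] assms(2) by (cases "i = l") simp_all
qed

lemma cell_insert:
  assumes "l \<notin> S"
  shows "y \<in> cell (insert l S) \<Longrightarrow> y(l := 0) \<in> cell S \<and> y l \<in> {0..1}"
    "y \<in> cell S \<Longrightarrow> t \<in> {0..1} \<Longrightarrow> y(l := t) \<in> cell (insert l S)"
    "y \<in> cell S \<Longrightarrow> y(l := 0) = y"
proof -
  show "y \<in> cell (insert l S) \<Longrightarrow> y(l := 0) \<in> cell S \<and> y l \<in> {0..1}"
    "y \<in> cell S \<Longrightarrow> t \<in> {0..1} \<Longrightarrow> y(l := t) \<in> cell (insert l S)"
    using assms by (auto simp: cell_def split: if_splits)
  show "y \<in> cell S \<Longrightarrow> y(l := 0) = y"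
    by (rule fun_upd_idem) (rule cellD(2)[OF _ assms])
qed

lemma cell_boundary_insert:
  assumes "l \<notin> S"
  shows "y \<in> cell_boundary (insert l S) \<longleftrightarrow>
      y \<in> cell (insert l S) \<and> (y l = 0 \<or> y l = 1 \<or> y(l := 0) \<in> cell_boundary S)"
proof -
  have "i \<noteq> l" if "i \<in> S" for i using that assms by blast
  then have "(\<exists>i\<in>S. (y(l := 0)) i = 0 \<or> (y(l := 0)) i = 1) \<longleftrightarrow> (\<exists>i\<in>S. y i = 0 \<or> y i = 1)" by simp
  then show ?thesis using cell_insert(1)[OF assms, of y] by (simp add: cell_boundary_def) blast
qed

text \<open>Asphericity in its usual form: a map from the boundary of a cube of dimension
  \<open>card S + 1\<close> extends over the cube if the homotopy group in dimension \<open>card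
  S\<close> vanishes. The boundary consists of the face \<open>T\<close>, where the coordinate
  \<open>l\<close> is \<open>1\<close>, and the rest \<open>J\<close>. On \<open>J\<close> the map
  \<open>f\<close> extends to a map \<open>k\<close> of the cube, since \<open>J\<close> is an open
  box. Shrinking the cube to the origin contracts \<open>f\<close> on \<open>J\<close> to the base
  point; the contraction is followed on \<open>T\<close> by a homotopy \<open>G\<close>, which ends
  with a spheroid \<open>G (1, _)\<close>. Its null homotopy \<open>N\<close> is a map
  \<open>h1\<close> of the cube that agrees on the boundary with the end of the whole deformation
  \<open>c\<close> of \<open>f\<close>. Finally the deformation \<open>c\<close> is undone by
  extending it to the cube, starting from \<open>h1\<close>.\<close>

proposition extend_from_cell_boundary:
  assumes triv: "trivial_group (homotopy_group (card S) X x0)" and fin: "finite S" "S \<noteq> {}" and l: "l \<notin> S"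
    and f: "continuous_map (top_of_set (cell_boundary (insert l S))) X f" "f (\<lambda>_. 0) = x0"
  obtains h where "continuous_map (top_of_set (cell (insert l S))) X h"
    "\<And>y. y \<in> cell_boundary (insert l S) \<Longrightarrow> h y = f y"
proof -
  note ci = cell_insert[OF l] and cb = cell_boundary_insert[OF l]
  define J where "J = {y \<in> cell (insert l S). y l = 0 \<or> y(l := 0) \<in> cell_boundary S}"
  define T where "T = {y \<in> cell (insert l S). y l = 1}"
  have JT: "cell_boundary (insert l S) = T \<union> J" by (auto simp: cb J_def T_def)
  have zero_cell: "(\<lambda>_. 0) \<in> cell S'" for S' by (auto simp: cell_def)
  have zero_J: "(\<lambda>_. 0) \<in> J" by (simp add: J_def zero_cell)
  have scale_cell: "(\<lambda>i. s * y i) \<in> cell S'" if "s \<in> {0..1}" "y \<in> cell S'" for s y S'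
    using that cellD[OF that(2)] by (intro cellI) (auto intro: mult_le_one)
  note split_cont = continuous_on_Pair[OF coordinate_intros(1) continuous_on_fun_upd[OF continuous_on_id continuous_on_const]]
  \<comment> \<open>the extension \<open>k\<close> of \<open>f\<close> from \<open>J\<close>\<close>
  have "continuous_map (top_of_set ({0::real} \<times> cell S \<union> {0..1::real} \<times> cell_boundary S)) X (\<lambda>z. f ((snd z)(l := fst z)))"
  proof (rule continuous_map_set_compose[OF f(1)])
    show "(snd z)(l := fst z) \<in> cell_boundary (insert l S)"
      if "z \<in> {0::real} \<times> cell S \<union> {0..1::real} \<times> cell_boundary S" for z
    proof -
      have z: "snd z \<in> cell S" "fst z \<in> {0..1}" "fst z = 0 \<or> snd z \<in> cell_boundary S"
        using that cell_boundary_cell[of _ S] by auto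
      have "(snd z)(l := fst z) \<in> cell (insert l S)" by (rule ci(2)[OF z(1,2)])
      moreover have "((snd z)(l := fst z))(l := 0) = snd z" using ci(3)[OF z(1)] by simp
      ultimately show ?thesis unfolding cb using z(3) by auto
    qed
  qed (intro continuous_on_fun_upd continuous_on_snd continuous_on_fst continuous_on_id)
  then obtain K where K: "continuous_map (top_of_set ({0..1::real} \<times> cell S)) X K"
    "\<And>y. y \<in> cell S \<Longrightarrow> K (0, y) = f (y(l := 0))"
    "\<And>s y. s \<in> {0..1} \<Longrightarrow> y \<in> cell_boundary S \<Longrightarrow> K (s, y) = f (y(l := s))"
    by (rule fill_open_box[OF fin]) (simp only: fst_conv snd_conv)
  define k where "k y = K (y l, y(l := 0))" for y
  have k_cont: "continuous_map (top_of_set (cell (insert l S))) X k"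
    unfolding k_def by (rule continuous_map_set_compose[OF K(1) split_cont]) (use ci(1) in auto)
  have k_J: "k y = f y" if "y \<in> J" for y
  proof -
    have y: "y(l := 0) \<in> cell S" "y l \<in> {0..1}" "y l = 0 \<or> y(l := 0) \<in> cell_boundary S"
      using that ci(1) by (auto simp: J_def)
    show ?thesis
    proof (cases "y l = 0")
      case True
      then have "y(l := 0) = y" by (rule fun_upd_idem)
      then show ?thesis using K(2)[OF y(1)] True by (simp add: k_def)
    next
      case False
      then have "y(l := 0) \<in> cell_boundary S" using y(3) False by blast
      from K(3)[OF y(2) this] show ?thesis by (simp add: k_def)
    qed
  qed
  have k_scale: "continuous_map (top_of_set ({0..1::real} \<times> cell (insert l S))) X (\<lambda>z. k (\<lambda>i. fst z * snd z i))"
  proof (rule continuous_map_set_compose[OF k_cont])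
    show "continuous_on ({0..1::real} \<times> cell (insert l S)) (\<lambda>z. (\<lambda>i. fst z * snd z i))"
      by (rule continuous_on_scale[OF continuous_on_fst[OF continuous_on_id] continuous_on_snd[OF continuous_on_id]])
    show "(\<lambda>i. fst z * snd z i) \<in> cell (insert l S)" if "z \<in> {0..1::real} \<times> cell (insert l S)" for z
      using scale_cell[of "fst z" "snd z"] that by (simp add: mem_Times_iff)
  qed
  have k_zero: "k (\<lambda>i. 0) = x0" using k_J[OF zero_J] f(2) by simp
  \<comment> \<open>the homotopy \<open>G\<close> that drags the boundary of the face
    \<open>T\<close> to the base point\<close>
  define b where "b z = (if z \<in> {0::real} \<times> cell S then f ((snd z)(l := 1)) else k (\<lambda>i. (1 - fst z) * ((snd z)(l := 1)) i))"
    for z :: "real \<times> (nat \<Rightarrow> real)"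
  have bd_J: "y(l := s) \<in> J" if "y \<in> cell_boundary S" "s \<in> {0..1}" for y s
  proof -
    have "y \<in> cell S" using that(1) cell_boundary_cell[of _ S] by blast
    then show ?thesis using that ci(2,3) by (simp add: J_def)
  qed
  have "continuous_map (top_of_set ({0::real} \<times> cell S \<union> {0..1::real} \<times> cell_boundary S)) X b"
    unfolding b_def
  proof (rule continuous_map_glue_closed)
    show "closed ({0::real} \<times> cell S)" "closed ({0..1::real} \<times> cell_boundary S)"
      by (intro closed_Times closed_cell closed_cell_boundary fin closed_singleton closed_atLeastAtMost)+
    show "continuous_map (top_of_set ({0::real} \<times> cell S)) X (\<lambda>z. f ((snd z)(l := 1)))"
      by (rule continuous_map_set_compose[OF f(1)])
         (use ci(2) in \<open>auto simp: cb intro!: continuous_on_fun_upd continuous_on_snd continuous_on_id continuous_on_const\<close>)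
    have "continuous_map (top_of_set ({0..1::real} \<times> cell_boundary S)) X
        (\<lambda>z. (\<lambda>v. k (\<lambda>i. fst v * snd v i)) (1 - fst z, (snd z)(l := 1)))"
    proof (rule continuous_map_set_compose[OF k_scale])
      show "continuous_on ({0..1::real} \<times> cell_boundary S) (\<lambda>z. (1 - fst z, (snd z)(l := 1 :: real)))"
        by (intro continuous_on_Pair continuous_on_diff continuous_on_const continuous_on_fst continuous_on_id
            continuous_on_fun_upd[OF continuous_on_snd[OF continuous_on_id] continuous_on_const])
      show "(1 - fst z, (snd z)(l := 1)) \<in> {0..1} \<times> cell (insert l S)"
        if z: "z \<in> {0..1::real} \<times> cell_boundary S" for z
      proof -
        have "snd z \<in> cell S" "fst z \<in> {0..1}" using z cell_boundary_cell[of _ S] by (auto simp: mem_Times_iff)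
        then show ?thesis using ci(2)[of "snd z" 1] by simp
      qed
    qed
    then show "continuous_map (top_of_set ({0..1::real} \<times> cell_boundary S)) X (\<lambda>z. k (\<lambda>i. (1 - fst z) * ((snd z)(l := 1)) i))"
      by (simp only: fst_conv snd_conv)
    show "f ((snd z)(l := 1)) = k (\<lambda>i. (1 - fst z) * ((snd z)(l := 1)) i)"
      if "z \<in> {0::real} \<times> cell S" "z \<in> {0..1::real} \<times> cell_boundary S" for z
    proof -
      have z: "fst z = 0" "snd z \<in> cell_boundary S" using that by (auto simp: mem_Times_iff)
      show ?thesis unfolding z(1) diff_zero mult_1 by (rule k_J[OF bd_J[OF z(2)], symmetric]) simp
    qed
  qed
  then obtain G where G: "continuous_map (top_of_set ({0..1::real} \<times> cell S)) X G"
    "\<And>y. y \<in> cell S \<Longrightarrow> G (0, y) = b (0, y)"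
    "\<And>s y. s \<in> {0..1} \<Longrightarrow> y \<in> cell_boundary S \<Longrightarrow> G (s, y) = b (s, y)"
    by (rule fill_open_box[OF fin]) (rule that)
  have G0: "G (0, y) = f (y(l := 1))" if "y \<in> cell S" for y
    using G(2)[OF that] that by (simp add: b_def)
  have G_bd: "G (s, y) = k (\<lambda>i. (1 - s) * (y(l := 1)) i)" if "s \<in> {0..1}" "y \<in> cell_boundary S" for s y
  proof (cases "s = 0")
    case True
    have "k (y(l := 1)) = f (y(l := 1))" by (rule k_J[OF bd_J[OF that(2)]]) simp
    then show ?thesis
      unfolding True diff_zero mult_1 using G0[OF cell_boundary_cell[OF that(2)]] by (simp only:)
  qed (use G(3)[OF that] in \<open>simp add: b_def\<close>)
  have G1: "continuous_map (top_of_set (cell S)) X (\<lambda>y. G (1, y))"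
    by (rule continuous_map_set_compose[OF G(1)]) (auto intro!: continuous_on_Pair continuous_on_id)
  have G1_bd: "G (1, y) = x0" if "y \<in> cell_boundary S" for y
    using G_bd[OF _ that, of 1] k_zero by simp
  obtain N where N: "continuous_map (top_of_set ({0..1::real} \<times> cell S)) X N"
    "\<And>y. y \<in> cell S \<Longrightarrow> N (0, y) = x0" "\<And>y. y \<in> cell S \<Longrightarrow> N (1, y) = G (1, y)"
    "\<And>s y. s \<in> {0..1} \<Longrightarrow> y \<in> cell_boundary S \<Longrightarrow> N (s, y) = x0"
    by (rule null_homotopy_on_cell[OF triv fin(1) G1 G1_bd]) (assumption, rule that)
  define h1 where "h1 y = N (y l, y(l := 0))" for y
  have h1_cont: "continuous_map (top_of_set (cell (insert l S))) X h1"
    unfolding h1_def by (rule continuous_map_set_compose[OF N(1) split_cont]) (use ci(1) in auto)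
  define c where "c z = (if z \<in> {0..1::real} \<times> T then G (1 - fst z, (snd z)(l := 0)) else k (\<lambda>i. fst z * snd z i))"
    for z :: "real \<times> (nat \<Rightarrow> real)"
  have TJ_sub: "T \<subseteq> cell (insert l S)" "J \<subseteq> cell (insert l S)" by (auto simp: T_def J_def)
  have closed_T: "closed T"
  proof -
    have "T = cell (insert l S) \<inter> {y. y l \<in> {1}}" by (auto simp: T_def)
    then show ?thesis by (simp only: closed_Int closed_cell closed_coordinate closed_singleton)
  qed
  have closed_J: "closed J"
  proof -
    have "J = cell (insert l S) \<inter> ({y. y l \<in> {0}} \<union> (\<lambda>y. y(l := 0)) -` cell_boundary S)"
      by (auto simp: J_def)
    moreover have "closed ((\<lambda>y :: nat \<Rightarrow> real. y(l := 0)) -` cell_boundary S)"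
      by (intro closed_vimage closed_cell_boundary fin continuous_on_fun_upd continuous_on_id continuous_on_const)
    ultimately show ?thesis
      by (simp only: closed_Int closed_Un closed_cell closed_coordinate closed_singleton)
  qed
  have c_overlap: "G (1 - s, y(l := 0)) = k (\<lambda>i. s * y i)" if "s \<in> {0..1}" "y \<in> T" "y \<in> J" for s y
  proof -
    have y: "y(l := 0) \<in> cell_boundary S" "y l = 1" using that by (auto simp: T_def J_def)
    have "(y(l := 0))(l := 1) = y" using y(2) by auto
    moreover have "G (1 - s, y(l := 0)) = k (\<lambda>i. (1 - (1 - s)) * ((y(l := 0))(l := 1)) i)"
      by (rule G_bd[OF _ y(1)]) (use that(1) in simp)
    moreover have "1 - (1 - s) = s" by simp
    ultimately show ?thesis by (simp only:)
  qed
  have "continuous_map (top_of_set ({0..1::real} \<times> T \<union> {0..1::real} \<times> J)) X c"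
    unfolding c_def
  proof (rule continuous_map_glue_closed)
    show "closed ({0..1::real} \<times> T)" "closed ({0..1::real} \<times> J)"
      by (intro closed_Times closed_T closed_J closed_atLeastAtMost)+
    show "continuous_map (top_of_set ({0..1::real} \<times> T)) X (\<lambda>z. G (1 - fst z, (snd z)(l := 0)))"
      by (rule continuous_map_set_compose[OF G(1)])
         (use ci(1) TJ_sub in \<open>auto intro!: continuous_on_Pair continuous_on_diff continuous_on_fun_upd
            continuous_on_fst continuous_on_snd continuous_on_id continuous_on_const\<close>)
    show "continuous_map (top_of_set ({0..1::real} \<times> J)) X (\<lambda>z. k (\<lambda>i. fst z * snd z i))"
      using continuous_map_set_compose[OF k_scale continuous_on_id, of "{0..1::real} \<times> J"] TJ_sub by auto
  qed (use c_overlap in auto)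
  moreover have "{0..1::real} \<times> T \<union> {0..1::real} \<times> J = {0..1::real} \<times> cell_boundary (insert l S)"
    unfolding JT by blast
  ultimately have c_cont: "continuous_map (top_of_set ({0..1::real} \<times> cell_boundary (insert l S))) X c"
    by simp
  \<comment> \<open>Since \<open>c\<close> runs backwards, from the end of the deformation to
    \<open>f\<close>, its extension ends with the map sought.\<close>
  define q where "q z = (if z \<in> {0::real} \<times> cell (insert l S) then h1 (snd z) else c z)" for z :: "real \<times> (nat \<Rightarrow> real)"
  have q_overlap: "h1 y = c (0, y)" if "y \<in> cell_boundary (insert l S)" for y
  proof -
    have y: "y(l := 0) \<in> cell S" "y l \<in> {0..1}" using that ci(1) unfolding cb by auto
    show ?thesis
    proof (cases "y \<in> T")
      case True
      then show ?thesis using N(3)[OF y(1)] by (simp add: h1_def c_def T_def)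
    next
      case False
      then have "y \<in> J" using that unfolding JT by blast
      then have "h1 y = x0" using N(2)[OF y(1)] N(4)[OF y(2)] by (auto simp: h1_def J_def)
      then show ?thesis using False k_zero by (simp add: c_def)
    qed
  qed
  have fin': "finite (insert l S)" "insert l S \<noteq> {}" using fin by auto
  have "continuous_map (top_of_set ({0::real} \<times> cell (insert l S) \<union> {0..1::real} \<times> cell_boundary (insert l S))) X q"
    unfolding q_def
  proof (rule continuous_map_glue_closed[OF _ _ _ c_cont])
    show "closed ({0::real} \<times> cell (insert l S))" "closed ({0..1::real} \<times> cell_boundary (insert l S))"
      by (intro closed_Times closed_cell closed_cell_boundary fin' closed_singleton closed_atLeastAtMost)+
    show "continuous_map (top_of_set ({0::real} \<times> cell (insert l S))) X (\<lambda>z. h1 (snd z))"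
      by (rule continuous_map_set_compose[OF h1_cont]) (auto intro!: continuous_on_snd continuous_on_id)
  qed (use q_overlap in auto)
  then obtain Q where Q: "continuous_map (top_of_set ({0..1::real} \<times> cell (insert l S))) X Q"
    "\<And>s y. s \<in> {0..1} \<Longrightarrow> y \<in> cell_boundary (insert l S) \<Longrightarrow> Q (s, y) = q (s, y)"
    by (rule fill_open_box[OF fin']) (rule that)
  show thesis
  proof (rule that[of "\<lambda>y. Q (1, y)"])
    show "continuous_map (top_of_set (cell (insert l S))) X (\<lambda>y. Q (1, y))"
      by (rule continuous_map_set_compose[OF Q(1)]) (auto intro!: continuous_on_Pair continuous_on_id)
    fix y assume y: "y \<in> cell_boundary (insert l S)"
    have "Q (1, y) = c (1, y)" using Q(2)[OF _ y, of 1] by (simp add: q_def)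
    also have "\<dots> = f y"
    proof (cases "y \<in> T")
      case True
      then have "(y(l := 0))(l := 1) = y" by (auto simp: T_def)
      moreover have "y(l := 0) \<in> cell S" using True TJ_sub ci(1) by blast
      then have "G (0, y(l := 0)) = f ((y(l := 0))(l := 1))" by (rule G0)
      moreover have "c (1, y) = G (0, y(l := 0))" using True by (simp add: c_def)
      ultimately show ?thesis by (simp only:)
    next
      case False
      then have "y \<in> J" using y unfolding JT by blast
      then show ?thesis using False k_J by (simp add: c_def)
    qed
    finally show "Q (1, y) = f y" .
  qed
qed

section \<open>Periodic maps from commuting loops\<close>

definition interior_coords :: "nat \<Rightarrow> (nat \<Rightarrow> real) \<Rightarrow> nat set" where
  "interior_coords r y = {i. i < r \<and> 0 < y i \<and> y i < 1}"

text \<open>The \<open>k\<close>-skeleton of the unit cube.\<close>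

definition skeleton :: "nat \<Rightarrow> nat \<Rightarrow> (nat \<Rightarrow> real) set" where
  "skeleton r k = {y \<in> cell {..<r}. card (interior_coords r y) \<le> k}"

text \<open>The torus is the cube with opposite faces identified. Each point is identified with
  exactly one point in the image of \<open>collapse\<close>, so that the invariance of a map under
  \<open>collapse\<close> says that it is a map of the torus.\<close>

definition collapse :: "(nat \<Rightarrow> real) \<Rightarrow> nat \<Rightarrow> real" where
  "collapse y i = (if y i = 1 then 0 else y i)"

lemma interior_coords_collapse [simp]: "interior_coords r (collapse y) = interior_coords r y"
  by (auto simp: interior_coords_def collapse_def)

lemma collapse_collapse [simp]: "collapse (collapse y) = collapse y"
  by (auto simp: collapse_def fun_eq_iff)

lemma collapse_cell: "y \<in> cell S \<Longrightarrow> collapse y \<in> cell S"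
  by (auto simp: cell_def collapse_def split: if_splits)

lemma skeleton_collapse_iff: "y \<in> cell {..<r} \<Longrightarrow> collapse y \<in> skeleton r k \<longleftrightarrow> y \<in> skeleton r k"
  by (simp add: skeleton_def collapse_cell)

lemma cell_mono: "S \<subseteq> T \<Longrightarrow> cell S \<subseteq> cell T"
  by (force simp: cell_def split: if_splits)

lemma interior_coords_cell: "y \<in> cell S \<Longrightarrow> interior_coords r y \<subseteq> S"
  using cellD(2)[of y S] by (fastforce simp: interior_coords_def)

lemma cell_subset_skeleton:
  assumes "S \<subseteq> {..<r}" "card S \<le> k"
  shows "cell S \<subseteq> skeleton r k"
proof
  fix y assume y: "y \<in> cell S"
  have "finite S" using assms(1) finite_subset by blast
  then have "card (interior_coords r y) \<le> card S"
    using interior_coords_cell[OF y] by (rule card_mono)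
  then show "y \<in> skeleton r k"
    using y assms cell_mono by (auto simp: skeleton_def)
qed

lemma interior_coords_boundary:
  assumes "y \<in> cell_boundary S" shows "interior_coords r y \<subset> S"
proof -
  obtain i where i: "i \<in> S" "y i = 0 \<or> y i = 1" using assms by (auto simp: cell_boundary_def)
  then have "i \<notin> interior_coords r y" by (auto simp: interior_coords_def)
  then show ?thesis using interior_coords_cell[OF cell_boundary_cell[OF assms]] i(1) by blast
qed

lemma cell_boundary_subset_skeleton:
  assumes "S \<subseteq> {..<r}" "card S = Suc k"
  shows "cell_boundary S \<subseteq> skeleton r k"
proof
  fix y assume y: "y \<in> cell_boundary S"
  have "finite S" using assms(1) finite_subset by blast
  then have "card (interior_coords r y) < card S"
    using interior_coords_boundary[OF y] by (rule psubset_card_mono)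
  then show "y \<in> skeleton r k"
    using assms cell_boundary_cell[OF y] cell_mono[of S "{..<r}"] by (auto simp: skeleton_def)
qed

text \<open>The faces of the cube that are parallel to \<open>cell S\<close> become one cell of the
  torus. So it suffices to extend the map over \<open>cell S\<close> for each \<open>S\<close>; the
  extension is copied to the faces parallel to it. The pieces are the parallel faces, with the set
  \<open>V\<close> of the fixed coordinates that are \<open>1\<close>; they are closed and finite in
  number.\<close>

lemma extend_over_skeleton:
  assumes f: "continuous_map (top_of_set (skeleton r k)) X f"
    and per: "\<And>y. y \<in> skeleton r k \<Longrightarrow> f (collapse y) = f y"
    and k: "Suc k \<le> r"
    and g: "\<And>S. S \<subseteq> {..<r} \<Longrightarrow> card S = Suc k \<Longrightarrow> continuous_map (top_of_set (cell S)) X (g S)"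
    and gf: "\<And>S y. S \<subseteq> {..<r} \<Longrightarrow> card S = Suc k \<Longrightarrow> y \<in> cell_boundary S \<Longrightarrow> g S y = f y"
  obtains F where "continuous_map (top_of_set (skeleton r (Suc k))) X F"
    "\<And>y. y \<in> skeleton r (Suc k) \<Longrightarrow> F (collapse y) = F y"
    "\<And>y. y \<in> skeleton r k \<Longrightarrow> F y = f y"
    "\<And>S y. S \<subseteq> {..<r} \<Longrightarrow> card S = Suc k \<Longrightarrow> y \<in> cell S \<Longrightarrow> F y = g S y"
proof -
  define F where "F y = (if y \<in> skeleton r k then f y else g (interior_coords r y) (collapse y))" for y
  define proj where "proj S y = (\<lambda>i. if i \<in> S then y i else 0)" for S and y :: "nat \<Rightarrow> real"
  define piece where "piece S V = {y \<in> cell {..<r}. \<forall>i. i < r \<and> i \<notin> S \<longrightarrow> y i \<in> {if i \<in> V then 1 else 0 :: real}}" for S V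
  have piece_coord: "y i = 0 \<or> y i = 1" if "y \<in> piece S V" "i < r" "i \<notin> S" for y i S V
    using that by (auto simp: piece_def split: if_splits)
  have piece_cell: "y \<in> cell {..<r}" if "y \<in> piece S V" for y S V
    using that by (simp add: piece_def)
  have piece_interior: "interior_coords r y \<subseteq> S" if "y \<in> piece S V" for y S V
    using piece_coord[OF that] by (fastforce simp: interior_coords_def)
  have piece_skeleton: "piece S V \<subseteq> skeleton r (Suc k)" if "S \<subseteq> {..<r}" "card S = Suc k" for S V
  proof
    fix y assume y: "y \<in> piece S V"
    have "finite S" using that(1) finite_subset by blast
    then have "card (interior_coords r y) \<le> card S"
      using piece_interior[OF y] by (rule card_mono)
    then show "y \<in> skeleton r (Suc k)" using piece_cell[OF y] that by (simp add: skeleton_def)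
  qed
  have proj_cell: "proj S y \<in> cell S" if "y \<in> cell {..<r}" "S \<subseteq> {..<r}" for S y
    using that cellD(1)[OF that(1)] by (intro cellI) (auto simp: proj_def)
  have collapse_proj: "collapse (proj S y) = collapse y" if "y \<in> piece S V" for y S V
  proof
    fix i
    show "collapse (proj S y) i = collapse y i"
    proof (cases "i \<in> S")
      case False
      have "y i = 0 \<or> y i = 1"
        using piece_coord[OF that _ False] cellD(2)[OF piece_cell[OF that], of i] by (cases "i < r") auto
      then show ?thesis using False by (auto simp: collapse_def proj_def)
    qed (simp add: collapse_def proj_def)
  qed
  have F_piece: "F y = g S (proj S y)" if S: "S \<subseteq> {..<r}" "card S = Suc k" and y: "y \<in> piece S V" for y S V
  proof (cases "interior_coords r y = S")
    case True
    have "collapse y = proj S y"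
    proof
      fix i
      show "collapse y i = proj S y i"
      proof (cases "i \<in> S")
        case i: True
        then have "0 < y i" "y i < 1" using True by (auto simp: interior_coords_def)
        then show ?thesis using i by (simp add: collapse_def proj_def)
      next
        case False
        have "y i = 0 \<or> y i = 1"
          using piece_coord[OF y _ False] cellD(2)[OF piece_cell[OF y], of i] by (cases "i < r") auto
        then show ?thesis using False by (auto simp: collapse_def proj_def)
      qed
    qed
    moreover have "y \<notin> skeleton r k" using True S by (simp add: skeleton_def)
    ultimately show ?thesis using True by (simp add: F_def)
  next
    case False
    have "finite S" using S(1) finite_subset by blast
    then have "card (interior_coords r y) < card S"
      using piece_interior[OF y] False by (intro psubset_card_mono) auto
    then have y_sk: "y \<in> skeleton r k" using S piece_cell[OF y] by (simp add: skeleton_def)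
    obtain i where i: "i \<in> S" "i \<notin> interior_coords r y" using piece_interior[OF y] False by blast
    then have "y i = 0 \<or> y i = 1"
      using S(1) cellD(1)[OF piece_cell[OF y], of i] by (fastforce simp: interior_coords_def)
    then have bd: "proj S y \<in> cell_boundary S"
      unfolding cell_boundary_def using proj_cell[OF piece_cell[OF y] S(1)] i(1)
      by (intro CollectI conjI bexI[of _ i]) (simp_all add: proj_def)
    have "proj S y \<in> skeleton r k" using cell_boundary_subset_skeleton[OF S] bd by blast
    then have "f (proj S y) = f y"
      using per[of "proj S y"] per[OF y_sk] collapse_proj[OF y] by simp
    then show ?thesis using gf[OF S bd] y_sk by (simp add: F_def)
  qed
  define Idx where "Idx = {S. S \<subseteq> {..<r} \<and> card S = Suc k} \<times> Pow {..<r}"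
  have cont: "continuous_map (top_of_set (skeleton r (Suc k))) X F"
  proof (rule pasting_lemma_closed[where I = Idx and T = "\<lambda>(S, V). piece S V" and f = "\<lambda>(S, V) y. g S (proj S y)"])
    show "finite Idx" unfolding Idx_def by (intro finite_cartesian_product) auto
    show "closedin (top_of_set (skeleton r (Suc k))) (case z of (S, V) \<Rightarrow> piece S V)" if zI: "z \<in> Idx" for z
    proof -
      obtain S V where z: "z = (S, V)" "S \<subseteq> {..<r}" "card S = Suc k" using zI by (auto simp: Idx_def)
      have "piece S V = cell {..<r} \<inter> {y. \<forall>i. i < r \<and> i \<notin> S \<longrightarrow> y i \<in> {if i \<in> V then 1 else 0}}"
        by (auto simp: piece_def)
      also have "closed \<dots>"
        by (intro closed_Int closed_cell closed_Collect_all closed_Collect_imp open_Collect_const closed_coordinate) simp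
      finally have "closed (piece S V)" .
      then show ?thesis using piece_skeleton[OF z(2,3)] unfolding z(1) by (simp add: closed_subset)
    qed
    show "continuous_map (subtopology (top_of_set (skeleton r (Suc k))) (case z of (S, V) \<Rightarrow> piece S V)) X
        ((\<lambda>(S, V) y. g S (proj S y)) z)" if zI: "z \<in> Idx" for z
    proof -
      obtain S V where z: "z = (S, V)" "S \<subseteq> {..<r}" "card S = Suc k" using zI by (auto simp: Idx_def)
      have "continuous_on (piece S V) (proj S)"
        unfolding proj_def
        by (rule continuous_on_coordinatewise_then_product, rule continuous_on_if_const)
           (rule coordinate_intros continuous_on_const)+
      then have "continuous_map (top_of_set (piece S V)) X (\<lambda>y. g S (proj S y))"
        using proj_cell[OF piece_cell z(2)] by (intro continuous_map_set_compose[OF g[OF z(2,3)]])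
      moreover have "skeleton r (Suc k) \<inter> piece S V = piece S V" using piece_skeleton[OF z(2,3)] by blast
      ultimately show ?thesis unfolding z(1) by (simp add: subtopology_subtopology)
    qed
    show "(\<lambda>(S, V) y. g S (proj S y)) z x = (\<lambda>(S, V) y. g S (proj S y)) z' x"
      if zI: "z \<in> Idx" "z' \<in> Idx" and xI: "x \<in> topspace (top_of_set (skeleton r (Suc k))) \<inter> (case z of (S, V) \<Rightarrow> piece S V)
        \<inter> (case z' of (S, V) \<Rightarrow> piece S V)" for z z' x
    proof -
      obtain S V where z: "z = (S, V)" "S \<subseteq> {..<r}" "card S = Suc k" using zI(1) by (auto simp: Idx_def)
      obtain S' V' where z': "z' = (S', V')" "S' \<subseteq> {..<r}" "card S' = Suc k" using zI(2) by (auto simp: Idx_def)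
      have "x \<in> piece S V" "x \<in> piece S' V'" using xI by (simp_all add: z(1) z'(1))
      then have "g S (proj S x) = g S' (proj S' x)"
        using F_piece[OF z(2,3)] F_piece[OF z'(2,3)] by metis
      then show ?thesis by (simp add: z(1) z'(1))
    qed
    show "\<exists>z. z \<in> Idx \<and> x \<in> (case z of (S, V) \<Rightarrow> piece S V) \<and> F x = (\<lambda>(S, V) y. g S (proj S y)) z x"
      if "x \<in> topspace (top_of_set (skeleton r (Suc k)))" for x
    proof -
      have x: "x \<in> cell {..<r}" "card (interior_coords r x) \<le> Suc k" using that by (simp_all add: skeleton_def)
      have "\<exists>S. interior_coords r x \<subseteq> S \<and> S \<subseteq> {..<r} \<and> card S = Suc k"
        by (rule exists_subset_between) (use x(2) k in \<open>auto simp: interior_coords_def\<close>)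
      then obtain S where S: "interior_coords r x \<subseteq> S" "S \<subseteq> {..<r}" "card S = Suc k" by blast
      define V where "V = {i. i < r \<and> x i = 1}"
      have "x i = (if i \<in> V then 1 else 0)" if "i < r" "i \<notin> S" for i
      proof -
        have "i \<notin> interior_coords r x" using that S(1) by blast
        then have "x i = 0 \<or> x i = 1"
          using cellD(1)[OF x(1), of i] that(1) by (fastforce simp: interior_coords_def)
        then show ?thesis using that by (auto simp: V_def)
      qed
      then have "x \<in> piece S V" using x(1) by (simp add: piece_def)
      moreover have "(S, V) \<in> Idx" using S by (auto simp: Idx_def V_def)
      ultimately show ?thesis using F_piece[OF S(2,3)] by (intro exI[of _ "(S, V)"]) simp
    qed
  qed
  show thesis
  proof (rule that[OF cont])
    show "F (collapse y) = F y" if "y \<in> skeleton r (Suc k)" for y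
    proof -
      have "y \<in> cell {..<r}" using that by (simp add: skeleton_def)
      then show ?thesis using per by (simp add: F_def skeleton_collapse_iff)
    qed
    show "F y = f y" if "y \<in> skeleton r k" for y using that by (simp add: F_def)
    show "F y = g S y" if S: "S \<subseteq> {..<r}" "card S = Suc k" and y: "y \<in> cell S" for S y
    proof -
      have "y \<in> piece S {}" using y S(1) cell_mono[OF S(1)] cellD(2)[OF y] by (auto simp: piece_def)
      moreover have "proj S y = y" using cellD(2)[OF y] by (auto simp: proj_def fun_eq_iff)
      ultimately show ?thesis using F_piece[OF S] by simp
    qed
  qed
qed

definition axis_point :: "nat \<Rightarrow> real \<Rightarrow> nat \<Rightarrow> real" where
  "axis_point i t = (\<lambda>j. if j = i then t else 0)"

lemma cell_singleton: "cell {i} = axis_point i ` {0..1}"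
proof (intro equalityI subsetI)
  fix y assume y: "y \<in> cell {i}"
  then have "y = axis_point i (y i)" using cellD(2)[OF y] by (auto simp: axis_point_def fun_eq_iff)
  then show "y \<in> axis_point i ` {0..1}" using cellD(1)[OF y, of i] by auto
next
  fix y assume "y \<in> axis_point i ` {0..1}"
  then show "y \<in> cell {i}" by (auto simp: axis_point_def intro!: cellI split: if_splits)
qed

lemma pause_0 [simp]: "pause 0 = 0" and pause_1 [simp]: "pause 1 = 1"
  by (simp_all add: pause_def)

text \<open>On a \<open>1\<close>-cell the map is the prescribed loop, on a \<open>2\<close>-cell
  the square of two commuting loops, and on the cells of higher dimension it exists by
  asphericity.\<close>

lemma skeleton_map_exists:
  assumes triv: "\<And>k. k \<ge> 2 \<Longrightarrow> trivial_group (homotopy_group k X x0)"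
    and x0: "x0 \<in> topspace X"
    and loops: "\<And>i. i < r \<Longrightarrow> loop_at X x0 (\<gamma> i)"
    and comm: "\<And>i j. i < r \<Longrightarrow> j < r \<Longrightarrow>
      loop_homotopic X x0 (loop_concat (\<gamma> i) (\<gamma> j)) (loop_concat (\<gamma> j) (\<gamma> i))"
  shows "k \<le> r \<Longrightarrow> \<exists>f. continuous_map (top_of_set (skeleton r k)) X f \<and>
     (\<forall>y\<in>skeleton r k. f (collapse y) = f y) \<and> f (\<lambda>_. 0) = x0 \<and>
     (k \<ge> 1 \<longrightarrow> (\<forall>i<r. \<forall>t\<in>{0..1}. f (axis_point i t) = \<gamma> i (pause t)))"
proof (induction k)
  case 0
  show ?case using x0 by (intro exI[of _ "\<lambda>_. x0"]) auto
next
  case (Suc k)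
  obtain f where f0: "continuous_map (top_of_set (skeleton r k)) X f"
    "\<forall>y\<in>skeleton r k. f (collapse y) = f y" "f (\<lambda>_. 0) = x0"
    "k \<ge> 1 \<longrightarrow> (\<forall>i<r. \<forall>t\<in>{0..1}. f (axis_point i t) = \<gamma> i (pause t))"
    using Suc.IH[OF Suc_leD[OF Suc.prems]] by blast
  note f = f0(1) f0(2)[rule_format] f0(3) f0(4)[rule_format]
  have \<gamma>: "continuous_map (top_of_set {0..1}) X (\<gamma> i)" "\<gamma> i 0 = x0" "\<gamma> i 1 = x0" if "i < r" for i
    using loops[OF that] by (simp_all add: loop_at_def)
  have pause_cont: "continuous_on A pause" for A
    unfolding pause_def by (intro continuous_intros)
  have pause_mem: "pause t \<in> {0..1}" for t by (auto simp: pause_def)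
  \<comment> \<open>The last conjunct records the loops when they enter in dimension \<open>1\<close>.\<close>
  define good where "good S h \<longleftrightarrow> continuous_map (top_of_set (cell S)) X h \<and> (\<forall>y\<in>cell_boundary S. h y = f y) \<and>
    (\<forall>i t. S = {i} \<longrightarrow> t \<in> {0..1} \<longrightarrow> h (axis_point i t) = \<gamma> i (pause t))" for S h
  have ex: "\<exists>h. good S h" if S: "S \<subseteq> {..<r}" "card S = Suc k" for S
  proof -
    have finS: "finite S" using S(1) finite_subset by blast
    have bd_sub: "continuous_map (top_of_set (cell_boundary S)) X f"
      using continuous_map_set_compose[OF f(1) continuous_on_id, of "cell_boundary S"]
        cell_boundary_subset_skeleton[OF S] by auto
    consider "k = 0" | "k = 1" | "k \<ge> 2" by linarith
    then show ?thesis
    proof cases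
      case 1
      then obtain i where i: "S = {i}" using S(2) card_1_singletonE[of S] by auto
      have "i < r" using S(1) i by simp
      have "continuous_map (top_of_set (cell S)) X (\<lambda>y. \<gamma> i (pause (y i)))"
        by (rule continuous_map_set_compose[OF \<gamma>(1)[OF \<open>i < r\<close>]])
           (use pause_mem in \<open>auto intro!: continuous_on_compose2[OF pause_cont] coordinate_intros\<close>)
      moreover have "\<gamma> i (pause (y i)) = f y" if y: "y \<in> cell_boundary S" for y
      proof -
        have ysk: "y \<in> skeleton r k" using cell_boundary_subset_skeleton[OF S] y by blast
        have "y i = 0 \<or> y i = 1" using y i by (auto simp: cell_boundary_def)
        moreover have "y j = 0" if "j \<noteq> i" for j
          using cellD(2)[OF cell_boundary_cell[OF y], of j] that i by simp
        ultimately have "collapse y j = 0" for j by (cases "j = i") (auto simp: collapse_def)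
        then have "collapse y = (\<lambda>_. 0)" by (rule ext)
        then have "f y = x0" using f(2)[OF ysk] f(3) by simp
        moreover have "\<gamma> i (pause (y i)) = x0"
          using \<open>y i = 0 \<or> y i = 1\<close> \<gamma>(2,3)[OF \<open>i < r\<close>] by auto
        ultimately show ?thesis by simp
      qed
      moreover have "\<gamma> i (pause (axis_point i t i)) = \<gamma> i (pause t)" for t
        by (simp add: axis_point_def)
      ultimately show ?thesis
        unfolding good_def i by (intro exI[of _ "\<lambda>y. \<gamma> i (pause (y i))"]) auto
    next
      case 2
      then have "card S = 2" using S(2) by simp
      then obtain i j where ij: "S = {i, j}" "i \<noteq> j" by (auto simp: card_2_iff)
      then have r: "i < r" "j < r" using S(1) by auto
      obtain h where h: "continuous_map (top_of_set ({0..1} \<times> {0..1})) X h"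
        "\<And>t. t \<in> {0..1} \<Longrightarrow> h (t, 0) = \<gamma> i (pause t) \<and> h (t, 1) = \<gamma> i (pause t) \<and>
           h (0, t) = \<gamma> j (pause t) \<and> h (1, t) = \<gamma> j (pause t)"
        by (rule commuting_loops_square[OF comm[OF r]]) (rule that)
      have "continuous_map (top_of_set (cell S)) X (\<lambda>y. h (y i, y j))"
        by (rule continuous_map_set_compose[OF h(1)])
           (use cellD(1) ij in \<open>auto intro!: continuous_on_Pair coordinate_intros\<close>)
      moreover have "h (y i, y j) = f y" if y: "y \<in> cell_boundary S" for y
      proof -
        have ysk: "y \<in> skeleton r k" using cell_boundary_subset_skeleton[OF S] y by blast
        have yc: "y \<in> cell S" by (rule cell_boundary_cell[OF y])
        have y01: "y i \<in> {0..1}" "y j \<in> {0..1}" using cellD(1)[OF yc] ij by auto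
        have other: "y l = 0" if "l \<noteq> i" "l \<noteq> j" for l using cellD(2)[OF yc, of l] that ij by simp
        have edge: "f y = \<gamma> a (pause (y a))"
          if a: "a < r" "y a \<in> {0..1}" and rest: "\<And>l. l \<noteq> a \<Longrightarrow> y l = 0 \<or> y l = 1" for a
        proof -
          have "collapse y l = axis_point a (collapse y a) l" for l
            by (cases "l = a") (use rest[of l] in \<open>auto simp: collapse_def axis_point_def\<close>)
          then have c: "collapse y = axis_point a (collapse y a)" by (rule ext)
          have "collapse y a \<in> {0..1}" using a(2) by (auto simp: collapse_def)
          then have "f (axis_point a (collapse y a)) = \<gamma> a (pause (collapse y a))"
            using f(4)[OF _ a(1)] 2 by simp
          then have "f y = \<gamma> a (pause (collapse y a))" using f(2)[OF ysk] c by simp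
          also have "\<dots> = \<gamma> a (pause (y a))"
            using \<gamma>(2,3)[OF a(1)] by (simp add: collapse_def)
          finally show ?thesis .
        qed
        have "y i = 0 \<or> y i = 1 \<or> y j = 0 \<or> y j = 1" using y ij by (auto simp: cell_boundary_def)
        then consider "y j = 0 \<or> y j = 1" | "y i = 0 \<or> y i = 1" by blast
        then show ?thesis
        proof cases
          case 1
          have rest: "y l = 0 \<or> y l = 1" if "l \<noteq> i" for l
            using other[of l] 1 that by (cases "l = j") auto
          have "f y = \<gamma> i (pause (y i))" by (rule edge[OF r(1) y01(1) rest])
          then show ?thesis using 1 h(2)[OF y01(1)] by auto
        next
          case 2
          have rest: "y l = 0 \<or> y l = 1" if "l \<noteq> j" for l
            using other[of l] 2 that by (cases "l = i") auto
          have "f y = \<gamma> j (pause (y j))" by (rule edge[OF r(2) y01(2) rest])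
          then show ?thesis using 2 h(2)[OF y01(2)] by auto
        qed
      qed
      ultimately show ?thesis
        unfolding good_def using \<open>card S = 2\<close> by (intro exI[of _ "\<lambda>y. h (y i, y j)"]) auto
    next
      case 3
      then have "S \<noteq> {}" using S(2) by auto
      then obtain l where l: "l \<in> S" by blast
      define S0 where "S0 = S - {l}"
      have S0: "S = insert l S0" "l \<notin> S0" "finite S0" "card S0 = k"
        using l finS S(2) by (auto simp: S0_def card_Diff_singleton)
      have "S0 \<noteq> {}" using S0(4) 3 by auto
      have tr: "trivial_group (homotopy_group (card S0) X x0)" using triv 3 S0(4) by simp
      obtain h where h: "continuous_map (top_of_set (cell (insert l S0))) X h"
        "\<And>y. y \<in> cell_boundary (insert l S0) \<Longrightarrow> h y = f y"
        by (rule extend_from_cell_boundary[OF tr S0(3) \<open>S0 \<noteq> {}\<close> S0(2) bd_sub[unfolded S0(1)] f(3)]) (rule that)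
      have "S \<noteq> {i}" for i using S(2) 3 by auto
      then show ?thesis unfolding good_def using h S0(1) by blast
    qed
  qed
  define g where "g S = (SOME h. good S h)" for S
  have g: "good S (g S)" if "S \<subseteq> {..<r}" "card S = Suc k" for S
    unfolding g_def by (rule someI_ex[OF ex[OF that]])
  obtain F where F: "continuous_map (top_of_set (skeleton r (Suc k))) X F"
    "\<And>y. y \<in> skeleton r (Suc k) \<Longrightarrow> F (collapse y) = F y"
    "\<And>y. y \<in> skeleton r k \<Longrightarrow> F y = f y"
    "\<And>S y. S \<subseteq> {..<r} \<Longrightarrow> card S = Suc k \<Longrightarrow> y \<in> cell S \<Longrightarrow> F y = g S y"
  proof (rule extend_over_skeleton[OF f(1) f(2) Suc.prems, of g])
    show "continuous_map (top_of_set (cell S)) X (g S)" if "S \<subseteq> {..<r}" "card S = Suc k" for S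
      using g[OF that] by (simp add: good_def)
    show "g S y = f y" if "S \<subseteq> {..<r}" "card S = Suc k" "y \<in> cell_boundary S" for S y
      using g[OF that(1,2)] that(3) by (simp add: good_def)
  qed (assumption, rule that)
  have "(\<lambda>_. 0) \<in> skeleton r k"
    by (simp add: skeleton_def cell_def interior_coords_def)
  then have "F (\<lambda>_. 0) = x0" using F(3) f(3) by simp
  moreover have "F (axis_point i t) = \<gamma> i (pause t)" if i: "i < r" and t: "t \<in> {0..1}" for i t
  proof (cases "k = 0")
    case True
    have S: "{i} \<subseteq> {..<r}" "card {i} = Suc k" using True i by auto
    have "axis_point i t \<in> cell {i}" using t by (auto simp: cell_singleton)
    then show ?thesis using F(4)[OF S] g[OF S] t by (simp add: good_def)
  next
    case False
    have "axis_point i t \<in> cell {i}" using t by (auto simp: cell_singleton)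
    then have "axis_point i t \<in> skeleton r k" using cell_subset_skeleton[of "{i}" r k] i False by auto
    then show ?thesis using F(3) f(4)[OF _ i t] False by simp
  qed
  ultimately show ?case using F(1,2) by (intro exI[of _ F]) simp
qed

text \<open>An aspherical space receives a map from the torus for any finite family of commuting
  elements of its fundamental group. The map on the unit cube that agrees on opposite faces is
  continued periodically; its continuity is checked on the unit boxes with integer corners, which
  form a locally finite closed cover.\<close>

proposition periodic_map_exists:
  assumes triv: "\<And>k. k \<ge> 2 \<Longrightarrow> trivial_group (homotopy_group k X x0)"
    and x0: "x0 \<in> topspace X"
    and loops: "\<And>i. i < r \<Longrightarrow> loop_at X x0 (\<gamma> i)"
    and comm: "\<And>i j. i < r \<Longrightarrow> j < r \<Longrightarrow>
      loop_homotopic X x0 (loop_concat (\<gamma> i) (\<gamma> j)) (loop_concat (\<gamma> j) (\<gamma> i))"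
  obtains \<Phi> where "continuous_map euclidean X \<Phi>"
    "\<And>x v. \<forall>j<r. v j \<in> \<int> \<Longrightarrow> \<Phi> (\<lambda>j. x j + v j) = \<Phi> x"
    "\<Phi> (\<lambda>_. 0) = x0"
    "\<And>i t. i < r \<Longrightarrow> t \<in> {0..1} \<Longrightarrow> \<Phi> (axis_point i t) = \<gamma> i (pause t)"
proof -
  have "\<exists>f. continuous_map (top_of_set (skeleton r r)) X f \<and>
     (\<forall>y\<in>skeleton r r. f (collapse y) = f y) \<and> f (\<lambda>_. 0) = x0 \<and>
     (r \<ge> 1 \<longrightarrow> (\<forall>i<r. \<forall>t\<in>{0..1}. f (axis_point i t) = \<gamma> i (pause t)))"
  proof (rule skeleton_map_exists[of X x0 r \<gamma> r])
    show "trivial_group (homotopy_group k X x0)" if "k \<ge> 2" for k by (rule triv[OF that])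
    show "loop_at X x0 (\<gamma> i)" if "i < r" for i by (rule loops[OF that])
    show "loop_homotopic X x0 (loop_concat (\<gamma> i) (\<gamma> j)) (loop_concat (\<gamma> j) (\<gamma> i))"
      if "i < r" "j < r" for i j by (rule comm[OF that])
  qed (rule x0, rule order_refl)
  then obtain f where f0: "continuous_map (top_of_set (skeleton r r)) X f"
    "\<forall>y\<in>skeleton r r. f (collapse y) = f y" "f (\<lambda>_. 0) = x0"
    "r \<ge> 1 \<longrightarrow> (\<forall>i<r. \<forall>t\<in>{0..1}. f (axis_point i t) = \<gamma> i (pause t))" by blast
  have f_axis: "f (axis_point i t) = \<gamma> i (pause t)" if "i < r" "t \<in> {0..1}" for i t
    using f0(4) that by simp
  note f = f0(1) f0(2)[rule_format] f0(3) f_axis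
  have sk: "skeleton r r = cell {..<r}"
  proof -
    have "card (interior_coords r y) \<le> r" for y
      using card_mono[of "{..<r}" "interior_coords r y"] by (auto simp: interior_coords_def)
    then show ?thesis by (auto simp: skeleton_def)
  qed
  define fracs where "fracs x = (\<lambda>i. if i < r then frac (x i) else 0)" for x :: "nat \<Rightarrow> real"
  define shift where "shift v x = (\<lambda>i. if i < r then x i - of_int (v i) else 0)" for v and x :: "nat \<Rightarrow> real"
  define \<Phi> where "\<Phi> x = f (fracs x)" for x
  define box where "box v = {x :: nat \<Rightarrow> real. \<forall>i. i < r \<longrightarrow> x i \<in> {of_int (v i) .. of_int (v i) + 1}}" for v
  define Idx where "Idx = {v :: nat \<Rightarrow> int. \<forall>i\<ge>r. v i = 0}"
  have shift_cell: "shift v x \<in> cell {..<r}" if "x \<in> box v" for x v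
    using that by (intro cellI) (auto simp: shift_def box_def)
  have \<Phi>_box: "\<Phi> x = f (shift v x)" if x: "x \<in> box v" for x v
  proof -
    have "collapse (shift v x) = fracs x"
    proof
      fix i
      show "collapse (shift v x) i = fracs x i"
      proof (cases "i < r")
        case True
        then have b: "of_int (v i) \<le> x i" "x i \<le> of_int (v i) + 1" using x by (auto simp: box_def)
        show ?thesis
        proof (cases "x i = of_int (v i) + 1")
          case eq: True
          have "frac (x i) = 0" unfolding eq by (simp add: frac_eq_0_iff)
          then show ?thesis using True eq by (simp add: collapse_def shift_def fracs_def)
        next
          case False
          then have "\<lfloor>x i\<rfloor> = v i" using b by (intro floor_unique) auto
          then show ?thesis using True False by (simp add: collapse_def shift_def fracs_def frac_def)
        qed
      qed (simp add: collapse_def shift_def fracs_def)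
    qed
    then show ?thesis using f(2)[unfolded sk, OF shift_cell[OF x]] by (simp add: \<Phi>_def)
  qed
  have box_floor: "x \<in> box (\<lambda>i. if i < r then \<lfloor>x i\<rfloor> else 0)" for x
  proof -
    have "x i \<le> of_int \<lfloor>x i\<rfloor> + 1" for i by linarith
    then show ?thesis by (auto simp: box_def)
  qed
  have "continuous_map euclidean X \<Phi>"
  proof (rule pasting_lemma_locally_finite[where I = Idx and T = box and f = "\<lambda>v x. f (shift v x)"])
    fix x :: "nat \<Rightarrow> real"
    define V where "V = PiE UNIV (\<lambda>i. if i < r then {x i - 1 <..< x i + 1} else UNIV)"
    have "open V"
      unfolding V_def
    proof (rule open_PiE)
      show "finite {i. (if i < r then {x i - 1 <..< x i + 1} else UNIV) \<noteq> (UNIV :: real set)}"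
        by (rule finite_subset[of _ "{..<r}"]) auto
    qed auto
    moreover have "x \<in> V" by (auto simp: V_def)
    moreover have "finite {v \<in> Idx. box v \<inter> V \<noteq> {}}"
    proof (rule finite_subset)
      define B where "B = (\<Union>i<r. {\<lfloor>x i\<rfloor> - 2 .. \<lfloor>x i\<rfloor> + 2})"
      show "finite {v :: nat \<Rightarrow> int. \<forall>i. (i \<in> {..<r} \<longrightarrow> v i \<in> B) \<and> (i \<notin> {..<r} \<longrightarrow> v i = 0)}"
        by (rule finite_set_of_finite_funs) (auto simp: B_def)
      show "{v \<in> Idx. box v \<inter> V \<noteq> {}} \<subseteq> {v. \<forall>i. (i \<in> {..<r} \<longrightarrow> v i \<in> B) \<and> (i \<notin> {..<r} \<longrightarrow> v i = 0)}"
      proof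
        fix v assume "v \<in> {v \<in> Idx. box v \<inter> V \<noteq> {}}"
        then obtain y where v: "v \<in> Idx" and y: "y \<in> box v" "y \<in> V" by blast
        have "v i \<in> B" if "i < r" for i
        proof -
          have "of_int (v i) \<le> y i" "y i \<le> of_int (v i) + 1" using y(1) that by (auto simp: box_def)
          moreover have "y i \<in> {x i - 1 <..< x i + 1}" using y(2) that by (auto simp: V_def PiE_iff split: if_splits)
          ultimately have "\<lfloor>x i\<rfloor> - 2 \<le> v i" "v i \<le> \<lfloor>x i\<rfloor> + 2" by simp_all linarith+
          then show ?thesis using that by (auto simp: B_def)
        qed
        then show "v \<in> {v. \<forall>i. (i \<in> {..<r} \<longrightarrow> v i \<in> B) \<and> (i \<notin> {..<r} \<longrightarrow> v i = 0)}"
          using v by (simp add: Idx_def)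
      qed
    qed
    ultimately show "\<exists>V. openin euclidean V \<and> x \<in> V \<and> finite {v \<in> Idx. box v \<inter> V \<noteq> {}}"
      by (intro exI[of _ V]) (simp add: open_openin[symmetric])
  next
    fix v assume "v \<in> Idx"
    have "closed (box v)"
      unfolding box_def by (intro closed_Collect_all closed_Collect_imp open_Collect_const closed_coordinate closed_atLeastAtMost)
    then show "closedin euclidean (box v)" by (simp add: closed_closedin[symmetric])
    have "continuous_on (box v) (shift v)"
      unfolding shift_def
      by (rule continuous_on_coordinatewise_then_product, rule continuous_on_if_const)
         (intro continuous_on_diff coordinate_intros continuous_on_const)+
    then show "continuous_map (subtopology euclidean (box v)) X (\<lambda>x. f (shift v x))"
      using shift_cell by (intro continuous_map_set_compose[OF f(1)[unfolded sk]])
  next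
    fix v w x assume "v \<in> Idx" "w \<in> Idx" "x \<in> topspace euclidean \<inter> box v \<inter> box w"
    then show "f (shift v x) = f (shift w x)" using \<Phi>_box[of x v] \<Phi>_box[of x w] by simp
  next
    fix x :: "nat \<Rightarrow> real"
    show "\<exists>v. v \<in> Idx \<and> x \<in> box v \<and> \<Phi> x = f (shift v x)"
      using box_floor[of x] \<Phi>_box[OF box_floor[of x]]
      by (intro exI[of _ "\<lambda>i. if i < r then \<lfloor>x i\<rfloor> else 0"]) (simp add: Idx_def)
  qed
  moreover have "\<Phi> (\<lambda>j. x j + v j) = \<Phi> x" if v: "\<forall>j<r. v j \<in> \<int>" for x v
  proof -
    have "frac (x i + v i) = frac (x i)" if "i < r" for i
      using v[rule_format, OF that] by (auto elim!: Ints_cases simp: frac_def)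
    then have "fracs (\<lambda>j. x j + v j) = fracs x" by (auto simp: fracs_def)
    then show ?thesis by (simp add: \<Phi>_def)
  qed
  moreover have \<Phi>_cell: "\<Phi> y = f y" if "y \<in> cell {..<r}" for y
  proof -
    have "y \<in> box (\<lambda>_. 0)" using cellD(1)[OF that] by (auto simp: box_def)
    moreover have "shift (\<lambda>_. 0) y = y" using cellD(2)[OF that] by (auto simp: shift_def fun_eq_iff)
    ultimately show ?thesis using \<Phi>_box by metis
  qed
  have "\<Phi> (\<lambda>_. 0) = x0" using \<Phi>_cell[of "\<lambda>_. 0"] f(3) by (simp add: cell_def)
  moreover have "\<Phi> (axis_point i t) = \<gamma> i (pause t)" if "i < r" "t \<in> {0..1}" for i t
  proof -
    have "axis_point i t \<in> cell {i}" using that(2) by (auto simp: cell_singleton)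
    then have "axis_point i t \<in> cell {..<r}" using cell_mono[of "{i}" "{..<r}"] that(1) by auto
    then show ?thesis using \<Phi>_cell f(4)[OF that] by simp
  qed
  ultimately show thesis by (rule that)
qed

section \<open>Local sections and conjugate loops\<close>

text \<open>A path in the path space is a homotopy, because the unit interval is locally compact:
  near a point \<open>u\<close> the subbasic open set of the paths that map a compact neighbourhood
  \<open>K\<close> of \<open>u\<close> into \<open>V\<close> controls the values in both
  variables.\<close>

lemma path_space_evaluation:
  assumes \<sigma>: "continuous_map (top_of_set {0..1::real}) (free_path_space X) \<sigma>"
  shows "continuous_map (top_of_set ({0..1::real} \<times> {0..1::real})) X (\<lambda>z. \<sigma> (fst z) (snd z))"
proof -
  define sub where "sub K U = {f \<in> extensional {0..1}. continuous_map (top_of_set {0..1::real}) X f \<and> f ` K \<subseteq> U}"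
    for K :: "real set" and U
  have fps: "free_path_space X = topology_generated_by {sub K U | K U. compactin (top_of_set {0..1}) K \<and> openin X U}"
    by (simp add: free_path_space_def compact_open_topology_def sub_def)
  have path: "continuous_map (top_of_set {0..1}) X (\<sigma> \<tau>)" "\<sigma> \<tau> \<in> extensional {0..1}" if "\<tau> \<in> {0..1}" for \<tau>
  proof -
    have "\<sigma> \<tau> \<in> topspace (free_path_space X)"
      using \<sigma> that unfolding continuous_map_def by auto
    then obtain K U where "\<sigma> \<tau> \<in> sub K U"
      unfolding fps topology_generated_by_topspace by blast
    then show "continuous_map (top_of_set {0..1}) X (\<sigma> \<tau>)" "\<sigma> \<tau> \<in> extensional {0..1}"
      by (simp_all add: sub_def)
  qed
  have open_sub: "openin (top_of_set {0..1}) {\<tau> \<in> {0..1}. \<sigma> \<tau> \<in> sub K U}"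
    if "compactin (top_of_set {0..1}) K" "openin X U" for K U
  proof -
    have "openin (free_path_space X) (sub K U)"
      unfolding fps using that by (intro topology_generated_by_Basis) blast
    then show ?thesis using openin_continuous_map_preimage[OF \<sigma>] by simp
  qed
  show ?thesis
    unfolding continuous_map_def
  proof (intro conjI allI impI)
    show "(\<lambda>z. \<sigma> (fst z) (snd z)) \<in> topspace (top_of_set ({0..1} \<times> {0..1})) \<rightarrow> topspace X"
    proof
      fix z assume z: "z \<in> topspace (top_of_set ({0..1::real} \<times> {0..1::real}))"
      then have "fst z \<in> {0..1}" "snd z \<in> {0..1}" by (simp_all add: mem_Times_iff)
      then show "\<sigma> (fst z) (snd z) \<in> topspace X"
        using path(1)[of "fst z"] unfolding continuous_map_def by auto
    qed
    fix V assume V: "openin X V"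
    let ?S = "{z \<in> topspace (top_of_set ({0..1} \<times> {0..1})). \<sigma> (fst z) (snd z) \<in> V}"
    show "openin (top_of_set ({0..1} \<times> {0..1})) ?S"
    proof (subst openin_subopen, intro ballI)
      fix z assume "z \<in> ?S"
      then obtain \<tau> u where z: "z = (\<tau>, u)" "\<tau> \<in> {0..1}" "u \<in> {0..1}" "\<sigma> \<tau> u \<in> V"
        by (cases z) auto
      have "openin (top_of_set {0..1}) {u \<in> {0..1}. \<sigma> \<tau> u \<in> V}"
        using openin_continuous_map_preimage[OF path(1)[OF z(2)] V] by simp
      then obtain e where e: "e > 0" "cball u e \<inter> {0..1} \<subseteq> {u \<in> {0..1}. \<sigma> \<tau> u \<in> V}"
        unfolding openin_contains_cball using z(3,4) by blast
      define K where "K = cball u e \<inter> {0..1}"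
      have K: "compactin (top_of_set {0..1}) K"
        by (auto simp: K_def compactin_subtopology compact_Int)
      let ?T = "{\<tau> \<in> {0..1}. \<sigma> \<tau> \<in> sub K V} \<times> ({0..1} \<inter> ball u e)"
      have "openin (top_of_set ({0..1} \<times> {0..1})) ?T"
        by (intro openin_Times open_sub[OF K V] openin_open_Int open_ball)
      moreover have "z \<in> ?T"
        using z e path[OF z(2)] by (auto simp: sub_def K_def)
      moreover have "?T \<subseteq> ?S"
        by (auto simp: sub_def K_def)
      ultimately show "\<exists>T. openin (top_of_set ({0..1} \<times> {0..1})) T \<and> z \<in> T \<and> T \<subseteq> ?S" by blast
    qed
  qed
qed

text \<open>If \<open>F\<close> is periodic and \<open>v\<close> an integer vector, this is the loop
  that \<open>v\<close> represents in the fundamental group.\<close>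

definition ray :: "((nat \<Rightarrow> real) \<Rightarrow> 'a) \<Rightarrow> (nat \<Rightarrow> real) \<Rightarrow> real \<Rightarrow> 'a" where
  "ray F v t = F (\<lambda>i. t * v i)"

lemma loop_homotopic_cong:
  assumes "loop_homotopic X x0 g h" "\<And>t. t \<in> {0..1} \<Longrightarrow> g t = g' t" "\<And>t. t \<in> {0..1} \<Longrightarrow> h t = h' t"
  shows "loop_homotopic X x0 g' h'"
proof -
  obtain H where H: "continuous_map (top_of_set ({0..1::real} \<times> {0..1::real})) X H"
    "\<forall>u\<in>{0..1}. H (0, u) = g u \<and> H (1, u) = h u" "\<forall>s\<in>{0..1}. H (s, 0) = x0 \<and> H (s, 1) = x0"
    using assms(1) unfolding loop_homotopic_def by blast
  then have "\<forall>u\<in>{0..1}. H (0, u) = g' u \<and> H (1, u) = h' u" using assms(2,3) by simp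
  with H(1,3) show ?thesis unfolding loop_homotopic_def by blast
qed

lemma loop_concat_cong:
  assumes "\<And>t. t \<in> {0..1} \<Longrightarrow> g t = g' t" "\<And>t. t \<in> {0..1} \<Longrightarrow> h t = h' t" "t \<in> {0..1}"
  shows "loop_concat g h t = loop_concat g' h' t"
  using assms by (auto simp: loop_concat_def)

lemma continuous_map_plane:
  assumes F: "continuous_map euclidean X F" and u: "\<And>i. continuous_on A (\<lambda>z. u z i)"
  shows "continuous_map (top_of_set A) X (\<lambda>z. F (u z))"
proof -
  have "continuous_map (top_of_set UNIV) X F" using F by simp
  moreover have "continuous_on A u" using u by (rule continuous_on_coordinatewise_then_product)
  ultimately show ?thesis by (rule continuous_map_set_compose) simp
qed

lemma ray_loop:
  assumes F: "continuous_map euclidean X F" "F (\<lambda>_. 0) = x0" and "F v = x0"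
  shows "loop_at X x0 (ray F v)"
proof -
  have "continuous_map (top_of_set {0..1}) X (ray F v)"
    unfolding ray_def by (rule continuous_map_plane[OF F(1)]) (intro continuous_intros)
  then show ?thesis using assms by (simp add: loop_at_def ray_def)
qed

text \<open>Both loops are images of paths in the plane spanned by \<open>v\<close> and
  \<open>w\<close>.\<close>

lemma ray_concat:
  assumes F: "continuous_map euclidean X F" "F (\<lambda>_. 0) = x0"
    and per: "\<And>x. F (\<lambda>i. x i + v i) = F x" "\<And>x. F (\<lambda>i. x i + w i) = F x"
  shows "loop_homotopic X x0 (loop_concat (ray F v) (ray F w)) (ray F (\<lambda>i. v i + w i))"
proof -
  define \<Theta> where "\<Theta> z = F (\<lambda>i. fst z * v i + snd z * w i)" for z :: "real \<times> real"
  define p where "p t = (min 1 (2 * t), max 0 (2 * t - 1))" for t :: real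
  define q where "q t = (t, t)" for t :: real
  have "loop_homotopic X x0 (\<lambda>t. \<Theta> (p t)) (\<lambda>t. \<Theta> (q t))"
  proof (rule convex_loop_homotopic)
    show "continuous_map (top_of_set (UNIV :: (real \<times> real) set)) X \<Theta>"
      unfolding \<Theta>_def by (rule continuous_map_plane[OF F(1)]) (intro continuous_intros)
    show "continuous_on {0..1} p" "continuous_on {0..1} q"
      unfolding p_def q_def by (intro continuous_intros)+
    show "\<Theta> (p 0) = x0" using F(2) by (simp add: \<Theta>_def p_def)
    have "F (\<lambda>i. 0 + v i) = x0" using per(1)[of "\<lambda>_. 0"] F(2) by simp
    then show "\<Theta> (p 1) = x0" using per(2)[of v] by (simp add: \<Theta>_def p_def)
  qed (simp_all add: p_def q_def)
  moreover have "(\<lambda>t. \<Theta> (p t)) = loop_concat (ray F v) (ray F w)"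
  proof
    fix t
    show "\<Theta> (p t) = loop_concat (ray F v) (ray F w) t"
    proof (cases "t \<le> 1/2")
      case True
      then have "p t = (2 * t, 0)" by (simp add: p_def)
      then show ?thesis using True by (simp add: \<Theta>_def loop_concat_def ray_def)
    next
      case False
      then have "p t = (1, 2 * t - 1)" by (simp add: p_def)
      then have "\<Theta> (p t) = F (\<lambda>i. (2 * t - 1) * w i + v i)" by (simp add: \<Theta>_def add.commute)
      then show ?thesis using False per(1)[of "\<lambda>i. (2 * t - 1) * w i"] by (simp add: loop_concat_def ray_def)
    qed
  qed
  moreover have "(\<lambda>t. \<Theta> (q t)) = ray F (\<lambda>i. v i + w i)"
    by (simp add: \<Theta>_def q_def ray_def distrib_left fun_eq_iff)
  ultimately show ?thesis by simp
qed

text \<open>The map \<open>K\<close> is a free homotopy from the loop \<open>F \<circ>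
  \<omega>\<close> to the loop \<open>F' \<circ> \<omega>\<close>. The path \<open>\<omega>\<close>
  leads from some point to its translate by \<open>v\<close> and is homotopic to the straight path
  from \<open>0\<close> to \<open>v\<close> through such paths, which extends the cylinder
  \<open>K\<close> at both ends to one between the two rays. The line traced by the base points on
  the cylinder is a conjugating loop.\<close>

lemma conjugate_rays:
  assumes F: "continuous_map euclidean X F" "F (\<lambda>_. 0) = x0" "\<And>x. F (\<lambda>i. x i + v i) = F x"
    and F': "continuous_map euclidean X F'" "F' (\<lambda>_. 0) = x0" "\<And>x. F' (\<lambda>i. x i + v i) = F' x"
    and \<omega>: "continuous_on {0..1} \<omega>" "\<omega> 1 = (\<lambda>i. \<omega> 0 i + v i)"
    and K: "continuous_map (top_of_set ({0..1::real} \<times> {0..1::real})) X K"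
      "\<And>\<tau>. \<tau> \<in> {0..1} \<Longrightarrow> K (0, \<tau>) = F (\<omega> \<tau>) \<and> K (1, \<tau>) = F' (\<omega> \<tau>)"
      "\<And>u. u \<in> {0..1} \<Longrightarrow> K (u, 0) = K (u, 1)"
  obtains c where "loop_at X x0 c"
    "loop_homotopic X x0 (loop_concat (ray F v) c) (loop_concat c (ray F' v))"
proof -
  \<comment> \<open>the two extensions of the cylinder: from the ray to \<open>F \<circ>
    \<omega>\<close>, and from \<open>F' \<circ> \<omega>\<close> to the ray\<close>
  define A where "A z = F (\<lambda>i. fst z * \<omega> (snd z) i + (1 - fst z) * (snd z * v i))" for z
  define B where "B z = F' (\<lambda>i. (1 - fst z) * \<omega> (snd z) i + fst z * (snd z * v i))" for z
  have \<omega>_cont: "continuous_on ({0..1::real} \<times> {0..1::real}) (\<lambda>z. \<omega> (snd z) i)" for i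
    using continuous_on_product_then_coordinatewise[OF \<omega>(1), of i]
    by (rule continuous_on_compose2) (auto intro: continuous_on_snd continuous_on_id)
  have A: "continuous_map (top_of_set ({0..1::real} \<times> {0..1::real})) X A"
    unfolding A_def by (rule continuous_map_plane[OF F(1)]) (intro continuous_intros \<omega>_cont)
  have B: "continuous_map (top_of_set ({0..1::real} \<times> {0..1::real})) X B"
    unfolding B_def by (rule continuous_map_plane[OF F'(1)]) (intro continuous_intros \<omega>_cont)
  have \<omega>1: "\<omega> 1 i = \<omega> 0 i + v i" for i using \<omega>(2) by (rule fun_cong)
  have A_sym: "A (u, 0) = A (u, 1)" for u
  proof -
    have "A (u, 1) = F (\<lambda>i. u * \<omega> 0 i + v i)"
      by (simp add: A_def \<omega>1 algebra_simps)
    then show ?thesis using F(3)[of "\<lambda>i. u * \<omega> 0 i"] by (simp add: A_def)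
  qed
  have B_sym: "B (u, 0) = B (u, 1)" for u
  proof -
    have "B (u, 1) = F' (\<lambda>i. (1 - u) * \<omega> 0 i + v i)"
      by (simp add: B_def \<omega>1 algebra_simps)
    then show ?thesis using F'(3)[of "\<lambda>i. (1 - u) * \<omega> 0 i"] by (simp add: B_def)
  qed
  define M1 where "M1 z = (if fst z \<le> 1/2 then K (2 * fst z, snd z) else B (2 * fst z - 1, snd z))" for z
  define M where "M z = (if fst z \<le> 1/2 then A (2 * fst z, snd z) else M1 (2 * fst z - 1, snd z))" for z
  have M1: "continuous_map (top_of_set ({0..1::real} \<times> {0..1::real})) X M1"
    unfolding M1_def by (rule continuous_map_glue_homotopies[OF K(1) B]) (simp add: B_def K(2))
  have M: "continuous_map (top_of_set ({0..1::real} \<times> {0..1::real})) X M"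
    unfolding M_def by (rule continuous_map_glue_homotopies[OF A M1]) (simp add: A_def M1_def K(2))
  have M1_sym: "M1 (u, 0) = M1 (u, 1)" if "u \<in> {0..1}" for u
    using K(3)[of "2 * u"] B_sym that by (simp add: M1_def)
  have M_sym: "M (u, 0) = M (u, 1)" if "u \<in> {0..1}" for u
    using M1_sym[of "2 * u - 1"] A_sym that by (simp add: M_def)
  have M0: "M (0, \<tau>) = ray F v \<tau>" for \<tau> by (simp add: M_def A_def ray_def)
  have M1': "M (1, \<tau>) = ray F' v \<tau>" for \<tau> by (simp add: M_def M1_def B_def ray_def)
  define c where "c u = M (u, 0)" for u
  have "continuous_map (top_of_set {0..1}) X c"
    unfolding c_def by (rule continuous_map_set_compose[OF M]) (auto intro!: continuous_intros)
  moreover have "c 0 = x0" "c 1 = x0"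
    using M0[of 0] M1'[of 0] F(2) F'(2) by (simp_all add: c_def ray_def)
  ultimately have c: "loop_at X x0 c" by (simp add: loop_at_def)
  define \<Theta> where "\<Theta> z = M (snd z, fst z)" for z
  have "continuous_on ({0..1::real} \<times> {0..1::real}) (\<lambda>z. (snd z, fst z))" by (intro continuous_intros)
  then have "continuous_map (top_of_set ({0..1::real} \<times> {0..1::real})) X \<Theta>"
    unfolding \<Theta>_def by (rule continuous_map_set_compose[OF M]) auto
  moreover have "\<Theta> (0, 0) = x0" using \<open>c 0 = x0\<close> by (simp add: \<Theta>_def c_def)
  moreover have "\<Theta> (1, 1) = x0" using \<open>c 1 = x0\<close> M_sym[of 1] by (simp add: \<Theta>_def c_def)
  ultimately have "loop_homotopic X x0 (loop_concat (\<lambda>t. \<Theta> (t, 0)) (\<lambda>t. \<Theta> (1, t)))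
     (loop_concat (\<lambda>t. \<Theta> (0, t)) (\<lambda>t. \<Theta> (t, 1)))"
    by (rule square_boundary_homotopic)
  then have "loop_homotopic X x0 (loop_concat (ray F v) c) (loop_concat c (ray F' v))"
  proof (rule loop_homotopic_cong)
    show "loop_concat (\<lambda>t. \<Theta> (t, 0)) (\<lambda>t. \<Theta> (1, t)) t = loop_concat (ray F v) c t" if "t \<in> {0..1}" for t
      by (rule loop_concat_cong[OF _ _ that]) (simp_all add: \<Theta>_def M0 c_def M_sym)
    show "loop_concat (\<lambda>t. \<Theta> (0, t)) (\<lambda>t. \<Theta> (t, 1)) t = loop_concat c (ray F' v) t" if "t \<in> {0..1}" for t
      by (rule loop_concat_cong[OF _ _ that]) (simp_all add: \<Theta>_def M1' c_def)
  qed
  with c show thesis by (rule that)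
qed

section \<open>Tori of planetary braids\<close>

text \<open>The third case undoes a step, which gives access to negative coordinates without an
  inverse of loops.\<close>

lemma int_vectors_induct [consumes 1, case_names zero plus minus]:
  assumes v: "v \<in> int_vectors r"
    and zero: "Q (\<lambda>_. 0)"
    and plus: "\<And>v l. l < r \<Longrightarrow> v \<in> int_vectors r \<Longrightarrow> Q v \<Longrightarrow> Q (\<lambda>i. v i + axis_point l 1 i)"
    and minus: "\<And>v l. l < r \<Longrightarrow> v \<in> int_vectors r \<Longrightarrow> Q (\<lambda>i. v i + axis_point l 1 i) \<Longrightarrow> Q v"
  shows "Q v"
proof -
  have axis: "(\<lambda>i. w i + axis_point l (of_int z) i) \<in> int_vectors r" if "w \<in> int_vectors r" "l < r" for w l z
    using that by (auto simp: int_vectors_def axis_point_def)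
  have step: "Q (\<lambda>i. w i + axis_point l (of_int z) i)" if w: "w \<in> int_vectors r" "l < r" "Q w" for w l z
  proof (induction z rule: int_induct[where k = 0])
    case base
    have "(\<lambda>i. w i + axis_point l (of_int 0) i) = w" by (auto simp: axis_point_def)
    then show ?case using w(3) by simp
  next
    case (step1 z)
    from plus[OF w(2) axis[OF w(1,2), of z] step1(2)]
    have "Q (\<lambda>i. w i + axis_point l (of_int z) i + axis_point l 1 i)" .
    moreover have "(\<lambda>i. w i + axis_point l (of_int z) i + axis_point l 1 i) = (\<lambda>i. w i + axis_point l (of_int (z + 1)) i)"
      by (auto simp: axis_point_def)
    ultimately show ?case by simp
  next
    case (step2 z)
    have "(\<lambda>i. w i + axis_point l (of_int (z - 1)) i + axis_point l 1 i) = (\<lambda>i. w i + axis_point l (of_int z) i)"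
      by (auto simp: axis_point_def)
    then show ?case using minus[OF w(2) axis[OF w(1,2), of "z - 1"]] step2(2) by simp
  qed
  have "Q (\<lambda>i. if i < r' then v i else 0)" if "r' \<le> r" for r'
    using that
  proof (induction r')
    case (Suc r')
    let ?w = "\<lambda>i. if i < r' then v i else 0"
    have w: "?w \<in> int_vectors r" using v by (auto simp: int_vectors_def)
    have "v r' \<in> \<int>" using v Suc.prems by (simp add: int_vectors_def)
    then obtain z where z: "v r' = of_int z" by (rule Ints_cases) (rule that)
    have "Q (\<lambda>i. ?w i + axis_point r' (of_int z) i)"
      using step[OF w, of r' z] Suc by simp
    moreover have "(\<lambda>i. ?w i + axis_point r' (of_int z) i) = (\<lambda>i. if i < Suc r' then v i else 0)"
      using z by (auto simp: axis_point_def fun_eq_iff less_Suc_eq)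
    ultimately show ?case by simp
  qed (use zero in simp)
  from this[OF order_refl] have "Q (\<lambda>i. if i < r then v i else 0)" .
  moreover have "(\<lambda>i. if i < r then v i else 0) = v" using v by (auto simp: int_vectors_def)
  ultimately show ?thesis by simp
qed

text \<open>The isomorphism \<open>\<phi>\<close> transports permutations and linking numbers of
  braids to the loops of the space.\<close>

locale aspherical_braid_space =
  fixes n :: nat and G :: "(nat \<Rightarrow> nat) set" and X :: "'x topology" and x0 :: 'x
    and \<phi> :: "((nat \<Rightarrow> real) \<Rightarrow> 'x) set \<Rightarrow> (nat \<Rightarrow> real \<Rightarrow> complex) set"
  assumes G: "subgroup G (sym_group n)"
    and x0: "x0 \<in> topspace X"
    and \<phi>: "\<phi> \<in> iso (homotopy_group 1 X x0) (braid_subgroup n G)"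
    and asph: "\<And>k. k \<ge> 2 \<Longrightarrow> trivial_group (homotopy_group k X x0)"
begin

definition braid_of :: "(real \<Rightarrow> 'x) \<Rightarrow> (nat \<Rightarrow> real \<Rightarrow> complex) set" where
  "braid_of g = \<phi> (loop_class X x0 g)"

definition perm_of :: "(real \<Rightarrow> 'x) \<Rightarrow> nat \<Rightarrow> nat" where
  "perm_of g = braid_proj n (braid_of g)"

definition link_of :: "(real \<Rightarrow> 'x) \<Rightarrow> nat \<Rightarrow> nat \<Rightarrow> complex" where
  "link_of g = class_winding (braid_of g)"

lemma braid_of_carrier:
  assumes "loop_at X x0 g"
  shows "braid_of g \<in> carrier (braid_subgroup n G)" "braid_of g \<in> carrier (braid_group n)" "perm_of g \<in> G"
proof -
  have "\<phi> ` carrier (homotopy_group 1 X x0) = carrier (braid_subgroup n G)"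
    using \<phi> by (auto simp: iso_def bij_betw_def)
  then show c: "braid_of g \<in> carrier (braid_subgroup n G)"
    unfolding braid_of_def using loop_class_carrier[OF assms] by blast
  from c show "braid_of g \<in> carrier (braid_group n)" "perm_of g \<in> G"
    by (simp_all add: braid_subgroup_def perm_of_def)
qed

lemma perm_of_permutes: "loop_at X x0 g \<Longrightarrow> perm_of g permutes {1..n}"
  using braid_of_carrier(3) subgroup.subset[OF G] by (auto simp: sym_group_def)

lemma braid_of_concat:
  assumes "loop_at X x0 g" "loop_at X x0 h"
  shows "braid_of (loop_concat g h) = braid_of g \<otimes>\<^bsub>braid_group n\<^esub> braid_of h"
proof -
  have "braid_of (loop_concat g h) = \<phi> (loop_class X x0 g \<otimes>\<^bsub>homotopy_group 1 X x0\<^esub> loop_class X x0 h)"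
    by (simp add: braid_of_def loop_class_mult[OF assms])
  also have "\<dots> = braid_of g \<otimes>\<^bsub>braid_subgroup n G\<^esub> braid_of h"
    unfolding braid_of_def
    by (rule hom_mult[OF iso_imp_homomorphism[OF \<phi>] loop_class_carrier[OF assms(1)] loop_class_carrier[OF assms(2)]])
  finally show ?thesis by (simp add: braid_subgroup_def)
qed

lemma braid_of_eq_iff:
  assumes "loop_at X x0 g" "loop_at X x0 h"
  shows "braid_of g = braid_of h \<longleftrightarrow> loop_homotopic X x0 g h"
proof -
  have "inj_on \<phi> (carrier (homotopy_group 1 X x0))"
    using \<phi> by (auto simp: iso_def bij_betw_def)
  then have "braid_of g = braid_of h \<longleftrightarrow> loop_class X x0 g = loop_class X x0 h"
    unfolding braid_of_def using loop_class_carrier[OF assms(1)] loop_class_carrier[OF assms(2)]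
    by (rule inj_on_eq_iff)
  then show ?thesis using loop_class_eq_iff[OF assms] by simp
qed

lemma braid_of_surj:
  assumes "A \<in> carrier (braid_subgroup n G)"
  obtains g where "loop_at X x0 g" "braid_of g = A"
proof -
  have "\<phi> ` carrier (homotopy_group 1 X x0) = carrier (braid_subgroup n G)"
    using \<phi> by (auto simp: iso_def bij_betw_def)
  then obtain B where B: "B \<in> carrier (homotopy_group 1 X x0)" "\<phi> B = A" using assms by (metis imageE)
  obtain g where g: "loop_at X x0 g" "B = loop_class X x0 g" by (rule loop_class_exists[OF B(1)]) (rule that)
  have "braid_of g = A" using g(2) B(2) by (simp add: braid_of_def)
  with g(1) show thesis by (rule that)
qed

lemma invariants_concat:
  assumes g: "loop_at X x0 g" and h: "loop_at X x0 h"
  shows "perm_of (loop_concat g h) = perm_of g \<circ> perm_of h"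
    "\<lbrakk>i \<in> {1..n}; j \<in> {1..n}; i \<noteq> j\<rbrakk> \<Longrightarrow> link_of (loop_concat g h) i j =
       link_of h i j + link_of g (perm_of h i) (perm_of h j)"
proof -
  note c = braid_of_carrier(2)[OF loop_at_concat[OF g h], unfolded braid_of_concat[OF g h]]
  note m = mult_invariants[OF braid_of_carrier(2)[OF g] braid_of_carrier(2)[OF h] c]
  show "perm_of (loop_concat g h) = perm_of g \<circ> perm_of h"
    unfolding perm_of_def braid_of_concat[OF g h] by (rule m(1))
  show "link_of (loop_concat g h) i j = link_of h i j + link_of g (perm_of h i) (perm_of h j)"
    if "i \<in> {1..n}" "j \<in> {1..n}" "i \<noteq> j"
    unfolding perm_of_def link_of_def braid_of_concat[OF g h] by (rule m(2)[OF that])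
qed

lemma invariants_homotopic:
  assumes "loop_homotopic X x0 g h"
  shows "perm_of g = perm_of h" "link_of g = link_of h"
  using loop_at_homotopic[OF assms] braid_of_eq_iff[of g h] assms by (simp_all add: perm_of_def link_of_def)

text \<open>The conjugating loop contributes the same winding number on both sides, because
  \<open>b\<close> is pure.\<close>

lemma linking_conjugate:
  assumes a: "loop_at X x0 a" and b: "loop_at X x0 b" and c: "loop_at X x0 c"
    and conj: "loop_homotopic X x0 (loop_concat a c) (loop_concat c b)"
    and pure: "perm_of b = id"
    and ij: "i \<in> {1..n}" "j \<in> {1..n}" "i \<noteq> j"
  shows "link_of b i j = link_of a (perm_of c i) (perm_of c j)"
proof -
  have "link_of (loop_concat a c) i j = link_of (loop_concat c b) i j"
    using invariants_homotopic(2)[OF conj] by simp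
  then show ?thesis
    using invariants_concat(2)[OF a c ij] invariants_concat(2)[OF c b ij] pure by simp
qed

definition outer :: "nat \<Rightarrow> nat \<Rightarrow> nat \<Rightarrow> nat" where
  "outer c i j = (if \<bar>real j - real c\<bar> < \<bar>real i - real c\<bar> then i else j)"

text \<open>Planetary braids in which only the point \<open>s l\<close> revolves, once, commute and
  so span a torus. The winding numbers of its rays are additive and hence known from those of the
  generators.\<close>

proposition planetary_torus:
  assumes c: "inj_on (\<lambda>i. \<bar>real i - real c\<bar>) {1..n}"
  obtains \<Phi> where "continuous_map euclidean X \<Phi>"
    "\<And>x v. \<forall>j<r. v j \<in> \<int> \<Longrightarrow> \<Phi> (\<lambda>j. x j + v j) = \<Phi> x"
    "\<Phi> (\<lambda>_. 0) = x0"
    "\<And>v. \<forall>j<r. v j \<in> \<int> \<Longrightarrow> perm_of (ray \<Phi> v) = id"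
    "\<And>v i j. \<forall>j<r. v j \<in> \<int> \<Longrightarrow> i \<in> {1..n} \<Longrightarrow> j \<in> {1..n} \<Longrightarrow> i \<noteq> j \<Longrightarrow>
       link_of (ray \<Phi> v) i j = of_real (\<Sum>l<r. if outer c i j = s l then v l else 0)"
proof -
  define \<theta> where "\<theta> l t i = (if i = s l then t else 0 :: real)" for l :: nat and t :: real and i :: nat
  have \<theta>: "winding_path n (\<theta> l)" for l
    unfolding winding_path_def \<theta>_def by (auto intro!: continuous_on_if_const continuous_on_id continuous_on_const)
  define A where "A l = braid_class n (planetary_braid c (\<theta> l))" for l
  have "id \<in> G" using subgroup.one_closed[OF G] by (simp add: sym_group_def)
  then have A_carrier: "A l \<in> carrier (braid_subgroup n G)" for l
    using planetary_class(2,3)[OF c \<theta>[of l]] by (simp add: braid_subgroup_def A_def)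
  define \<gamma> where "\<gamma> l = (SOME g. loop_at X x0 g \<and> braid_of g = A l)" for l
  have \<gamma>: "loop_at X x0 (\<gamma> l)" "braid_of (\<gamma> l) = A l" for l
  proof -
    have "\<exists>g. loop_at X x0 g \<and> braid_of g = A l" using braid_of_surj[OF A_carrier[of l]] by blast
    then have "loop_at X x0 (\<gamma> l) \<and> braid_of (\<gamma> l) = A l" unfolding \<gamma>_def by (rule someI_ex)
    then show "loop_at X x0 (\<gamma> l)" "braid_of (\<gamma> l) = A l" by simp_all
  qed
  have comm: "loop_homotopic X x0 (loop_concat (\<gamma> k) (\<gamma> l)) (loop_concat (\<gamma> l) (\<gamma> k))" for k l
  proof -
    note kl = loop_at_concat[OF \<gamma>(1) \<gamma>(1), of k l] loop_at_concat[OF \<gamma>(1) \<gamma>(1), of l k]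
    have "A k \<otimes>\<^bsub>braid_group n\<^esub> A l \<in> carrier (braid_group n)" "A l \<otimes>\<^bsub>braid_group n\<^esub> A k \<in> carrier (braid_group n)"
      using braid_of_carrier(2)[OF kl(1)] braid_of_carrier(2)[OF kl(2)] by (simp_all add: braid_of_concat \<gamma>)
    then have "A k \<otimes>\<^bsub>braid_group n\<^esub> A l = A l \<otimes>\<^bsub>braid_group n\<^esub> A k"
      by (rule planetary_commute[OF c \<theta> \<theta> A_def A_def])
    then show ?thesis
      using braid_of_eq_iff[OF kl] by (simp add: braid_of_concat \<gamma>)
  qed
  obtain \<Phi> where \<Phi>: "continuous_map euclidean X \<Phi>"
    "\<And>x v. \<forall>j<r. v j \<in> \<int> \<Longrightarrow> \<Phi> (\<lambda>j. x j + v j) = \<Phi> x"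
    "\<Phi> (\<lambda>_. 0) = x0"
    "\<And>i t. i < r \<Longrightarrow> t \<in> {0..1} \<Longrightarrow> \<Phi> (axis_point i t) = \<gamma> i (pause t)"
    by (rule periodic_map_exists[of X x0 r \<gamma>, OF asph x0 \<gamma>(1) comm]) (assumption, rule that)
  have per: "\<Phi> (\<lambda>j. x j + v j) = \<Phi> x" if "v \<in> int_vectors r" for x v
    using \<Phi>(2)[of v x] that by (simp add: int_vectors_def)
  have ray_at: "loop_at X x0 (ray \<Phi> v)" if "v \<in> int_vectors r" for v
    using per[OF that, of "\<lambda>_. 0"] by (intro ray_loop \<Phi>(1,3)) (simp add: \<Phi>(3))
  define e where "e l = axis_point l 1" for l
  have e: "e l \<in> int_vectors r" if "l < r" for l
    using that by (auto simp: int_vectors_def e_def axis_point_def)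
  have ray_e: "perm_of (ray \<Phi> (e l)) = id"
    "\<lbrakk>i \<in> {1..n}; j \<in> {1..n}; i \<noteq> j\<rbrakk> \<Longrightarrow> link_of (ray \<Phi> (e l)) i j = (if outer c i j = s l then 1 else 0)"
    if l: "l < r" for l i j
  proof -
    have "loop_homotopic X x0 (\<gamma> l) (ray \<Phi> (e l))"
    proof (rule loop_homotopic_cong[OF pause_homotopic[OF \<gamma>(1)[of l]] refl])
      fix t :: real assume t: "t \<in> {0..1}"
      have "(\<lambda>i. t * e l i) = axis_point l t" by (simp add: e_def axis_point_def fun_eq_iff)
      then show "\<gamma> l (pause t) = ray \<Phi> (e l) t" using \<Phi>(4)[OF l t] by (simp add: ray_def)
    qed
    note hom_inv = invariants_homotopic[OF this]
    show "perm_of (ray \<Phi> (e l)) = id"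
      using hom_inv(1) planetary_class(3)[OF c \<theta>[of l]] by (simp add: perm_of_def \<gamma> A_def)
    show "link_of (ray \<Phi> (e l)) i j = (if outer c i j = s l then 1 else 0)"
      if "i \<in> {1..n}" "j \<in> {1..n}" "i \<noteq> j"
      using hom_inv(2) planetary_class(4)[OF c \<theta>[of l] that]
      by (simp add: link_of_def \<gamma> A_def outer_def \<theta>_def)
  qed
  define val where "val v i j = complex_of_real (\<Sum>l<r. if outer c i j = s l then v l else 0)" for v i j
  have val_e: "val (\<lambda>p. v p + e l p) i j = val v i j + (if outer c i j = s l then 1 else 0)" if "l < r" for v l i j
  proof -
    have "(\<Sum>k<r. if outer c i j = s k then v k + e l k else 0) =
        (\<Sum>k<r. if outer c i j = s k then v k else 0) + (\<Sum>k<r. if k = l then (if outer c i j = s l then 1 else 0) else 0)"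
      unfolding sum.distrib[symmetric] by (rule sum.cong) (auto simp: e_def axis_point_def)
    then show ?thesis using that by (simp add: val_def)
  qed
  have main: "perm_of (ray \<Phi> v) = id \<and> (\<forall>i\<in>{1..n}. \<forall>j\<in>{1..n}. i \<noteq> j \<longrightarrow> link_of (ray \<Phi> v) i j = val v i j)"
    if "v \<in> int_vectors r" for v
    using that
  proof (induction rule: int_vectors_induct)
    case zero
    have z: "(\<lambda>_. 0) \<in> int_vectors r" by (simp add: int_vectors_def)
    note l0 = ray_at[OF z]
    have "loop_homotopic X x0 (loop_concat (ray \<Phi> (\<lambda>_. 0)) (ray \<Phi> (\<lambda>_. 0))) (ray \<Phi> (\<lambda>_. 0))"
      using ray_concat[OF \<Phi>(1,3) per[OF z] per[OF z]] by simp
    note hom_inv = invariants_homotopic[OF this]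
    have "perm_of (ray \<Phi> (\<lambda>_. 0)) \<circ> perm_of (ray \<Phi> (\<lambda>_. 0)) = perm_of (ray \<Phi> (\<lambda>_. 0))"
      using hom_inv(1) invariants_concat(1)[OF l0 l0] by simp
    moreover have "inj (perm_of (ray \<Phi> (\<lambda>_. 0)))" by (rule permutes_inj[OF perm_of_permutes[OF l0]])
    ultimately have p: "perm_of (ray \<Phi> (\<lambda>_. 0)) = id"
      by (auto simp: fun_eq_iff dest: injD)
    moreover have "link_of (ray \<Phi> (\<lambda>_. 0)) i j = val (\<lambda>_. 0) i j" if "i \<in> {1..n}" "j \<in> {1..n}" "i \<noteq> j" for i j
      using invariants_concat(2)[OF l0 l0 that] hom_inv(2) p by (simp add: val_def)
    ultimately show ?case by blast
  next
    case (plus v l)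
    have w: "loop_homotopic X x0 (loop_concat (ray \<Phi> v) (ray \<Phi> (e l))) (ray \<Phi> (\<lambda>i. v i + e l i))"
      by (rule ray_concat[OF \<Phi>(1,3) per[OF plus(2)] per[OF e[OF plus(1)]]])
    note hom_inv = invariants_homotopic[OF w] and cat = invariants_concat[OF ray_at[OF plus(2)] ray_at[OF e[OF plus(1)]]]
    show ?case
      using hom_inv cat plus(3) ray_e[OF plus(1)] val_e[OF plus(1)] unfolding e_def[symmetric] by simp
  next
    case (minus v l)
    have w: "loop_homotopic X x0 (loop_concat (ray \<Phi> v) (ray \<Phi> (e l))) (ray \<Phi> (\<lambda>i. v i + e l i))"
      by (rule ray_concat[OF \<Phi>(1,3) per[OF minus(2)] per[OF e[OF minus(1)]]])
    note hom_inv = invariants_homotopic[OF w] and cat = invariants_concat[OF ray_at[OF minus(2)] ray_at[OF e[OF minus(1)]]]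
    note IH = minus(3)[folded e_def]
    have p: "perm_of (ray \<Phi> v) = id"
    proof -
      have "perm_of (ray \<Phi> v) \<circ> perm_of (ray \<Phi> (e l)) = id"
        by (rule trans[OF cat(1)[symmetric] trans[OF hom_inv(1) conjunct1[OF IH]]])
      then show ?thesis unfolding ray_e(1)[OF minus(1)] comp_id .
    qed
    moreover have "link_of (ray \<Phi> v) i j = val v i j" if ij: "i \<in> {1..n}" "j \<in> {1..n}" "i \<noteq> j" for i j
    proof -
      have "link_of (ray \<Phi> (\<lambda>i. v i + e l i)) i j = val (\<lambda>i. v i + e l i) i j" using IH ij by blast
      then show ?thesis
        using hom_inv(2) cat(2)[OF ij] ray_e(1)[OF minus(1)] ray_e(2)[OF minus(1) ij] val_e[OF minus(1), of v i j] by simp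
    qed
    ultimately show ?case by blast
  qed
  have trunc: "ray \<Phi> v = ray \<Phi> (\<lambda>i. if i < r then v i else 0)" for v
  proof
    fix t
    have "\<Phi> (\<lambda>i. t * (if i < r then v i else 0) + (if i < r then 0 else t * v i)) = \<Phi> (\<lambda>i. t * (if i < r then v i else 0))"
      by (rule \<Phi>(2)) simp
    moreover have "(\<lambda>i. t * (if i < r then v i else 0) + (if i < r then 0 else t * v i)) = (\<lambda>i. t * v i)" by auto
    ultimately show "ray \<Phi> v t = ray \<Phi> (\<lambda>i. if i < r then v i else 0) t" by (simp add: ray_def)
  qed
  have trunc_int: "(\<lambda>i. if i < r then v i else 0) \<in> int_vectors r" if "\<forall>j<r. v j \<in> \<int>" for v
    using that by (auto simp: int_vectors_def)
  show thesis
  proof (rule that[of \<Phi>])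
    show "perm_of (ray \<Phi> v) = id" if v: "\<forall>j<r. v j \<in> \<int>" for v
      unfolding trunc[of v] using main[OF trunc_int[OF v]] by blast
    show "link_of (ray \<Phi> v) i j = of_real (\<Sum>l<r. if outer c i j = s l then v l else 0)"
      if v: "\<forall>j<r. v j \<in> \<int>" and ij: "i \<in> {1..n}" "j \<in> {1..n}" "i \<noteq> j" for v i j
    proof -
      have "link_of (ray \<Phi> v) i j = val (\<lambda>i. if i < r then v i else 0) i j"
        unfolding trunc[of v] using main[OF trunc_int[OF v]] ij by blast
      also have "\<dots> = of_real (\<Sum>l<r. if outer c i j = s l then v l else 0)"
        unfolding val_def by (intro arg_cong[of _ _ of_real] sum.cong) auto
      finally show ?thesis .
    qed
  qed (fact \<Phi>(1-3))+
qed

end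

section \<open>The lower bound\<close>

context aspherical_braid_space
begin

lemma outer_last: "i \<le> n \<Longrightarrow> j \<le> n \<Longrightarrow> outer n i j = min i j"
  by (auto simp: outer_def min_def)

lemma outer_first: "1 \<le> i \<Longrightarrow> 1 \<le> j \<Longrightarrow> outer 1 i j = max i j"
  by (auto simp: outer_def max_def)

lemma sum_single:
  fixes p q r :: nat and v :: "nat \<Rightarrow> real"
  shows "(\<Sum>l<r. if p = l + q then v l else 0) = (if q \<le> p \<and> p < q + r then v (p - q) else 0)"
proof -
  have "(\<Sum>l<r. if p = l + q then v l else 0) = (\<Sum>l<r. if l = p - q then (if q \<le> p then v l else 0) else 0)"
    by (rule sum.cong) auto
  also have "\<dots> = (if p - q < r then if q \<le> p then v (p - q) else 0 else 0)"
    by (simp only: sum.delta[OF finite_lessThan] lessThan_iff)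
  finally show ?thesis by auto
qed

text \<open>The torus \<open>\<Phi>\<close> has the centre \<open>n\<close> and all the other points
  revolve; the torus \<open>\<Psi>\<close> has the centre \<open>1\<close> and only the points from
  \<open>2\<close> to \<open>n - k + 1\<close> revolve. Therefore the strand \<open>i\<close> is
  linked with no other strand in \<open>\<Psi>\<close> if \<open>i \<ge> n - k + 2\<close>. If the
  classes of \<open>v\<close> in \<open>\<Phi>\<close> and of \<open>u\<close> in
  \<open>\<Psi>\<close> are conjugate by a braid with permutation \<open>p\<close>, then the strand
  \<open>p i\<close> is linked with no other strand in the former. But every point smaller than
  \<open>n\<close> which revolves round \<open>n\<close> is linked with \<open>n\<close> as well as
  with \<open>n - 1\<close>, unless it is \<open>n - 1\<close> itself. So \<open>v = 0\<close>, the
  conjugate braid is trivial, and \<open>u = 0\<close> as well.\<close>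

proposition free_torus_action:
  assumes "n \<ge> 2" and k: "2 \<le> k" "k \<le> n"
    and H: "\<And>p. p \<in> G \<Longrightarrow> \<exists>i. n - k + 2 \<le> i \<and> i \<le> n \<and> (p i = n \<or> p i = n - 1)"
  obtains \<Phi> \<Psi> where
    "continuous_map euclidean X \<Phi>" "\<Phi> (\<lambda>_. 0) = x0"
    "\<And>x v. \<forall>j<n - 1. v j \<in> \<int> \<Longrightarrow> \<Phi> (\<lambda>j. x j + v j) = \<Phi> x"
    "continuous_map euclidean X \<Psi>" "\<Psi> (\<lambda>_. 0) = x0"
    "\<And>x v. \<forall>j<n - k. v j \<in> \<int> \<Longrightarrow> \<Psi> (\<lambda>j. x j + v j) = \<Psi> x"
    "\<And>v u c. \<forall>j<n - 1. v j \<in> \<int> \<Longrightarrow> \<forall>j<n - k. u j \<in> \<int> \<Longrightarrow> loop_at X x0 c \<Longrightarrow>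
       loop_homotopic X x0 (loop_concat (ray \<Phi> v) c) (loop_concat c (ray \<Psi> u)) \<Longrightarrow>
       (\<forall>j<n - 1. v j = 0) \<and> (\<forall>j<n - k. u j = 0)"
proof -
  have inj_n: "inj_on (\<lambda>i. \<bar>real i - real n\<bar>) {1..n}" by (rule inj_onI) auto
  have inj_1: "inj_on (\<lambda>i. \<bar>real i - real 1\<bar>) {1..n}" by (rule inj_onI) auto
  obtain \<Phi> where \<Phi>: "continuous_map euclidean X \<Phi>"
    "\<And>x v. \<forall>j<n - 1. v j \<in> \<int> \<Longrightarrow> \<Phi> (\<lambda>j. x j + v j) = \<Phi> x"
    "\<Phi> (\<lambda>_. 0) = x0"
    "\<And>v. \<forall>j<n - 1. v j \<in> \<int> \<Longrightarrow> perm_of (ray \<Phi> v) = id"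
    "\<And>v i j. \<forall>j<n - 1. v j \<in> \<int> \<Longrightarrow> i \<in> {1..n} \<Longrightarrow> j \<in> {1..n} \<Longrightarrow> i \<noteq> j \<Longrightarrow>
       link_of (ray \<Phi> v) i j = of_real (\<Sum>l<n - 1. if outer n i j = l + 1 then v l else 0)"
    by (rule planetary_torus[OF inj_n, of "n - 1" "\<lambda>l. l + 1"]) (rule that)
  obtain \<Psi> where \<Psi>: "continuous_map euclidean X \<Psi>"
    "\<And>x v. \<forall>j<n - k. v j \<in> \<int> \<Longrightarrow> \<Psi> (\<lambda>j. x j + v j) = \<Psi> x"
    "\<Psi> (\<lambda>_. 0) = x0"
    "\<And>v. \<forall>j<n - k. v j \<in> \<int> \<Longrightarrow> perm_of (ray \<Psi> v) = id"
    "\<And>v i j. \<forall>j<n - k. v j \<in> \<int> \<Longrightarrow> i \<in> {1..n} \<Longrightarrow> j \<in> {1..n} \<Longrightarrow> i \<noteq> j \<Longrightarrow>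
       link_of (ray \<Psi> v) i j = of_real (\<Sum>l<n - k. if outer 1 i j = l + 2 then v l else 0)"
    by (rule planetary_torus[OF inj_1, of "n - k" "\<lambda>l. l + 2"]) (rule that)
  have free: "(\<forall>j<n - 1. v j = 0) \<and> (\<forall>j<n - k. u j = 0)"
    if v: "\<forall>j<n - 1. v j \<in> \<int>" and u: "\<forall>j<n - k. u j \<in> \<int>" and c: "loop_at X x0 c"
      and conj: "loop_homotopic X x0 (loop_concat (ray \<Phi> v) c) (loop_concat c (ray \<Psi> u))" for v u c
  proof -
    have v_at: "loop_at X x0 (ray \<Phi> v)"
      using \<Phi>(2)[OF v, of "\<lambda>_. 0"] \<Phi>(3) by (intro ray_loop \<Phi>(1,3)) simp
    have u_at: "loop_at X x0 (ray \<Psi> u)"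
      using \<Psi>(2)[OF u, of "\<lambda>_. 0"] \<Psi>(3) by (intro ray_loop \<Psi>(1,3)) simp
    define p where "p = perm_of c"
    have p_perm: "p permutes {1..n}" unfolding p_def by (rule perm_of_permutes[OF c])
    have link_v: "link_of (ray \<Phi> v) i j = of_real (v (min i j - 1))" if "i \<in> {1..n}" "j \<in> {1..n}" "i \<noteq> j" for i j
    proof -
      have "outer n i j = min i j" "1 \<le> min i j" "min i j < 1 + (n - 1)"
        using that outer_last[of i j] by auto
      then show ?thesis using \<Phi>(5)[OF v that] by (simp only: sum_single) simp
    qed
    have link_u: "link_of (ray \<Psi> u) i j = of_real (if max i j \<le> n - k + 1 then u (max i j - 2) else 0)"
      if "i \<in> {1..n}" "j \<in> {1..n}" "i \<noteq> j" for i j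
    proof -
      have "outer 1 i j = max i j" "2 \<le> max i j" "max i j < 2 + (n - k) \<longleftrightarrow> max i j \<le> n - k + 1"
        using that outer_first[of i j] by auto
      then show ?thesis using \<Psi>(5)[OF u that] by (simp only: sum_single) simp
    qed
    have link_conj: "link_of (ray \<Psi> u) i j = link_of (ray \<Phi> v) (p i) (p j)"
      if "i \<in> {1..n}" "j \<in> {1..n}" "i \<noteq> j" for i j
      unfolding p_def by (rule linking_conjugate[OF v_at u_at c conj \<Psi>(4)[OF u] that])
    obtain i where i: "n - k + 2 \<le> i" "i \<le> n" "p i = n \<or> p i = n - 1"
      using H[OF braid_of_carrier(3)[OF c]] unfolding p_def by blast
    have unlinked: "link_of (ray \<Phi> v) (p i) q = 0" if q: "q \<in> {1..n}" "q \<noteq> p i" for q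
    proof -
      obtain j where j: "q = p j" "j \<in> {1..n}"
      proof -
        have "q \<in> p ` {1..n}" unfolding permutes_image[OF p_perm] by (rule q(1))
        then show thesis by (rule imageE) (rule that)
      qed
      have ij: "i \<in> {1..n}" "j \<in> {1..n}" "i \<noteq> j" using i j q by auto
      have "\<not> max i j \<le> n - k + 1" using i(1) by auto
      then have "link_of (ray \<Psi> u) i j = 0" unfolding link_u[OF ij] by (simp only: if_False of_real_0)
      then show ?thesis unfolding j(1) link_conj[OF ij, symmetric] .
    qed
    have pi: "p i \<in> {1..n}" using permutes_in_image[OF p_perm, of i] i by auto
    have v0: "v l = 0" if l: "l < n - 1" for l
    proof -
      \<comment> \<open>a strand whose linking number with \<open>p i\<close> is \<open>v l\<close>\<close>
      define q where "q = (if p i = l + 1 then n else l + 1)"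
      have q: "q \<in> {1..n} \<and> q \<noteq> p i \<and> min (p i) q = l + 1"
      proof -
        show "q \<in> {1..n} \<and> q \<noteq> p i \<and> min (p i) q = l + 1"
        proof (cases "p i = l + 1")
          case True
          then have "q = n" "l + 1 < n" using l i(3) by (simp_all add: q_def)
          with True show ?thesis by simp
        next
          case False
          then have "q = l + 1" by (simp add: q_def)
          moreover have "l + 1 < p i" using i(3) l False by linarith
          moreover have "l + 1 \<le> n" using l by linarith
          ultimately show ?thesis by simp
        qed
      qed
      note q = conjunct1[OF q] conjunct1[OF conjunct2[OF q]] conjunct2[OF conjunct2[OF q]]
      have "of_real (v l) = (0 :: complex)"
        using unlinked[OF q(1,2)] unfolding link_v[OF pi q(1) q(2)[symmetric]] q(3) by simp
      then show ?thesis by (simp only: of_real_eq_0_iff)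
    qed
    have u0: "u l = 0" if l: "l < n - k" for l
    proof -
      have ij: "1 \<in> {1..n}" "l + 2 \<in> {1..n}" "1 \<noteq> l + 2" using l k by auto
      have pj: "p 1 \<in> {1..n}" "p (l + 2) \<in> {1..n}" "p 1 \<noteq> p (l + 2)"
        using permutes_in_image[OF p_perm] ij permutes_inj[OF p_perm] by (auto dest: injD)
      have "min (p 1) (p (l + 2)) - 1 < n - 1" using pj by (auto simp: min_def)
      then have "v (min (p 1) (p (l + 2)) - 1) = 0" by (rule v0)
      then have "link_of (ray \<Phi> v) (p 1) (p (l + 2)) = 0"
        unfolding link_v[OF pj] by (simp only: of_real_0)
      then have unlinked': "link_of (ray \<Psi> u) 1 (l + 2) = 0" unfolding link_conj[OF ij] .
      have outermost: "max 1 (l + 2) = l + 2" and moving: "l + 2 \<le> n - k + 1"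
        and index: "l + 2 - 2 = l"
        using l by linarith+
      have "of_real (u l) = (0 :: complex)"
        using unlinked' unfolding link_u[OF ij] outermost if_P[OF moving] index .
      then show ?thesis by (simp only: of_real_eq_0_iff)
    qed
    show ?thesis using v0 u0 by blast
  qed
  show thesis by (rule that[OF \<Phi>(1,3,2) \<Psi>(1,3,2) free]) assumption+
qed

text \<open>The torus \<open>\<Phi>\<close> in the first \<open>m - 1\<close> factors and
  \<open>\<Psi>\<close> in the last one form a torus of dimension \<open>d\<close> in the power
  space. If \<open>d\<close> open sets with local sections were enough, the preimage of one of them
  would contain a path from a point to its translate by some \<open>v \<noteq> 0\<close>. The
  section over the path is a family of paths in \<open>X\<close>, whose parts between the moments
  \<open>j / (m - 1)\<close> and \<open>1\<close> show that the \<open>j\<close>-th block of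
  \<open>v\<close> in \<open>\<Phi>\<close> is conjugate to the last block of \<open>v\<close> in
  \<open>\<Psi>\<close>. By the previous proposition all blocks vanish.\<close>

theorem higher_TC_lower_bound:
  assumes m: "m \<ge> 2" and n: "n \<ge> 2" and k: "2 \<le> k" "k \<le> n"
    and H: "\<And>p. p \<in> G \<Longrightarrow> \<exists>i. n - k + 2 \<le> i \<and> i \<le> n \<and> (p i = n \<or> p i = n - 1)"
  shows "enat ((m - 1) * (n - 1) + (n - k)) \<le> higher_TC m X"
proof (rule ccontr)
  define d where "d = (m - 1) * (n - 1) + (n - k)"
  assume "\<not> enat ((m - 1) * (n - 1) + (n - k)) \<le> higher_TC m X"
  then have "higher_TC m X < enat d" by (simp add: d_def not_le)
  then obtain e U where e: "e < d"
    and U: "\<forall>i\<le>e. openin (power_space m X) (U i) \<and> has_local_section m X (U i)"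
      "(\<Union>i\<le>e. U i) = topspace (power_space m X)"
    unfolding higher_TC_def Inf_less_iff by auto
  obtain \<Phi> \<Psi> where \<Phi>: "continuous_map euclidean X \<Phi>" "\<Phi> (\<lambda>_. 0) = x0"
      "\<And>x v. \<forall>j<n - 1. v j \<in> \<int> \<Longrightarrow> \<Phi> (\<lambda>j. x j + v j) = \<Phi> x"
    and \<Psi>: "continuous_map euclidean X \<Psi>" "\<Psi> (\<lambda>_. 0) = x0"
      "\<And>x v. \<forall>j<n - k. v j \<in> \<int> \<Longrightarrow> \<Psi> (\<lambda>j. x j + v j) = \<Psi> x"
    and free: "\<And>v u c. \<forall>j<n - 1. v j \<in> \<int> \<Longrightarrow> \<forall>j<n - k. u j \<in> \<int> \<Longrightarrow> loop_at X x0 c \<Longrightarrow>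
       loop_homotopic X x0 (loop_concat (ray \<Phi> v) c) (loop_concat c (ray \<Psi> u)) \<Longrightarrow>
       (\<forall>j<n - 1. v j = 0) \<and> (\<forall>j<n - k. u j = 0)"
    by (rule free_torus_action[OF n k H]) (assumption, rule that)
  \<comment> \<open>the \<open>j\<close>-th block of coordinates; the last one consists of the
    \<open>n - k\<close> coordinates that remain\<close>
  define b where "b j x = (\<lambda>i. x (j * (n - 1) + i) :: real)" for j :: nat and x :: "nat \<Rightarrow> real"
  define F where "F j x = (if j < m - 1 then \<Phi> (b j x) else \<Psi> (b j x))" for j x
  have b_int: "\<forall>i<n - 1. b j v i \<in> \<int>" if v: "v \<in> int_vectors d" and j: "j < m - 1" for v j
  proof -
    have "j * (n - 1) + i < d" if "i < n - 1" for i
    proof -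
      have "j * (n - 1) + i < Suc j * (n - 1)" using that by simp
      also have "\<dots> \<le> (m - 1) * (n - 1)" by (rule mult_le_mono1[OF Suc_leI[OF j]])
      finally show ?thesis by (simp add: d_def)
    qed
    then show ?thesis using v by (simp add: b_def int_vectors_def)
  qed
  have b_int_last: "\<forall>i<n - k. b (m - 1) v i \<in> \<int>" if "v \<in> int_vectors d" for v
    using that by (simp add: b_def int_vectors_def d_def)
  have F_cont: "continuous_map euclidean X (F j)" for j
  proof -
    have u: "continuous_on UNIV (\<lambda>x. b j x i)" for i unfolding b_def by (rule continuous_on_product_coordinates)
    have "continuous_map (top_of_set UNIV) X (\<lambda>x. \<Phi> (b j x))" "continuous_map (top_of_set UNIV) X (\<lambda>x. \<Psi> (b j x))"
      by (rule continuous_map_plane[OF \<Phi>(1) u], rule continuous_map_plane[OF \<Psi>(1) u])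
    then show ?thesis unfolding F_def by (cases "j < m - 1") simp_all
  qed
  have F_zero: "F j (\<lambda>_. 0) = x0" for j using \<Phi>(2) \<Psi>(2) by (simp add: F_def b_def)
  have F_per: "F j (\<lambda>i. x i + v i) = F j x" if v: "v \<in> int_vectors d" and j: "j < m" for j x v
  proof (cases "j < m - 1")
    case True
    then show ?thesis using \<Phi>(3)[OF b_int[OF v True], of "b j x"] by (simp add: F_def b_def)
  next
    case False
    then have "j = m - 1" using j by simp
    then show ?thesis using \<Psi>(3)[OF b_int_last[OF v], of "b j x"] by (simp add: F_def b_def)
  qed
  define FF where "FF x = (\<lambda>j\<in>{..<m}. F j x)" for x
  have FF_cont: "continuous_map euclidean (power_space m X) FF"
    unfolding power_space_def FF_def
  proof (rule continuous_map_coordinatewise_then_product)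
    show "continuous_map euclidean X (\<lambda>x. (\<lambda>j\<in>{..<m}. F j x) i)" if "i \<in> {..<m}" for i
      using F_cont[of i] that by simp
  qed simp
  have FF_per: "FF (translate v x) = FF x" if "v \<in> int_vectors d" for v x
    unfolding FF_def translate_def using F_per[OF that] by (intro restrict_ext) simp
  define W where "W i = {x. FF x \<in> U i}" for i
  have "\<exists>i x v. i \<le> e \<and> v \<in> int_vectors d \<and> v \<noteq> (\<lambda>_. 0) \<and> path_component (W i) x (translate v x)"
  proof (rule periodic_open_cover[OF _ _ _ e])
    show "open (W i)" if "i \<le> e" for i
    proof -
      have "openin (power_space m X) (U i)" using U(1) that by simp
      then have "openin euclidean {x \<in> topspace euclidean. FF x \<in> U i}"
        by (rule openin_continuous_map_preimage[OF FF_cont])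
      then have "openin euclidean (W i)" unfolding W_def by simp
      then show ?thesis by (rule open_openin[THEN iffD2])
    qed
    show "\<exists>i\<le>e. x \<in> W i" for x
    proof -
      have "FF x \<in> topspace (power_space m X)"
        by (rule continuous_map_image_subset_topspace[OF FF_cont, THEN subsetD, OF imageI]) (simp only: topspace_euclidean UNIV_I)
      then have "FF x \<in> (\<Union>i\<le>e. U i)" by (simp only: U(2))
      then obtain i where "i \<le> e" "FF x \<in> U i" unfolding UN_iff atMost_iff by (elim bexE) (rule that, simp_all only: atMost_iff)
      then show ?thesis unfolding W_def mem_Collect_eq by (intro exI conjI)
    qed
    show "translate v x \<in> W i" if "x \<in> W i" "v \<in> int_vectors d" for i x v
      using that(1) unfolding W_def mem_Collect_eq FF_per[OF that(2)] .
  qed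
  then obtain i x v where i: "i \<le> e" and v: "v \<in> int_vectors d" "v \<noteq> (\<lambda>_. 0)"
    and pc: "path_component (W i) x (translate v x)"
    by (elim exE conjE) (rule that)
  obtain \<omega> where \<omega>: "path \<omega>" "path_image \<omega> \<subseteq> W i" "pathstart \<omega> = x" "pathfinish \<omega> = translate v x"
    using pc by (auto simp: path_component_def)
  have \<omega>_cont: "continuous_on {0..1} \<omega>" using \<omega>(1) by (simp add: path_def)
  have \<omega>_end: "\<omega> 1 = (\<lambda>i. \<omega> 0 i + v i)" using \<omega>(3,4) by (simp add: pathstart_def pathfinish_def translate_def)
  have \<omega>_W: "FF (\<omega> t) \<in> U i" if "t \<in> {0..1}" for t
  proof -
    have "\<omega> t \<in> path_image \<omega>" unfolding path_image_def using that by (rule imageI)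
    then have "\<omega> t \<in> W i" by (rule subsetD[OF \<omega>(2)])
    then show ?thesis by (simp add: W_def)
  qed
  obtain s where s: "continuous_map (subtopology (power_space m X) (U i)) (free_path_space X) s"
    "\<And>y. y \<in> U i \<Longrightarrow> path_fibration m (s y) = y"
  proof -
    have "has_local_section m X (U i)" using U(1) i by simp
    then show thesis unfolding has_local_section_def by (elim exE conjE) (rule that, assumption, drule (1) bspec)
  qed
  define \<sigma> where "\<sigma> = (\<lambda>t. s (FF (\<omega> t)))"
  have "continuous_map (top_of_set UNIV) (power_space m X) FF" using FF_cont by simp
  from continuous_map_set_compose[OF this \<omega>_cont]
  have "continuous_map (top_of_set {0..1}) (subtopology (power_space m X) (U i)) (\<lambda>t. FF (\<omega> t))"
    using \<omega>_W by (simp add: continuous_map_in_subtopology Pi_iff)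
  from continuous_map_compose[OF this s(1)]
  have "continuous_map (top_of_set {0..1}) (free_path_space X) \<sigma>"
    unfolding o_def \<sigma>_def .
  note ev = path_space_evaluation[OF this]
  have \<sigma>_val: "\<sigma> t (real j / real (m - 1)) = F j (\<omega> t)" if "t \<in> {0..1}" "j < m" for t j
  proof -
    have "path_fibration m (\<sigma> t) j = FF (\<omega> t) j" using s(2)[OF \<omega>_W[OF that(1)]] by (simp add: \<sigma>_def)
    then show ?thesis using that(2) by (simp add: path_fibration_def FF_def)
  qed
  have \<sigma>_sym: "\<sigma> 0 = \<sigma> 1"
    using FF_per[OF v(1), of "\<omega> 0"] \<omega>_end by (simp add: \<sigma>_def translate_def)
  have ray_F: "ray (F j) v = (if j < m - 1 then ray \<Phi> (b j v) else ray \<Psi> (b j v))" for j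
    by (auto simp: ray_def F_def b_def fun_eq_iff)
  have block: "(\<forall>l<n - 1. b j v l = 0) \<and> (\<forall>l<n - k. b (m - 1) v l = 0)" if j: "j < m - 1" for j
  proof -
    \<comment> \<open>the affine map from the unit interval onto \<open>[j / (m - 1), 1]\<close>\<close>
    define \<eta> where "\<eta> u = (real j + (real (m - 1) - real j) * u) / real (m - 1)" for u
    have m1: "real (m - 1) > 0" "real j \<le> real (m - 1)" using m j by auto
    have \<eta>01: "\<eta> u \<in> {0..1}" if "u \<in> {0..1}" for u
    proof -
      have "(real (m - 1) - real j) * u \<le> (real (m - 1) - real j) * 1"
        using that m1 by (intro mult_left_mono) auto
      moreover have "0 \<le> (real (m - 1) - real j) * u" using that m1 by simp
      ultimately show ?thesis using m1 by (simp add: \<eta>_def)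
    qed
    have \<eta>_ends: "\<eta> 0 = real j / real (m - 1)" "\<eta> 1 = real (m - 1) / real (m - 1)"
      by (simp_all add: \<eta>_def)
    define K where "K = (\<lambda>z. \<sigma> (snd z) (\<eta> (fst z)))"
    have "continuous_on ({0..1::real} \<times> {0..1::real}) (\<lambda>z. (snd z, \<eta> (fst z)))"
      unfolding \<eta>_def using m1 by (intro continuous_intros) auto
    from continuous_map_set_compose[OF ev this]
    have K: "continuous_map (top_of_set ({0..1::real} \<times> {0..1::real})) X K"
      using \<eta>01 by (simp add: K_def mem_Times_iff)
    have jm: "j < m" "m - 1 < m" using j by auto
    have K_ends: "K (0, t) = F j (\<omega> t) \<and> K (1, t) = F (m - 1) (\<omega> t)" if "t \<in> {0..1}" for t
      using \<sigma>_val[OF that jm(1)] \<sigma>_val[OF that jm(2)] by (simp only: K_def fst_conv snd_conv \<eta>_ends)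
    have K_sym: "K (u, 0) = K (u, 1)" for u by (simp add: K_def \<sigma>_sym)
    obtain c where c: "loop_at X x0 c"
      "loop_homotopic X x0 (loop_concat (ray (F j) v) c) (loop_concat c (ray (F (m - 1)) v))"
      by (rule conjugate_rays[OF F_cont F_zero F_per[OF v(1) jm(1)] F_cont F_zero F_per[OF v(1) jm(2)]
            \<omega>_cont \<omega>_end K K_ends K_sym]) (assumption, rule that)
    show ?thesis
      by (rule free[OF b_int[OF v(1) j] b_int_last[OF v(1)] c(1)]) (use c(2) j in \<open>simp add: ray_F\<close>)
  qed
  have "v l = 0" for l
  proof -
    consider "l < (m - 1) * (n - 1)" | "(m - 1) * (n - 1) \<le> l" "l < d" | "d \<le> l" by linarith
    then show ?thesis
    proof cases
      case 1
      have "l div (n - 1) < m - 1" using 1 n by (simp add: less_mult_imp_div_less)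
      moreover have "l mod (n - 1) < n - 1" using n by simp
      ultimately have "b (l div (n - 1)) v (l mod (n - 1)) = 0" using block by blast
      then show ?thesis unfolding b_def div_mult_mod_eq .
    next
      case 2
      have "0 < m - 1" using m by simp
      moreover have "l - (m - 1) * (n - 1) < n - k" using 2 by (simp add: d_def)
      ultimately have "b (m - 1) v (l - (m - 1) * (n - 1)) = 0" using block by blast
      then show ?thesis using 2(1) by (simp add: b_def)
    next
      case 3
      then show ?thesis using v(1) by (simp add: int_vectors_def)
    qed
  qed
  then have "v = (\<lambda>_. 0)" by (rule ext)
  with v(2) show False by contradiction
qed

end

theorem theorem6p4:
  fixes m n :: nat and G :: "(nat \<Rightarrow> nat) set" and X :: "'x topology"
  assumes "m \<ge> 2" and "n \<ge> 2"
    and "subgroup G (sym_group n)"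
    and "Eilenberg_MacLane_1 (braid_subgroup n G) X"
  shows "(\<forall>k::nat. 2 \<le> k \<and> k \<le> n - 1 \<and> G \<subseteq> sym_partition_subgroup n k \<longrightarrow>
            higher_TC m X \<ge> enat (m * (n - 1) - k + 1)) \<and>
         (G \<subseteq> sym_fix_last_subgroup n \<longrightarrow>
            higher_TC m X \<ge> enat (m * (n - 1) - 1))"
proof -
  obtain x0 where x0: "x0 \<in> topspace X" "homotopy_group 1 X x0 \<cong> braid_subgroup n G"
    "\<forall>k\<ge>2. trivial_group (homotopy_group k X x0)"
    using assms(4) unfolding Eilenberg_MacLane_1_def by blast
  obtain \<phi> where \<phi>: "\<phi> \<in> iso (homotopy_group 1 X x0) (braid_subgroup n G)"
    using x0(2) unfolding is_iso_def by blast
  have asph: "trivial_group (homotopy_group k X x0)" if "k \<ge> 2" for k using x0(3) that by simp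
  interpret aspherical_braid_space n G X x0 \<phi>
    by (rule aspherical_braid_space.intro[OF assms(3) x0(1) \<phi> asph])
  have block: "m * (n - 1) = (m - 1) * (n - 1) + (n - 1)" using assms(1) by (cases m) simp_all
  show ?thesis
  proof (intro conjI allI impI)
    fix k assume k: "2 \<le> k \<and> k \<le> n - 1 \<and> G \<subseteq> sym_partition_subgroup n k"
    have "\<exists>i. n - k + 2 \<le> i \<and> i \<le> n \<and> (p i = n \<or> p i = n - 1)" if p: "p \<in> G" for p
    proof -
      have "p \<in> sym_partition_subgroup n k" using k p by blast
      then have image: "p ` {n - k + 1..n} = {n - k + 1..n}" by (simp add: sym_partition_subgroup_def)
      have "n \<in> {n - k + 1..n}" "n - 1 \<in> {n - k + 1..n}" using k assms(2) by auto
      then obtain i j where i: "i \<in> {n - k + 1..n}" "p i = n" and j: "j \<in> {n - k + 1..n}" "p j = n - 1"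
      proof -
        from \<open>n \<in> _\<close> have "n \<in> p ` {n - k + 1..n}" unfolding image .
        then obtain i where "i \<in> {n - k + 1..n}" "n = p i" by (rule imageE)
        moreover from \<open>n - 1 \<in> _\<close> have "n - 1 \<in> p ` {n - k + 1..n}" unfolding image .
        then obtain j where "j \<in> {n - k + 1..n}" "n - 1 = p j" by (rule imageE)
        ultimately show thesis by (metis that)
      qed
      \<comment> \<open>Of two different points, one is not the first of the last \<open>k\<close> points.\<close>
      have "i \<noteq> j" using i j assms(2) by auto
      then have "n - k + 2 \<le> i \<or> n - k + 2 \<le> j" using i(1) j(1) by auto
      then show ?thesis using i j by auto
    qed
    then have "enat ((m - 1) * (n - 1) + (n - k)) \<le> higher_TC m X"
      using k by (intro higher_TC_lower_bound[OF assms(1,2)]) auto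
    moreover have "(m - 1) * (n - 1) + (n - k) = m * (n - 1) - k + 1"
      unfolding block using k by arith
    ultimately show "enat (m * (n - 1) - k + 1) \<le> higher_TC m X" by simp
  next
    assume G: "G \<subseteq> sym_fix_last_subgroup n"
    have "p n = n" if "p \<in> G" for p using G that by (auto simp: sym_fix_last_subgroup_def)
    then have "enat ((m - 1) * (n - 1) + (n - 2)) \<le> higher_TC m X"
      using assms(2) by (intro higher_TC_lower_bound[OF assms(1,2)]) (auto intro!: exI[of _ n])
    moreover have "(m - 1) * (n - 1) + (n - 2) = m * (n - 1) - 1"
      unfolding block using assms(2) by arith
    ultimately show "enat (m * (n - 1) - 1) \<le> higher_TC m X" by simp
  qed
qed

end
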